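(* Let $\beta=1$ or $2$. Let $(E_N)_{N\in\mathbb{N}}$ be real diagonal $N\times N$ matrices such that $\hat\mu^N_{E_N}$ converges weakly to a compactly supported probability measure $\mu_E$ and such that $\lambda_{\min}(E_N)$ and $\lambda_{\max}(E_N)$ converge to finite limits $\lambda_{\min}$ and $\lambda_{\max}$ respectively. Let $H_{\min}:=\lim_{z\uparrow\lambda_{\min}}H_{\mu_E}(z)$ and $H_{\max}:=\lim_{z\downarrow\lambda_{\max}}H_{\mu_E}(z)$. Then for every $\theta\in\mathbb{R}$, $$\lim_{N\to\infty}\frac1N\log I_N^{(\beta)}(\theta,E_N)=\theta v(\theta)-\frac\beta2\int\log\Big(1+\frac2\beta\theta v(\theta)-\frac2\beta\theta\lambda\Big)\,d\mu_E(\lambda),$$ with $$v(\theta)=\begin{cases}R_{\mu_E}\big(\frac2\beta\theta\big)&\text{if }H_{\min}\le\frac{2\theta}\beta\le H_{\max},\\[2pt]\lambda_{\max}-\frac{\beta}{2\theta}&\text{if }\frac{2\theta}\beta>H_{\max},\\[2pt]\lambda_{\min}-\frac{\beta}{2\theta}&\text{if }\frac{2\theta}\beta<H_{\min}.\end{cases}$$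
   Context: $m_N^{(1)}$ is the Haar probability measure on the orthogonal group $O_N$ and $m_N^{(2)}$ that on the unitary group $U_N$; $I_N^{(\beta)}(\theta,E_N)=\int e^{\theta N(UE_NU^* )_{11}}\,dm_N^{(\beta)}(U)$. $\hat\mu^N_{E_N}=\frac1N\sum_i\delta_{\lambda_i(E_N)}$, where $\lambda_i(E_N)$ are the eigenvalues of $E_N$, with minimum $\lambda_{\min}(E_N)$ and maximum $\lambda_{\max}(E_N)$. Note $\mathrm{supp}(\mu_E)\subset[\lambda_{\min},\lambda_{\max}]$. $H_{\mu_E}(z)=\int\frac1{z-\lambda}\,d\mu_E(\lambda)$ for $z\in\mathbb{R}\setminus\mathrm{supp}(\mu_E)$. $H_{\min}\in(-\infty,0)\cup\{-\infty\}$ and $H_{\max}\in(0,\infty)\cup\{+\infty\}$. $H_{\mu_E}$ is a bijection from $\mathbb{R}\setminus[\lambda_{\min},\lambda_{\max}]$ onto $(H_{\min},H_{\max})\setminus\{0\}$ with inverse $K_{\mu_E}$, and $R_{\mu_E}(\gamma)=K_{\mu_E}(\gamma)-\frac1\gamma$ on $(H_{\min},H_{\max})\setminus\{0\}$. $R_{\mu_E}$ is extended by continuity: $R_{\mu_E}(0)=\int\lambda\,d\mu_E(\lambda)$, and, when $H_{\max}$ (resp. $H_{\min}$) is finite, $R_{\mu_E}(H_{\max})=\lambda_{\max}-1/H_{\max}$ (resp. $R_{\mu_E}(H_{\min})=\lambda_{\min}-1/H_{\min}$). *)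

theory Defs
  imports
    "HOL-Probability.Probability"
    "Jordan_Normal_Form.Schur_Decomposition"
    "Jordan_Normal_Form.Spectral_Radius"
begin

(* Conjugation on real is the identity, so this is O_N at type real mat and U_N at
   type complex mat. *)
definition unitary_group :: "nat \<Rightarrow> 'a :: conjugatable_field mat set" where
  "unitary_group N = {U \<in> carrier_mat N N. U * mat_adjoint U = 1\<^sub>m N}"

(* The type of matrices carries no topology; the Borel sets of the group are the traces of the
   Borel sets of the N^2-dimensional space of entries. *)
definition unitary_borel :: "nat \<Rightarrow> 'a :: {conjugatable_field, topological_space} mat measure" where
  "unitary_borel N =
     vimage_algebra (unitary_group N)
       (\<lambda>U. \<lambda>ij\<in>{..<N} \<times> {..<N}. U $$ ij)
       (\<Pi>\<^sub>M ij\<in>{..<N} \<times> {..<N}. borel)"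

definition haar_prob :: "nat \<Rightarrow> 'a :: {conjugatable_field, topological_space} mat measure \<Rightarrow> bool" where
  "haar_prob N M \<longleftrightarrow>
     prob_space M \<and> sets M = sets (unitary_borel N) \<and>
     (\<forall>A\<in>unitary_group N. distr M M (\<lambda>U. A * U) = M)"

(* Matrix indices start at 0, so (0, 0) is the entry usually indexed (1,1). *)
definition orthogonal_integral :: "real mat measure \<Rightarrow> nat \<Rightarrow> real \<Rightarrow> real mat \<Rightarrow> real" where
  "orthogonal_integral M N \<theta> E =
     (\<integral>U. exp (\<theta> * real N * (U * E * mat_adjoint U) $$ (0, 0)) \<partial>M)"

(* U E U^* is Hermitian, so taking Re of its diagonal entry loses nothing. *)
definition unitary_integral :: "complex mat measure \<Rightarrow> nat \<Rightarrow> real \<Rightarrow> real mat \<Rightarrow> real" where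
  "unitary_integral M N \<theta> E =
     (\<integral>U. exp (\<theta> * real N *
        Re ((U * map_mat complex_of_real E * mat_adjoint U) $$ (0, 0))) \<partial>M)"

(* Eigenvalues are counted with multiplicity, as roots of the characteristic polynomial. *)
definition empirical_spectral_measure :: "real mat \<Rightarrow> real measure" where
  "empirical_spectral_measure E =
     distr (measure_pmf (pmf_of_multiset (proots (char_poly E)))) borel (\<lambda>x. x)"

definition lambda_min :: "real mat \<Rightarrow> real" where
  "lambda_min E = Min (spectrum E)"

definition lambda_max :: "real mat \<Rightarrow> real" where
  "lambda_max E = Max (spectrum E)"

definition msupp :: "real measure \<Rightarrow> real set" where
  "msupp \<mu> = {x. \<forall>V. open V \<longrightarrow> x \<in> V \<longrightarrow> emeasure \<mu> V > 0}"

(* Only meaningful for z outside the support of \<mu>. *)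
definition hilbert_transform :: "real measure \<Rightarrow> real \<Rightarrow> real" where
  "hilbert_transform \<mu> z = (\<integral>x. 1 / (z - x) \<partial>\<mu>)"

(* In the following, a and b are the limits of the smallest and largest eigenvalues.
   They need not be the end points of the support of \<mu>. *)

definition H_min :: "real measure \<Rightarrow> real \<Rightarrow> ereal" where
  "H_min \<mu> a = Lim (at_left a) (\<lambda>z. ereal (hilbert_transform \<mu> z))"

definition H_max :: "real measure \<Rightarrow> real \<Rightarrow> ereal" where
  "H_max \<mu> b = Lim (at_right b) (\<lambda>z. ereal (hilbert_transform \<mu> z))"

definition K_transform :: "real measure \<Rightarrow> real \<Rightarrow> real \<Rightarrow> real \<Rightarrow> real" where
  "K_transform \<mu> a b = inv_into (- {a..b}) (hilbert_transform \<mu>)"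

(* Only meaningful for H_min <= \<gamma> <= H_max; the first three cases are the extension by
   continuity to 0 and to the finite end points. *)
definition R_transform :: "real measure \<Rightarrow> real \<Rightarrow> real \<Rightarrow> real \<Rightarrow> real" where
  "R_transform \<mu> a b \<gamma> =
     (if \<gamma> = 0 then \<integral>x. x \<partial>\<mu>
      else if ereal \<gamma> = H_max \<mu> b then b - 1 / \<gamma>
      else if ereal \<gamma> = H_min \<mu> a then a - 1 / \<gamma>
      else K_transform \<mu> a b \<gamma> - 1 / \<gamma>)"

definition v_fun :: "real \<Rightarrow> real measure \<Rightarrow> real \<Rightarrow> real \<Rightarrow> real \<Rightarrow> real" where
  "v_fun \<beta> \<mu> a b \<theta> =
     (if H_min \<mu> a \<le> ereal (2 * \<theta> / \<beta>) \<and> ereal (2 * \<theta> / \<beta>) \<le> H_max \<mu> b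
        then R_transform \<mu> a b (2 / \<beta> * \<theta>)
      else if ereal (2 * \<theta> / \<beta>) > H_max \<mu> b then b - \<beta> / (2 * \<theta>)
      else a - \<beta> / (2 * \<theta>))"

end

theory Submission
  imports Defs
begin

text \<open>Put \<alpha> = \<beta>/2 and \<gamma> = \<theta>/\<alpha>, and let l_j be the diagonal entries of E_N. The integrand depends on
the Haar matrix only through the weights w_j, the squared moduli of the entries of one row, so
the spherical integral is the Laplace transform at \<theta>N of the quadratic form q = (\<Sum>j. l_j w_j).

The moments of q can be computed exactly. Invariance under rotations in the plane of the
coordinates i and j, differentiated at angle 0, gives \<alpha> (E[w_j q^k] - E[w_i q^k]) + k (l_i -
l_j) E[w_i w_j q^(k-1)] = 0 (lemma \<open>exchange_identity\<close>). Summed against l_i^a this becomes a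
recursion which says that the numbers h_k = (N\<alpha>)(N\<alpha>+1)...(N\<alpha>+k-1) E[q^k] / k! satisfy Newton's
identities for the coefficients of the product of the (1 - l_j X)^(-\<alpha>). Hence
(\<open>moment_eq_spectral_coeff\<close>, \<open>expectation_exp_row\<close>) the integral is the sum over k of (\<theta>N)^k h_k
/ ((N\<alpha>)(N\<alpha>+1)...(N\<alpha>+k-1)).

For the asymptotics, reflecting E_N reduces \<theta> < 0 to \<theta> > 0, and a shift of the spectrum makes
all l_j nonnegative. For z above all l_j the numbers h_k z^(-k) are, up to the normalisation G,
the distribution of a random integer J, a sum of independent negative binomial variables. With w
= \<theta>Nz the series is G E[w^J / ((N\<alpha>)...(N\<alpha>+J-1))], and elementary bounds for the rising factorial
show that the function under the expectation is at most (1 + J/(N\<alpha>)) e^C and at least e^(C - (N\<alpha>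
+ J - w)^2/w), where C = w - N\<alpha> ln w + N\<alpha> ln (N\<alpha>) - N\<alpha>. The first bound gives, for every z above
the limit b of the largest eigenvalue, the upper bound F(z) = \<theta>z - \<alpha> - \<alpha> \<integral> ln (\<gamma>(z - x)) d\<mu>(x)
for the exponential growth rate (\<open>log_series_upper\<close>). Since the mean of N\<alpha> + J is about N\<alpha>zH(z)
and its variance is of order N, Jensen's inequality turns the second one into the matching lower
bound, provided that this mean is close to w, that is, H(z) = \<gamma>.

If \<gamma> is below the limit of H at b, there is such a z, namely z = K(\<gamma>). Otherwise J is too small
on average for every z > b. The missing amount n is supplied by the largest eigenvalue: its
factor (1 - l X)^(-\<alpha>) forces h(k + n) to be at least l^n h(k) up to a factor polynomial in n, so
shifting J by n costs only (l/z)^n (\<open>log_series_lower\<close>), and this loss disappears as z decreases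
to b (\<open>log_series_tendsto_edge\<close>). In every case the limit is F(z) at a point z with v(\<theta>) = z -
1/\<gamma>, which is the asserted formula.\<close>

section \<open>The power series of a product of negative binomial factors\<close>

text \<open>The binomial series of (1 - l X)^(-\<alpha>). For 0 < l < 1 its coefficients are proportional to the
weights of a negative binomial distribution.\<close>

definition nb_fps :: "real \<Rightarrow> real \<Rightarrow> real fps" where
  "nb_fps \<alpha> l = Abs_fps (\<lambda>k. pochhammer \<alpha> k / fact k * l ^ k)"

definition spectral_fps :: "real \<Rightarrow> nat \<Rightarrow> (nat \<Rightarrow> real) \<Rightarrow> real fps" where
  "spectral_fps \<alpha> N l = (\<Prod>j<N. nb_fps \<alpha> (l j))"

text \<open>This linear differential equation characterises the powers of 1 - l X; on coefficients it is the
ratio (\<alpha> + k)/(k + 1) of successive binomial coefficients.\<close>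

lemma nb_fps_ODE:
  "(1 - fps_const l * fps_X) * fps_deriv (nb_fps \<alpha> l) = fps_const (\<alpha> * l) * nb_fps \<alpha> l"
proof (rule fps_ext)
  fix k
  have eq: "real (Suc k) * (pochhammer \<alpha> (Suc k) / fact (Suc k)) = (\<alpha> + real k) * (pochhammer \<alpha> k / fact k)"
    by (simp add: pochhammer_Suc field_simps del: of_nat_Suc)
  have "fps_nth ((1 - fps_const l * fps_X) * fps_deriv (nb_fps \<alpha> l)) k
      = real (Suc k) * (pochhammer \<alpha> (Suc k) / fact (Suc k)) * l ^ Suc k
        - real k * (pochhammer \<alpha> k / fact k) * l ^ Suc k"
    by (cases k) (simp_all add: nb_fps_def algebra_simps del: fact_Suc of_nat_Suc)
  also have "\<dots> = \<alpha> * l * (pochhammer \<alpha> k / fact k * l ^ k)"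
    unfolding eq by (simp add: algebra_simps add_divide_distrib)
  finally show "fps_nth ((1 - fps_const l * fps_X) * fps_deriv (nb_fps \<alpha> l)) k
      = fps_nth (fps_const (\<alpha> * l) * nb_fps \<alpha> l) k"
    by (simp add: nb_fps_def)
qed

lemma nb_fps_deriv:
  "fps_deriv (nb_fps \<alpha> l) = fps_const \<alpha> * Abs_fps (\<lambda>i. l ^ Suc i) * nb_fps \<alpha> l"
proof -
  have geo: "(1 - fps_const l * fps_X) * Abs_fps (\<lambda>i. l ^ i) = 1"
  proof (rule fps_ext)
    fix k show "fps_nth ((1 - fps_const l * fps_X) * Abs_fps (\<lambda>i. l ^ i)) k = fps_nth 1 k"
      by (cases k) (simp_all add: algebra_simps)
  qed
  have "fps_deriv (nb_fps \<alpha> l)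
      = Abs_fps (\<lambda>i. l ^ i) * ((1 - fps_const l * fps_X) * fps_deriv (nb_fps \<alpha> l))"
    unfolding mult.assoc[symmetric] mult.commute[of "Abs_fps _"] geo by simp
  also have "\<dots> = fps_const \<alpha> * (fps_const l * Abs_fps (\<lambda>i. l ^ i)) * nb_fps \<alpha> l"
    unfolding nb_fps_ODE fps_const_mult[symmetric] by (simp only: mult_ac)
  also have "fps_const l * Abs_fps (\<lambda>i. l ^ i) = Abs_fps (\<lambda>i. l ^ Suc i)"
    by (rule fps_ext) simp
  finally show ?thesis .
qed

lemma spectral_fps_deriv:
  "fps_deriv (spectral_fps \<alpha> N l)
     = fps_const \<alpha> * Abs_fps (\<lambda>i. \<Sum>j<N. l j ^ Suc i) * spectral_fps \<alpha> N l"
proof (induction N)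
  case 0
  then show ?case by (simp add: spectral_fps_def) (simp add: fps_eq_iff)
next
  case (Suc N)
  have "Abs_fps (\<lambda>i. \<Sum>j<Suc N. l j ^ Suc i)
      = Abs_fps (\<lambda>i. \<Sum>j<N. l j ^ Suc i) + Abs_fps (\<lambda>i. l N ^ Suc i)"
    by (rule fps_ext) simp
  then show ?case using Suc.IH nb_fps_deriv[of \<alpha> "l N"]
    by (simp add: spectral_fps_def algebra_simps)
qed

definition spectral_coeff :: "real \<Rightarrow> nat \<Rightarrow> (nat \<Rightarrow> real) \<Rightarrow> nat \<Rightarrow> real" where
  "spectral_coeff \<alpha> N l k = fps_nth (spectral_fps \<alpha> N l) k"

lemma spectral_coeff_0 [simp]: "spectral_coeff \<alpha> N l 0 = 1"
  by (induction N) (simp_all add: spectral_coeff_def spectral_fps_def nb_fps_def)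

text \<open>Newton's identities: the coefficients of the logarithmic derivative of the product are \<alpha> times
the power sums of the l_j.\<close>

lemma spectral_coeff_newton:
  "real (Suc k) * spectral_coeff \<alpha> N l (Suc k)
     = \<alpha> * (\<Sum>i\<le>k. (\<Sum>j<N. l j ^ Suc i) * spectral_coeff \<alpha> N l (k - i))"
proof -
  have "real (Suc k) * spectral_coeff \<alpha> N l (Suc k)
      = \<alpha> * fps_nth (Abs_fps (\<lambda>i. \<Sum>j<N. l j ^ Suc i) * spectral_fps \<alpha> N l) k"
    using arg_cong[OF spectral_fps_deriv[of \<alpha> N l], of "\<lambda>F. fps_nth F k"]
    by (simp add: spectral_coeff_def mult.assoc)
  then show ?thesis
    by (simp only: fps_mult_nth fps_nth_Abs_fps atLeast0AtMost spectral_coeff_def)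
qed

lemma spectral_coeff_unique:
  assumes "T 0 = 1"
    and "\<And>k. real (Suc k) * T (Suc k) = \<alpha> * (\<Sum>i\<le>k. (\<Sum>j<N. l j ^ Suc i) * T (k - i))"
  shows "T k = spectral_coeff \<alpha> N l k"
proof (induction k rule: less_induct)
  case (less k)
  show ?case
  proof (cases k)
    case 0
    then show ?thesis using assms(1) by simp
  next
    case (Suc n)
    have "real (Suc n) * T (Suc n) = real (Suc n) * spectral_coeff \<alpha> N l (Suc n)"
      unfolding assms(2) spectral_coeff_newton using less Suc by simp
    then show ?thesis using Suc by simp
  qed
qed

lemma spectral_fps_remove:
  assumes "i < N"
  shows "spectral_fps \<alpha> N l = nb_fps \<alpha> (l i) * (\<Prod>j\<in>{..<N}-{i}. nb_fps \<alpha> (l j))"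
  unfolding spectral_fps_def using assms by (subst prod.remove[of _ i]) auto

lemma fps_prod_nonneg:
  fixes f :: "'b \<Rightarrow> real fps"
  assumes "finite A" "\<And>j k. j \<in> A \<Longrightarrow> 0 \<le> fps_nth (f j) k"
  shows "0 \<le> fps_nth (\<Prod>j\<in>A. f j) (k::nat)"
  using assms
  by (induction A arbitrary: k rule: finite_induct)
     (auto simp: fps_mult_nth intro!: sum_nonneg mult_nonneg_nonneg)

lemma nb_fps_nonneg: "0 < \<alpha> \<Longrightarrow> 0 \<le> l \<Longrightarrow> 0 \<le> fps_nth (nb_fps \<alpha> l) k"
  by (simp add: nb_fps_def pochhammer_nonneg)

lemma spectral_coeff_nonneg:
  "0 < \<alpha> \<Longrightarrow> (\<And>j. j < N \<Longrightarrow> 0 \<le> l j) \<Longrightarrow> 0 \<le> spectral_coeff \<alpha> N l k"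
  unfolding spectral_coeff_def spectral_fps_def by (intro fps_prod_nonneg nb_fps_nonneg) auto

text \<open>For \<alpha> at most 1 the ratios (\<alpha> + k)/(1 + k) of successive coefficients increase in k.\<close>

lemma pochhammer_over_fact_supermult:
  assumes "0 < \<alpha>" "\<alpha> \<le> (1::real)"
  shows "pochhammer \<alpha> i / fact i * (pochhammer \<alpha> m / fact m)
      \<le> pochhammer \<alpha> (i + m) / fact (i + m)"
proof (induction m)
  case 0
  then show ?case by simp
next
  case (Suc m)
  have step: "pochhammer \<alpha> (Suc n) / fact (Suc n)
      = pochhammer \<alpha> n / fact n * ((\<alpha> + real n) / (1 + real n))" for n
    by (simp add: pochhammer_Suc field_simps)
  have mono: "(\<alpha> + real m) / (1 + real m) \<le> (\<alpha> + real (i + m)) / (1 + real (i + m))"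
  proof -
    have "\<alpha> * real i \<le> 1 * real i" using assms by (intro mult_right_mono) auto
    then show ?thesis using assms by (simp add: divide_simps) (simp add: algebra_simps)
  qed
  have "pochhammer \<alpha> i / fact i * (pochhammer \<alpha> (Suc m) / fact (Suc m))
      = (pochhammer \<alpha> i / fact i * (pochhammer \<alpha> m / fact m)) * ((\<alpha> + real m) / (1 + real m))"
    by (simp only: step mult.assoc)
  also have "\<dots> \<le> pochhammer \<alpha> (i + m) / fact (i + m) * ((\<alpha> + real (i + m)) / (1 + real (i + m)))"
    using assms by (intro mult_mono Suc.IH mono) (auto intro!: divide_nonneg_nonneg pochhammer_nonneg)
  also have "\<dots> = pochhammer \<alpha> (i + Suc m) / fact (i + Suc m)"
    unfolding add_Suc_right step ..
  finally show ?case .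
qed

lemma pochhammer_over_fact_ge:
  assumes "0 < \<alpha>" "\<alpha> \<le> (1::real)"
  shows "\<alpha> / real (Suc m) \<le> pochhammer \<alpha> m / fact m"
proof (cases m)
  case 0
  then show ?thesis using assms by simp
next
  case (Suc n)
  have "\<alpha> / real (Suc n) \<le> pochhammer \<alpha> (Suc n) / fact (Suc n)"
  proof (induction n)
    case (Suc n)
    have "\<alpha> / real (Suc (Suc n)) \<le> \<alpha> / real (Suc n) * ((\<alpha> + real (Suc n)) / real (Suc (Suc n)))"
      using assms by (simp add: divide_simps)
    also have "\<dots> \<le> pochhammer \<alpha> (Suc n) / fact (Suc n) * ((\<alpha> + real (Suc n)) / real (Suc (Suc n)))"
      using assms by (intro mult_right_mono Suc.IH) auto
    also have "\<dots> = pochhammer \<alpha> (Suc (Suc n)) / fact (Suc (Suc n))"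
      by (simp add: pochhammer_Suc[of _ "Suc n"] fact_Suc[of "Suc n"] del: pochhammer_Suc fact_Suc of_nat_Suc)
    finally show ?case .
  qed simp
  moreover have "\<alpha> / real (Suc m) \<le> \<alpha> / real m"
    using assms Suc by (intro divide_left_mono) auto
  ultimately show ?thesis using Suc by simp
qed

text \<open>One factor of the product already keeps the coefficients from decaying faster than l_i^m: split
off the factor of l_i and shift its index. Applied to the largest eigenvalue, this is what
governs the regime where \<theta>/\<alpha> exceeds the limit of H at b.\<close>

lemma spectral_coeff_shift:
  assumes "0 < \<alpha>" "\<alpha> \<le> 1" "\<And>j. j < N \<Longrightarrow> 0 \<le> l j" "i < N"
  shows "pochhammer \<alpha> m / fact m * l i ^ m * spectral_coeff \<alpha> N l k \<le> spectral_coeff \<alpha> N l (k + m)"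
proof -
  define R where "R = (\<Prod>j\<in>{..<N}-{i}. nb_fps \<alpha> (l j))"
  have R: "0 \<le> fps_nth R k" for k
    unfolding R_def using assms by (intro fps_prod_nonneg nb_fps_nonneg) auto
  have eq: "spectral_coeff \<alpha> N l k = (\<Sum>t\<le>k. fps_nth (nb_fps \<alpha> (l i)) t * fps_nth R (k - t))" for k
    using arg_cong[OF spectral_fps_remove[OF assms(4), of \<alpha> l, folded R_def], of "\<lambda>F. fps_nth F k"]
    by (simp only: spectral_coeff_def fps_mult_nth atLeast0AtMost)
  have li: "0 \<le> l i" using assms by auto
  have "pochhammer \<alpha> m / fact m * l i ^ m * spectral_coeff \<alpha> N l k
     = (\<Sum>t\<le>k. (pochhammer \<alpha> t / fact t * (pochhammer \<alpha> m / fact m)) * l i ^ (t + m) * fps_nth R (k - t))"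
    unfolding eq sum_distrib_left
    by (intro sum.cong refl) (simp add: nb_fps_def power_add field_simps)
  also have "\<dots> \<le> (\<Sum>t\<le>k. pochhammer \<alpha> (t + m) / fact (t + m) * l i ^ (t + m) * fps_nth R (k - t))"
    by (intro sum_mono mult_right_mono pochhammer_over_fact_supermult assms R zero_le_power li)
  also have "\<dots> = (\<Sum>t\<in>{m..k+m}. fps_nth (nb_fps \<alpha> (l i)) t * fps_nth R (k + m - t))"
    unfolding nb_fps_def
    by (rule sum.reindex_bij_witness[of _ "\<lambda>t. t - m" "\<lambda>t. t + m"]) auto
  also have "\<dots> \<le> spectral_coeff \<alpha> N l (k + m)"
    unfolding eq using assms by (intro sum_mono2) (auto intro!: mult_nonneg_nonneg R nb_fps_nonneg)
  finally show ?thesis .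
qed

lemma nb_fps_sums:
  assumes "0 < \<alpha>" "0 \<le> s" "0 \<le> l" "s * l < 1"
  shows "(\<lambda>k. fps_nth (nb_fps \<alpha> l) k * s ^ k) sums ((1 - s * l) powr (-\<alpha>))"
proof -
  have "(\<lambda>n. (-\<alpha> gchoose n) * (-(s * l)) ^ n) sums ((1 + (-(s * l))) powr (-\<alpha>))"
  proof (rule gen_binomial_real)
    have "0 \<le> s * l" using assms by simp
    then show "\<bar>- (s * l)\<bar> < 1" using assms(4) by linarith
  qed
  moreover have "(-\<alpha> gchoose n) * (-(s * l)) ^ n = fps_nth (nb_fps \<alpha> l) n * s ^ n" for n
  proof -
    have ring: "(e * p / f) * (e * q) = (e * e) * (p / f * q)" for e p q f :: real
      by simp
    have e: "(-1) ^ n * (-1) ^ n = (1::real)"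
      by (cases "even n") simp_all
    have "(-\<alpha> gchoose n) * (-(s * l)) ^ n
        = ((-1) ^ n * pochhammer \<alpha> n / fact n) * ((-1) ^ n * (s * l) ^ n)"
      by (subst gbinomial_pochhammer, subst power_minus) (simp only: minus_minus)
    then show ?thesis unfolding ring e nb_fps_def
      by (simp only: fps_nth_Abs_fps power_mult_distrib mult_1 mult.assoc mult.commute[of "s ^ n"])
  qed
  ultimately show ?thesis by simp
qed

lemma spectral_coeff_sums:
  assumes "0 < \<alpha>" "0 \<le> s" "\<And>j. j < N \<Longrightarrow> 0 \<le> l j" "\<And>j. j < N \<Longrightarrow> s * l j < 1"
  shows "(\<lambda>k. spectral_coeff \<alpha> N l k * s ^ k) sums (\<Prod>j<N. (1 - s * l j) powr (-\<alpha>))"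
  using assms(3,4)
proof (induction N)
  case 0
  have "(\<lambda>k. spectral_coeff \<alpha> 0 l k * s ^ k) sums (\<Sum>k\<in>{0}. spectral_coeff \<alpha> 0 l k * s ^ k)"
    by (intro sums_finite) (auto simp: spectral_coeff_def spectral_fps_def)
  then show ?case by simp
next
  case (Suc N)
  let ?a = "\<lambda>k. spectral_coeff \<alpha> N l k * s ^ k"
  let ?b = "\<lambda>k. fps_nth (nb_fps \<alpha> (l N)) k * s ^ k"
  have A: "?a sums (\<Prod>j<N. (1 - s * l j) powr (-\<alpha>))" using Suc by auto
  have B: "?b sums ((1 - s * l N) powr (-\<alpha>))" using Suc.prems assms by (intro nb_fps_sums) auto
  have nA: "\<bar>?a k\<bar> = ?a k" for k
    using assms(1,2) Suc.prems by (auto intro!: abs_of_nonneg mult_nonneg_nonneg spectral_coeff_nonneg)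
  have nB: "\<bar>?b k\<bar> = ?b k" for k
    using assms(1,2) Suc.prems by (auto intro!: abs_of_nonneg mult_nonneg_nonneg nb_fps_nonneg)
  have "(\<lambda>k. \<Sum>i\<le>k. ?a i * ?b (k - i)) sums ((\<Sum>k. ?a k) * (\<Sum>k. ?b k))"
    using A B by (intro Cauchy_product_sums) (auto simp only: real_norm_def nA nB sums_iff)
  moreover have "(\<Sum>i\<le>k. ?a i * ?b (k - i)) = spectral_coeff \<alpha> (Suc N) l k * s ^ k" for k
  proof -
    have "(\<Sum>i\<le>k. ?a i * ?b (k - i))
        = (\<Sum>i\<le>k. spectral_coeff \<alpha> N l i * fps_nth (nb_fps \<alpha> (l N)) (k - i) * s ^ k)"
    proof (intro sum.cong refl)
      fix i assume "i \<in> {..k}"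
      then have "s ^ k = s ^ i * s ^ (k - i)" by (simp flip: power_add)
      then show "?a i * ?b (k - i) = spectral_coeff \<alpha> N l i * fps_nth (nb_fps \<alpha> (l N)) (k - i) * s ^ k"
        by simp
    qed
    then show ?thesis
      by (simp add: spectral_coeff_def spectral_fps_def fps_mult_nth atLeast0AtMost sum_distrib_right)
  qed
  ultimately show ?case using A B by (simp add: sums_iff)
qed

lemma Cauchy_product_sums_nonneg:
  fixes a b :: "nat \<Rightarrow> real"
  assumes "a sums A" "b sums B" "\<And>k. 0 \<le> a k" "\<And>k. 0 \<le> b k"
  shows "(\<lambda>k. \<Sum>i\<le>k. a i * b (k - i)) sums (A * B)"
  using Cauchy_product_sums[of a b] assms by (simp add: sums_iff)

text \<open>After division by G these are the mean m and the second moment v + m^2 of a sum of independent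
negative binomial variables. Both follow from Newton's identities: k h_k is the convolution of
the power sums with h, and writing k = i + (k - i) inside this convolution gives k^2 h_k.\<close>

lemma spectral_moment_sums:
  assumes "0 < \<alpha>" "0 \<le> s" "\<And>j. j < N \<Longrightarrow> 0 \<le> l j" "\<And>j. j < N \<Longrightarrow> s * l j < 1"
  defines "G \<equiv> (\<Prod>j<N. (1 - s * l j) powr (-\<alpha>))"
    and "m \<equiv> \<alpha> * (\<Sum>j<N. s * l j / (1 - s * l j))"
    and "v \<equiv> \<alpha> * (\<Sum>j<N. s * l j / (1 - s * l j) ^ 2)"
  shows "(\<lambda>k. real k * (spectral_coeff \<alpha> N l k * s ^ k)) sums (m * G)"
    and "(\<lambda>k. real k ^ 2 * (spectral_coeff \<alpha> N l k * s ^ k)) sums ((v + m ^ 2) * G)"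
proof -
  let ?h = "\<lambda>k. spectral_coeff \<alpha> N l k * s ^ k"
  \<comment> \<open>the terms of the logarithmic derivative of the generating function, multiplied by s\<close>
  define p where "p = (\<lambda>i. if i = 0 then 0 else \<alpha> * (\<Sum>j<N. (s * l j) ^ i))"
  have h: "?h sums G" unfolding G_def using assms by (intro spectral_coeff_sums) auto
  have h0: "0 \<le> ?h k" for k
    using assms by (intro mult_nonneg_nonneg spectral_coeff_nonneg) auto
  have p0: "0 \<le> p k" for k
    using assms by (auto simp: p_def intro!: mult_nonneg_nonneg sum_nonneg)
  have rec: "real k * ?h k = (\<Sum>i\<le>k. p i * ?h (k - i))" for k
  proof (cases k)
    case (Suc n)
    have "real k * ?h k = (real (Suc n) * spectral_coeff \<alpha> N l (Suc n)) * s ^ Suc n"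
      by (simp add: Suc)
    also have "\<dots> = (\<Sum>i\<le>n. \<alpha> * (\<Sum>j<N. l j ^ Suc i) * spectral_coeff \<alpha> N l (n - i) * s ^ Suc n)"
      unfolding spectral_coeff_newton by (simp add: sum_distrib_left sum_distrib_right mult.assoc)
    also have "\<dots> = (\<Sum>i\<le>n. p (Suc i) * ?h (n - i))"
    proof (intro sum.cong refl)
      fix i assume "i \<in> {..n}"
      then have "s ^ Suc n = s ^ Suc i * s ^ (n - i)" by (simp flip: power_add)
      moreover have "p (Suc i) = \<alpha> * (s ^ Suc i * (\<Sum>j<N. l j ^ Suc i))"
        unfolding p_def sum_distrib_left[of "s ^ Suc i"] by (simp only: power_mult_distrib nat.simps if_False)
      ultimately show "\<alpha> * (\<Sum>j<N. l j ^ Suc i) * spectral_coeff \<alpha> N l (n - i) * s ^ Suc n = p (Suc i) * ?h (n - i)"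
        by (simp only: mult_ac)
    qed
    also have "\<dots> = (\<Sum>i\<le>k. p i * ?h (k - i))"
      unfolding Suc sum.atMost_Suc_shift by (simp add: p_def)
    finally show ?thesis .
  qed (simp add: p_def)
  have x: "\<bar>s * l j\<bar> < 1" if "j < N" for j using assms that by simp
  have geo: "(\<lambda>i. if i = 0 then 0 else y ^ i) sums (y / (1 - y))" if "\<bar>y\<bar> < 1" for y :: real
  proof -
    have "(\<lambda>i. y ^ i - (if i = 0 then 1 else 0)) sums (1 / (1 - y) - 1)"
      using that by (intro sums_diff geometric_sums sums_single[of 0 "\<lambda>_. 1::real"]) auto
    moreover have "1 / (1 - y) - 1 = y / (1 - y)" using that by (simp add: field_simps)
    moreover have "(\<lambda>i. y ^ i - (if i = 0 then 1 else 0)) = (\<lambda>i. if i = 0 then 0 else y ^ i)"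
      by auto
    ultimately show ?thesis by metis
  qed
  have p: "p sums m"
  proof -
    have "(\<lambda>i. \<alpha> * (\<Sum>j<N. if i = 0 then 0 else (s * l j) ^ i)) sums m"
      unfolding m_def by (intro sums_mult sums_sum geo x) auto
    then show ?thesis by (rule sums_cong[THEN iffD1, rotated]) (auto simp: p_def)
  qed
  have q: "(\<lambda>i. real i * p i) sums v"
  proof -
    have g2: "(\<lambda>i. real i * y ^ i) sums (y / (1 - y) ^ 2)" if "\<bar>y\<bar> < 1" for y :: real
    proof -
      have "(\<lambda>n. real (Suc n) * y ^ n) sums (1 / (1 - y)\<^sup>2)"
        using that by (intro geometric_deriv_sums) auto
      from sums_mult[OF this, of y] have "(\<lambda>n. real (Suc n) * y ^ Suc n) sums (y / (1 - y)\<^sup>2)"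
        by (simp add: mult_ac)
      then show ?thesis using sums_Suc_iff[of "\<lambda>i. real i * y ^ i"] by simp
    qed
    have "(\<lambda>i. \<alpha> * (\<Sum>j<N. real i * (s * l j) ^ i)) sums v"
      unfolding v_def by (intro sums_mult sums_sum g2 x) auto
    then show ?thesis
      by (rule sums_cong[THEN iffD1, rotated]) (auto simp: p_def sum_distrib_left mult_ac)
  qed
  show first: "(\<lambda>k. real k * ?h k) sums (m * G)"
    unfolding rec using p h p0 h0 by (rule Cauchy_product_sums_nonneg)
  have A: "(\<lambda>k. \<Sum>i\<le>k. (real i * p i) * ?h (k - i)) sums (v * G)"
    by (intro Cauchy_product_sums_nonneg q h h0 mult_nonneg_nonneg p0) auto
  have B: "(\<lambda>k. \<Sum>i\<le>k. p i * (real (k - i) * ?h (k - i))) sums (m * (m * G))"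
    by (intro Cauchy_product_sums_nonneg p first h0 mult_nonneg_nonneg p0) auto
  have "real k ^ 2 * ?h k
      = (\<Sum>i\<le>k. (real i * p i) * ?h (k - i)) + (\<Sum>i\<le>k. p i * (real (k - i) * ?h (k - i)))" for k
  proof -
    have "real k ^ 2 * ?h k = (\<Sum>i\<le>k. real k * (p i * ?h (k - i)))"
      unfolding power2_eq_square mult.assoc rec sum_distrib_left ..
    also have "\<dots> = (\<Sum>i\<le>k. (real i * p i) * ?h (k - i) + p i * (real (k - i) * ?h (k - i)))"
      by (intro sum.cong refl) (simp add: of_nat_diff algebra_simps)
    finally show ?thesis by (simp only: sum.distrib)
  qed
  then show "(\<lambda>k. real k ^ 2 * ?h k) sums ((v + m ^ 2) * G)"
    using sums_add[OF A B] by (simp add: algebra_simps power2_eq_square)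
qed

section \<open>Moments of the quadratic form of an isotropic weight vector\<close>

definition sphere_series :: "real \<Rightarrow> nat \<Rightarrow> (nat \<Rightarrow> real) \<Rightarrow> real \<Rightarrow> real" where
  "sphere_series \<alpha> N l x = (\<Sum>k. x ^ k * spectral_coeff \<alpha> N l k / pochhammer (real N * \<alpha>) k)"

text \<open>The weights w_j stand for the squared moduli |u_j|^2 of a random unit vector, and r_ij for the
real part of the product of u_j with the conjugate of u_i. The last two assumptions are all that
is used of the invariance of the law of u: the rotation by the angle t/2 in the plane of the
coordinates i and j replaces r_ij and q by the two factors in the first one, and the second one
reads r_ij^2 = w_i w_j in the real case (\<alpha> = 1/2) and averages over the phase of u_j in the
complex case (\<alpha> = 1).\<close>

locale isotropic_weights = prob_space M for M :: "'a measure" +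
  fixes \<alpha> :: real and N :: nat and w :: "nat \<Rightarrow> 'a \<Rightarrow> real" and r :: "nat \<Rightarrow> nat \<Rightarrow> 'a \<Rightarrow> real"
    and l :: "nat \<Rightarrow> real"
  assumes \<alpha>: "0 < \<alpha>" and N: "0 < N"
    and w_measurable [measurable]: "\<And>j. j < N \<Longrightarrow> w j \<in> borel_measurable M"
    and r_measurable [measurable]: "\<And>i j. i < N \<Longrightarrow> j < N \<Longrightarrow> r i j \<in> borel_measurable M"
    and w_nonneg: "\<And>x j. x \<in> space M \<Longrightarrow> j < N \<Longrightarrow> 0 \<le> w j x"
    and w_sum: "\<And>x. x \<in> space M \<Longrightarrow> (\<Sum>j<N. w j x) = 1"
    and r_bound: "\<And>x i j. x \<in> space M \<Longrightarrow> i < N \<Longrightarrow> j < N \<Longrightarrow> \<bar>r i j x\<bar> \<le> 1"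
    and rotation_raw: "\<And>i j k t. i < N \<Longrightarrow> j < N \<Longrightarrow> i \<noteq> j \<Longrightarrow>
      expectation (\<lambda>x. (cos t * r i j x + sin t / 2 * (w j x - w i x)) *
          ((\<Sum>j<N. l j * w j x) + (l i - l j) * ((cos t - 1) / 2 * (w i x - w j x) + sin t * r i j x)) ^ k)
      = expectation (\<lambda>x. r i j x * (\<Sum>j<N. l j * w j x) ^ k)"
    and second_moment_raw: "\<And>i j k. i < N \<Longrightarrow> j < N \<Longrightarrow> i \<noteq> j \<Longrightarrow>
      2 * \<alpha> * expectation (\<lambda>x. r i j x ^ 2 * (\<Sum>j<N. l j * w j x) ^ k) = expectation (\<lambda>x. w i x * w j x * (\<Sum>j<N. l j * w j x) ^ k)"
begin

definition q :: "'a \<Rightarrow> real" where "q x = (\<Sum>j<N. l j * w j x)"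

lemmas rotation = rotation_raw[folded q_def]
lemmas second_moment = second_moment_raw[folded q_def]

lemma w_le_1: "x \<in> space M \<Longrightarrow> j < N \<Longrightarrow> w j x \<le> 1"
  using member_le_sum[of j "{..<N}" "\<lambda>j. w j x"] w_sum[of x] w_nonneg[of x] by auto

lemma q_measurable [measurable]: "q \<in> borel_measurable M"
  unfolding q_def[abs_def] by (intro borel_measurable_sum borel_measurable_times) auto

definition q_bound :: real where "q_bound = (\<Sum>j<N. \<bar>l j\<bar>)"

lemma q_bound_nonneg: "0 \<le> q_bound" by (simp add: q_bound_def)

lemma abs_q_le: "x \<in> space M \<Longrightarrow> \<bar>q x\<bar> \<le> q_bound"
proof -
  assume x: "x \<in> space M"
  have "\<bar>q x\<bar> \<le> (\<Sum>j<N. \<bar>l j * w j x\<bar>)" unfolding q_def by (rule sum_abs)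
  also have "\<dots> \<le> q_bound" unfolding q_bound_def
  proof (rule sum_mono)
    fix j assume "j \<in> {..<N}"
    then show "\<bar>l j * w j x\<bar> \<le> \<bar>l j\<bar>"
      using w_le_1[OF x, of j] w_nonneg[OF x, of j] mult_left_mono[of "w j x" 1 "\<bar>l j\<bar>"]
      by (simp add: abs_mult)
  qed
  finally show ?thesis .
qed

lemma integrable_poly:
  assumes [measurable]: "f \<in> borel_measurable M" and "\<And>x. x \<in> space M \<Longrightarrow> \<bar>f x\<bar> \<le> B"
  shows "integrable M (\<lambda>x. f x * q x ^ k)"
proof (rule integrable_const_bound[where B = "B * q_bound ^ k"])
  show "AE x in M. norm (f x * q x ^ k) \<le> B * q_bound ^ k"
  proof (intro AE_I2)
    fix x assume x: "x \<in> space M"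
    have "0 \<le> B" using assms(2)[OF x] by linarith
    then show "norm (f x * q x ^ k) \<le> B * q_bound ^ k"
      using assms(2)[OF x] abs_q_le[OF x] by (simp add: abs_mult power_abs mult_mono power_mono)
  qed
qed measurable

text \<open>The expectation of r_ij q^k along the rotation does not depend on the angle, so its derivative
at 0 vanishes; the integrand below is this derivative, computed pointwise. Differentiation under
the expectation is dominated convergence of difference quotients, which the mean value theorem
bounds uniformly.\<close>

lemma rotation_derivative:
  assumes ij: "i < N" "j < N" "i \<noteq> j"
  shows "expectation (\<lambda>x. (w j x - w i x) / 2 * q x ^ k
            + real k * (l i - l j) * (r i j x ^ 2 * q x ^ (k - 1))) = 0"
proof -
  define d where "d = l i - l j"
  define R where "R = (\<lambda>t x. cos t * r i j x + sin t / 2 * (w j x - w i x))"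
  define R' where "R' = (\<lambda>t x. - sin t * r i j x + cos t / 2 * (w j x - w i x))"
  define Q where "Q = (\<lambda>t x. q x + d * ((cos t - 1) / 2 * (w i x - w j x) + sin t * r i j x))"
  define Q' where "Q' = (\<lambda>t x. d * (- sin t / 2 * (w i x - w j x) + cos t * r i j x))"
  define D where "D = (\<lambda>t x. R t x * Q t x ^ k)"
  define D' where "D' = (\<lambda>t x. R' t x * Q t x ^ k + R t x * (real k * Q t x ^ (k - 1) * Q' t x))"
  define L where "L = q_bound + \<bar>d\<bar> * 2"
  define B where "B = 2 * L ^ k + 2 * (real k * L ^ (k - 1) * L)"
  have [measurable]: "w i \<in> borel_measurable M" "w j \<in> borel_measurable M" "r i j \<in> borel_measurable M"
    using ij by auto
  have [measurable]: "D t \<in> borel_measurable M" for t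
    unfolding D_def R_def Q_def by measurable
  have [measurable]: "D' t \<in> borel_measurable M" for t
    unfolding D'_def R_def R'_def Q_def Q'_def by measurable
  have deriv: "((\<lambda>t. D t x) has_real_derivative D' t x) (at t)" for t x
    unfolding D_def D'_def R_def R'_def Q_def Q'_def
    by (rule derivative_eq_intros refl | simp)+ (simp add: algebra_simps)?
  have mult1: "\<bar>a * b\<bar> \<le> 1" if "\<bar>a\<bar> \<le> 1" "\<bar>b\<bar> \<le> 1" for a b :: real
    using that by (simp add: abs_mult mult_le_one)
  have bounds: "\<bar>R t x\<bar> \<le> 2" "\<bar>R' t x\<bar> \<le> 2" "\<bar>Q t x\<bar> \<le> L" "\<bar>Q' t x\<bar> \<le> L" if x: "x \<in> space M" for t x
  proof -
    have rr: "\<bar>r i j x\<bar> \<le> 1" using r_bound[OF x] ij by simp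
    have ww: "\<bar>w j x - w i x\<bar> \<le> 1" "\<bar>w i x - w j x\<bar> \<le> 1"
      using w_le_1[OF x] w_nonneg[OF x] ij by (auto simp: abs_le_iff intro: order_trans)
         (smt (verit))+
    have unit: "\<bar>y / 2\<bar> \<le> 1" "\<bar>(y - 1) / 2\<bar> \<le> 1" "\<bar>- y\<bar> \<le> 1" "\<bar>- y / 2\<bar> \<le> 1"
      if "\<bar>y\<bar> \<le> 1" for y :: real using that by (auto simp: abs_le_iff)
    note c = abs_cos_le_one[of t] abs_sin_le_one[of t] unit(2)[OF abs_cos_le_one, of t]
      unit(1)[OF abs_sin_le_one, of t] unit(1)[OF abs_cos_le_one, of t]
      unit(3)[OF abs_sin_le_one, of t] unit(4)[OF abs_sin_le_one, of t]
    show "\<bar>R t x\<bar> \<le> 2" "\<bar>R' t x\<bar> \<le> 2"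
      unfolding R_def R'_def using mult1[OF c(1) rr] mult1[OF c(4) ww(1)] mult1[OF c(6) rr] mult1[OF c(5) ww(1)]
      by linarith+
    have "\<bar>(cos t - 1) / 2 * (w i x - w j x) + sin t * r i j x\<bar> \<le> 2"
      using mult1[OF c(3) ww(2)] mult1[OF c(2) rr] by linarith
    then have "\<bar>d * ((cos t - 1) / 2 * (w i x - w j x) + sin t * r i j x)\<bar> \<le> \<bar>d\<bar> * 2"
      unfolding abs_mult by (intro mult_left_mono) auto
    then show "\<bar>Q t x\<bar> \<le> L" unfolding Q_def L_def using abs_q_le[OF x] by linarith
    have "\<bar>- sin t / 2 * (w i x - w j x) + cos t * r i j x\<bar> \<le> 2"
      using mult1[OF c(7) ww(2)] mult1[OF c(1) rr] by linarith
    then have "\<bar>Q' t x\<bar> \<le> \<bar>d\<bar> * 2" unfolding Q'_def abs_mult by (intro mult_left_mono) auto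
    then show "\<bar>Q' t x\<bar> \<le> L" unfolding L_def using q_bound_nonneg by linarith
  qed
  have L: "0 \<le> L" using q_bound_nonneg by (simp add: L_def)
  have D'_bound: "\<bar>D' t x\<bar> \<le> B" if x: "x \<in> space M" for t x
  proof -
    note b = bounds[OF x, of t]
    have "\<bar>R' t x * Q t x ^ k\<bar> \<le> 2 * L ^ k"
      unfolding abs_mult power_abs by (intro mult_mono power_mono b) (use L in auto)
    moreover have "\<bar>R t x * (real k * Q t x ^ (k - 1) * Q' t x)\<bar> \<le> 2 * (real k * L ^ (k - 1) * L)"
      unfolding abs_mult power_abs by (intro mult_mono power_mono b) (use L in auto)
    ultimately show ?thesis unfolding D'_def B_def by linarith
  qed
  have D_int: "integrable M (D t)" for t
  proof (rule integrable_const_bound[where B = "2 * L ^ k"])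
    show "AE x in M. norm (D t x) \<le> 2 * L ^ k"
    proof (intro AE_I2)
      fix x assume "x \<in> space M"
      note b = bounds[OF this, of t]
      show "norm (D t x) \<le> 2 * L ^ k"
        unfolding D_def real_norm_def abs_mult power_abs by (intro mult_mono power_mono b) (use L in auto)
    qed
  qed measurable
  have D_const: "expectation (D t) = expectation (D 0)" for t
    using rotation[OF ij, of t k] rotation[OF ij, of 0 k]
    unfolding D_def R_def Q_def d_def by simp
  define h where "h = (\<lambda>n. 1 / real (Suc n))"
  have h0: "h n \<noteq> 0" for n by (simp add: h_def)
  have "(\<lambda>n. expectation (\<lambda>x. (D (h n) x - D 0 x) / h n)) \<longlonglongrightarrow> expectation (D' 0)"
  proof (rule integral_dominated_convergence[where w = "\<lambda>_. B"])
    have "h \<longlonglongrightarrow> 0" unfolding h_def using LIMSEQ_inverse_real_of_nat by (simp add: inverse_eq_divide)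
    then have h_at: "filterlim h (at 0) sequentially"
      using h0 by (simp add: filterlim_at)
    show "AE x in M. (\<lambda>n. (D (h n) x - D 0 x) / h n) \<longlonglongrightarrow> D' 0 x"
    proof (intro AE_I2)
      fix x
      have "((\<lambda>t. (D t x - D 0 x) / (t - 0)) \<longlongrightarrow> D' 0 x) (at 0)"
        using deriv[of x 0] unfolding has_field_derivative_iff .
      from filterlim_compose[OF this h_at] show "(\<lambda>n. (D (h n) x - D 0 x) / h n) \<longlonglongrightarrow> D' 0 x"
        by simp
    qed
    show "AE x in M. norm ((D (h n) x - D 0 x) / h n) \<le> B" for n
    proof (intro AE_I2)
      fix x assume x: "x \<in> space M"
      have "0 < h n" by (simp add: h_def)
      from MVT2[OF this, of "\<lambda>t. D t x" "\<lambda>t. D' t x"] deriv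
      obtain s where "D (h n) x - D 0 x = (h n - 0) * D' s x" by blast
      then have "(D (h n) x - D 0 x) / h n = D' s x" using h0[of n] by simp
      then show "norm ((D (h n) x - D 0 x) / h n) \<le> B" using D'_bound[OF x] by simp
    qed
  qed simp_all
  moreover have "(\<lambda>n. expectation (\<lambda>x. (D (h n) x - D 0 x) / h n)) = (\<lambda>_. 0)"
    using D_int D_const by (intro ext) simp
  ultimately have "expectation (D' 0) = 0" by (simp only: LIMSEQ_const_iff)
  moreover have "D' 0 = (\<lambda>x. (w j x - w i x) / 2 * q x ^ k
            + real k * (l i - l j) * (r i j x ^ 2 * q x ^ (k - 1)))"
    by (rule ext) (simp add: D'_def R_def R'_def Q_def Q'_def d_def power2_eq_square)
  ultimately show ?thesis by simp
qed

lemma r_sq_bound: "x \<in> space M \<Longrightarrow> i < N \<Longrightarrow> j < N \<Longrightarrow> \<bar>r i j x ^ 2\<bar> \<le> 1"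
  using r_bound by (simp add: abs_square_le_1)

lemma w_bound: "x \<in> space M \<Longrightarrow> j < N \<Longrightarrow> \<bar>w j x\<bar> \<le> 1"
  using w_le_1 w_nonneg by simp

lemma ww_bound: "x \<in> space M \<Longrightarrow> i < N \<Longrightarrow> j < N \<Longrightarrow> \<bar>w i x * w j x\<bar> \<le> 1"
  using w_bound by (simp add: abs_mult mult_le_one)

lemma exchange_identity:
  assumes ij: "i < N" "j < N"
  shows "\<alpha> * (expectation (\<lambda>x. w j x * q x ^ k) - expectation (\<lambda>x. w i x * q x ^ k))
       + real k * (l i - l j) * expectation (\<lambda>x. w i x * w j x * q x ^ (k - 1)) = 0"
proof (cases "i = j")
  case False
  have int: "integrable M (\<lambda>x. w j x * q x ^ k)" "integrable M (\<lambda>x. w i x * q x ^ k)"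
    "integrable M (\<lambda>x. r i j x ^ 2 * q x ^ (k - 1))"
    using ij by (auto intro!: integrable_poly[where B = 1] r_sq_bound w_bound simp del: abs_power2)
  have "0 = expectation (\<lambda>x. (w j x * q x ^ k - w i x * q x ^ k) / 2
            + real k * (l i - l j) * (r i j x ^ 2 * q x ^ (k - 1)))"
    using rotation_derivative[OF ij False, of k] by (simp add: algebra_simps)
  also have "\<dots> = (expectation (\<lambda>x. w j x * q x ^ k) - expectation (\<lambda>x. w i x * q x ^ k)) / 2
       + real k * (l i - l j) * expectation (\<lambda>x. r i j x ^ 2 * q x ^ (k - 1))"
    using int by simp
  finally have "2 * \<alpha> * ((expectation (\<lambda>x. w j x * q x ^ k) - expectation (\<lambda>x. w i x * q x ^ k)) / 2
       + real k * (l i - l j) * expectation (\<lambda>x. r i j x ^ 2 * q x ^ (k - 1))) = 0"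
    by simp
  moreover have "\<alpha> * (A - B) + c * (2 * \<alpha> * R) = 2 * \<alpha> * ((A - B) / 2 + c * R)" for A B c R
    by (simp add: field_simps)
  ultimately show ?thesis
    unfolding second_moment[OF ij False, symmetric] by (simp only:)
qed simp

definition power_form :: "nat \<Rightarrow> 'a \<Rightarrow> real" where "power_form a x = (\<Sum>j<N. l j ^ a * w j x)"

lemma power_form_1: "power_form 1 = q" by (rule ext) (simp add: power_form_def q_def)

lemma expectation_power_form:
  "expectation (\<lambda>x. power_form a x * q x ^ k) = (\<Sum>j<N. l j ^ a * expectation (\<lambda>x. w j x * q x ^ k))"
proof -
  have "integrable M (\<lambda>x. w j x * q x ^ k)" if "j < N" for j
    using that by (intro integrable_poly[where B = 1] w_bound) auto
  then show ?thesis
    unfolding power_form_def sum_distrib_right mult.assoc by (subst Bochner_Integration.integral_sum) auto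
qed

text \<open>Multiply the exchange identity by l_i^a and sum over all pairs (i, j). Because the weights add
up to 1 and (\<Sum>j. l_j w_j) = q, every double sum collapses to a single one.\<close>

lemma moment_recursion:
  "(real N * \<alpha> + real k) * expectation (\<lambda>x. power_form a x * q x ^ k)
     = \<alpha> * (\<Sum>j<N. l j ^ a) * expectation (\<lambda>x. q x ^ k)
       + real k * expectation (\<lambda>x. power_form (Suc a) x * q x ^ (k - 1))"
proof -
  let ?e = "\<lambda>j. expectation (\<lambda>x. w j x * q x ^ k)"
  let ?f = "\<lambda>i j. expectation (\<lambda>x. w i x * w j x * q x ^ (k - 1))"
  have intw: "integrable M (\<lambda>x. w j x * q x ^ k)" if "j < N" for j k
    using that by (intro integrable_poly[where B = 1] w_bound) auto
  have intww: "integrable M (\<lambda>x. w i x * w j x * q x ^ k)" if "i < N" "j < N" for i j k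
    using that by (intro integrable_poly[where B = 1] ww_bound) auto
  have sum_e: "(\<Sum>j<N. ?e j) = expectation (\<lambda>x. q x ^ k)"
  proof -
    have "(\<Sum>j<N. ?e j) = expectation (\<lambda>x. \<Sum>j<N. w j x * q x ^ k)"
      using intw by (subst Bochner_Integration.integral_sum) auto
    also have "\<dots> = expectation (\<lambda>x. q x ^ k)"
      by (intro Bochner_Integration.integral_cong refl) (simp add: w_sum flip: sum_distrib_right)
    finally show ?thesis .
  qed
  have f1: "(\<Sum>j<N. ?f i j) = expectation (\<lambda>x. w i x * q x ^ (k - 1))" if "i < N" for i
  proof -
    have "(\<Sum>j<N. ?f i j) = expectation (\<lambda>x. \<Sum>j<N. w i x * w j x * q x ^ (k - 1))"
      using intww that by (subst Bochner_Integration.integral_sum) auto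
    also have "\<dots> = expectation (\<lambda>x. w i x * q x ^ (k - 1))"
      by (intro Bochner_Integration.integral_cong refl)
         (simp add: w_sum flip: sum_distrib_right sum_distrib_left)
    finally show ?thesis .
  qed
  have f2: "real k * (\<Sum>j<N. l j * ?f i j) = real k * ?e i" if "i < N" for i
  proof (cases k)
    case (Suc n)
    have "(\<Sum>j<N. l j * ?f i j) = expectation (\<lambda>x. \<Sum>j<N. l j * (w i x * w j x * q x ^ (k - 1)))"
      using intww that by (subst Bochner_Integration.integral_sum) auto
    also have "\<dots> = ?e i"
    proof (intro Bochner_Integration.integral_cong refl)
      fix x
      have "(\<Sum>j<N. l j * (w i x * w j x * q x ^ (k - 1))) = w i x * (\<Sum>j<N. l j * w j x) * q x ^ (k - 1)"
        by (simp add: sum_distrib_left sum_distrib_right mult_ac)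
      also have "(\<Sum>j<N. l j * w j x) = q x" by (simp add: q_def)
      finally show "(\<Sum>j<N. l j * (w i x * w j x * q x ^ (k - 1))) = w i x * q x ^ k"
        unfolding Suc by simp
    qed
    finally show ?thesis by simp
  qed simp
  have "0 = (\<Sum>i<N. \<Sum>j<N. l i ^ a * (\<alpha> * (?e j - ?e i) + real k * (l i - l j) * ?f i j))"
    by (intro sum.neutral[symmetric] ballI) (simp add: exchange_identity del: One_nat_def)
  also have "\<dots> = (\<Sum>i<N. l i ^ a * (\<alpha> * ((\<Sum>j<N. ?e j) - real N * ?e i)
      + real k * l i * (\<Sum>j<N. ?f i j) - real k * (\<Sum>j<N. l j * ?f i j)))"
  proof (intro sum.cong refl)
    fix i
    have "(\<Sum>j<n. c * (\<alpha> * (e j - E) + d * (L - l j) * f j))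
      = c * (\<alpha> * ((\<Sum>j<n. e j) - real n * E) + d * L * (\<Sum>j<n. f j) - d * (\<Sum>j<n. l j * f j))"
      for n c d L E and e f :: "nat \<Rightarrow> real"
      by (induction n) (simp_all add: algebra_simps)
    note ring = this
    show "(\<Sum>j<N. l i ^ a * (\<alpha> * (?e j - ?e i) + real k * (l i - l j) * ?f i j))
      = l i ^ a * (\<alpha> * ((\<Sum>j<N. ?e j) - real N * ?e i)
      + real k * l i * (\<Sum>j<N. ?f i j) - real k * (\<Sum>j<N. l j * ?f i j))"
      by (rule ring)
  qed
  also have "\<dots> = (\<Sum>i<N. \<alpha> * expectation (\<lambda>x. q x ^ k) * l i ^ a
      + real k * (l i ^ Suc a * expectation (\<lambda>x. w i x * q x ^ (k - 1)))
      - (real N * \<alpha> + real k) * (l i ^ a * ?e i))"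
    by (intro sum.cong refl, subst f1, simp, subst f2, simp, subst sum_e) (simp add: algebra_simps)
  also have "\<dots> = \<alpha> * expectation (\<lambda>x. q x ^ k) * (\<Sum>j<N. l j ^ a)
      + real k * expectation (\<lambda>x. power_form (Suc a) x * q x ^ (k - 1))
      - (real N * \<alpha> + real k) * expectation (\<lambda>x. power_form a x * q x ^ k)"
    unfolding expectation_power_form by (simp only: sum.distrib sum_subtractf sum_distrib_left)
  finally show ?thesis by (simp add: mult_ac)
qed

text \<open>Iterating the recursion from a = 1, where the power form is q itself, lowers k by one and raises
a by one in every step. The outcome is Newton's identity for the left hand side.\<close>

lemma moment_eq_spectral_coeff:
  "expectation (\<lambda>x. q x ^ k) * pochhammer (real N * \<alpha>) k / fact k = spectral_coeff \<alpha> N l k"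
proof -
  define T where "T = (\<lambda>k. expectation (\<lambda>x. q x ^ k) * pochhammer (real N * \<alpha>) k / fact k)"
  define X where "X = (\<lambda>a k. expectation (\<lambda>x. power_form a x * q x ^ k) * pochhammer (real N * \<alpha>) (Suc k) / fact k)"
  have X_rec: "X a k = \<alpha> * (\<Sum>j<N. l j ^ a) * T k
      + real k * expectation (\<lambda>x. power_form (Suc a) x * q x ^ (k - 1)) * pochhammer (real N * \<alpha>) k / fact k" for a k
  proof -
    have "X a k = ((real N * \<alpha> + real k) * expectation (\<lambda>x. power_form a x * q x ^ k)) * pochhammer (real N * \<alpha>) k / fact k"
      by (simp add: X_def pochhammer_Suc)
    then show ?thesis unfolding moment_recursion T_def by (simp add: algebra_simps add_divide_distrib)
  qed
  have X: "X a k = \<alpha> * (\<Sum>i\<le>k. (\<Sum>j<N. l j ^ (a + i)) * T (k - i))" for a k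
  proof (induction k arbitrary: a)
    case 0
    then show ?case by (simp add: X_rec)
  next
    case (Suc k)
    have cancel: "real (Suc k) * e * p / fact (Suc k) = e * p / fact k" for e p :: real
    proof -
      have "real (Suc k) / fact (Suc k) = 1 / (fact k :: real)" by simp
      then have "e * p * (real (Suc k) / fact (Suc k)) = e * p * (1 / fact k)" by (simp only:)
      then show ?thesis by (simp only: times_divide_eq_right mult.right_neutral mult_ac)
    qed
    have "X a (Suc k) = \<alpha> * (\<Sum>j<N. l j ^ a) * T (Suc k) + X (Suc a) k"
      unfolding X_rec[of a "Suc k"] cancel by (simp add: X_def)
    then show ?case unfolding Suc.IH sum.atMost_Suc_shift by (simp add: algebra_simps)
  qed
  have "T k = spectral_coeff \<alpha> N l k"
  proof (rule spectral_coeff_unique)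
    show "T 0 = 1" by (simp add: T_def prob_space)
    fix k
    have "real (Suc k) * T (Suc k) = X 1 k"
      unfolding T_def X_def power_form_1 by (simp add: field_simps del: of_nat_Suc)
    then show "real (Suc k) * T (Suc k) = \<alpha> * (\<Sum>i\<le>k. (\<Sum>j<N. l j ^ Suc i) * T (k - i))"
      unfolding X by simp
  qed
  then show ?thesis by (simp add: T_def)
qed

lemma expectation_exp_eq_sphere_series:
  "expectation (\<lambda>x. exp (y * q x)) = sphere_series \<alpha> N l y"
proof -
  let ?f = "\<lambda>k x. y ^ k / fact k * q x ^ k"
  have exp_eq: "exp (y * q x) = (\<Sum>k. ?f k x)" for x
    by (simp add: exp_def scaleR_conv_of_real power_mult_distrib field_simps)
  have le: "\<bar>?f k x\<bar> \<le> (\<bar>y\<bar> * q_bound) ^ k / fact k" if "x \<in> space M" for k x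
  proof -
    have "\<bar>?f k x\<bar> = \<bar>y\<bar> ^ k * \<bar>q x\<bar> ^ k / fact k" by (simp add: abs_mult power_abs)
    also have "\<dots> \<le> \<bar>y\<bar> ^ k * q_bound ^ k / fact k"
      using abs_q_le[OF that] by (intro divide_right_mono mult_left_mono power_mono) auto
    finally show ?thesis by (simp add: power_mult_distrib)
  qed
  have summ: "summable (\<lambda>k. (\<bar>y\<bar> * q_bound) ^ k / fact k)"
    using summable_exp[of "\<bar>y\<bar> * q_bound"] by (simp add: field_simps)
  have int: "integrable M (\<lambda>x. q x ^ k)" for k
    using integrable_poly[of "\<lambda>_. 1" 1 k] by simp
  have "expectation (\<lambda>x. exp (y * q x)) = (\<Sum>k. expectation (?f k))"
    unfolding exp_eq
  proof (rule integral_suminf)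
    show "integrable M (?f k)" for k using int by simp
    show "AE x in M. summable (\<lambda>k. norm (?f k x))"
      using le by (intro AE_I2 summable_comparison_test'[OF summ, of 0]) auto
    show "summable (\<lambda>k. expectation (\<lambda>x. norm (?f k x)))"
    proof (rule summable_comparison_test'[OF summ, of 0])
      fix k
      have "expectation (\<lambda>x. norm (?f k x)) \<le> expectation (\<lambda>x. (\<bar>y\<bar> * q_bound) ^ k / fact k)"
        using int le by (intro integral_mono integrable_norm) auto
      then show "norm (expectation (\<lambda>x. norm (?f k x))) \<le> (\<bar>y\<bar> * q_bound) ^ k / fact k"
        by (simp add: prob_space)
    qed
  qed
  also have "\<dots> = sphere_series \<alpha> N l y"
    unfolding sphere_series_def
  proof (rule suminf_cong)
    fix k
    have "pochhammer (real N * \<alpha>) k \<noteq> 0" using \<alpha> N pochhammer_pos[of "real N * \<alpha>" k] by simp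
    then show "expectation (?f k) = y ^ k * spectral_coeff \<alpha> N l k / pochhammer (real N * \<alpha>) k"
      unfolding moment_eq_spectral_coeff[symmetric] by (simp add: field_simps)
  qed
  finally show ?thesis .
qed

end

section \<open>Unitary matrices and left-invariant measures\<close>

lemma mat_adjoint_carrier: "A \<in> carrier_mat N N \<Longrightarrow> mat_adjoint A \<in> carrier_mat N N"
  by (auto simp: mat_adjoint_def)

lemma mat_adjoint_index:
  assumes "A \<in> carrier_mat N N" "i < N" "j < N"
  shows "mat_adjoint A $$ (i, j) = conjugate (A $$ (j, i))"
  using assms by (simp add: mat_adjoint_def mat_of_rows_index)

lemma mult_index:
  assumes "A \<in> carrier_mat N N" "B \<in> carrier_mat N N" "i < N" "j < N"
  shows "(A * B) $$ (i, j) = (\<Sum>k<N. A $$ (i, k) * B $$ (k, j))"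
  using assms by (simp add: scalar_prod_def atLeast0LessThan)

lemma mat_adjoint_adjoint:
  fixes A :: "'a :: conjugatable_field mat"
  assumes A: "A \<in> carrier_mat N N"
  shows "mat_adjoint (mat_adjoint A) = A"
proof (rule eq_matI)
  note A' = mat_adjoint_carrier[OF A] and A'' = mat_adjoint_carrier[OF mat_adjoint_carrier[OF A]]
  fix i j assume "i < dim_row A" "j < dim_col A"
  then have ij: "i < N" "j < N" using A by auto
  show "mat_adjoint (mat_adjoint A) $$ (i, j) = A $$ (i, j)"
    unfolding mat_adjoint_index[OF A' ij] mat_adjoint_index[OF A ij(2,1)] by simp
qed (use A mat_adjoint_carrier[OF mat_adjoint_carrier[OF A]] in auto)

lemma mat_adjoint_mult:
  fixes A :: "'a :: conjugatable_field mat"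
  assumes A: "A \<in> carrier_mat N N" and B: "B \<in> carrier_mat N N"
  shows "mat_adjoint (A * B) = mat_adjoint B * mat_adjoint A"
proof -
  note A' = mat_adjoint_carrier[OF A] and B' = mat_adjoint_carrier[OF B]
  have AB: "A * B \<in> carrier_mat N N" using A B by simp
  note AB' = mat_adjoint_carrier[OF AB]
  have BA: "mat_adjoint B * mat_adjoint A \<in> carrier_mat N N" using A' B' by simp
  show ?thesis
  proof (rule eq_matI)
    fix i j assume "i < dim_row (mat_adjoint B * mat_adjoint A)" "j < dim_col (mat_adjoint B * mat_adjoint A)"
    then have ij: "i < N" "j < N" using BA by auto
    show "mat_adjoint (A * B) $$ (i, j) = (mat_adjoint B * mat_adjoint A) $$ (i, j)"
      unfolding mat_adjoint_index[OF AB ij] mult_index[OF A B ij(2,1)] mult_index[OF B' A' ij]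
      using ij by (simp add: sum_conjugate conjugate_dist_mul mat_adjoint_index[OF A] mat_adjoint_index[OF B] mult.commute)
  qed (use AB' BA in auto)
qed

lemma unitary_group_carrier: "U \<in> unitary_group N \<Longrightarrow> U \<in> carrier_mat N N"
  by (simp add: unitary_group_def)

lemma unitary_group_mult:
  fixes A :: "'a :: conjugatable_field mat"
  assumes "A \<in> unitary_group N" "B \<in> unitary_group N"
  shows "A * B \<in> unitary_group N"
proof -
  have c: "A \<in> carrier_mat N N" "B \<in> carrier_mat N N"
    "mat_adjoint A \<in> carrier_mat N N" "mat_adjoint B \<in> carrier_mat N N"
    using assms by (auto intro: unitary_group_carrier mat_adjoint_carrier)
  have "(A * B) * mat_adjoint (A * B) = A * B * (mat_adjoint B * mat_adjoint A)"
    using c by (simp add: mat_adjoint_mult[of _ N])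
  also have "\<dots> = A * (B * (mat_adjoint B * mat_adjoint A))"
    using c by (intro assoc_mult_mat) auto
  also have "B * (mat_adjoint B * mat_adjoint A) = (B * mat_adjoint B) * mat_adjoint A"
    using c by (intro assoc_mult_mat[symmetric]) auto
  also have "B * mat_adjoint B = 1\<^sub>m N" using assms(2) by (simp add: unitary_group_def)
  also have "1\<^sub>m N * mat_adjoint A = mat_adjoint A" using c(3) by (rule left_mult_one_mat)
  also have "A * mat_adjoint A = 1\<^sub>m N" using assms(1) by (simp add: unitary_group_def)
  finally show ?thesis using mult_carrier_mat[OF c(1,2)] unfolding unitary_group_def by blast
qed

lemma unitary_group_left_inverse:
  assumes "U \<in> unitary_group N"
  shows "mat_adjoint U * U = 1\<^sub>m N"
  using assms by (intro mat_mult_left_right_inverse[of U N])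
    (auto simp: unitary_group_def intro: mat_adjoint_carrier)

lemma unitary_group_adjoint:
  assumes "U \<in> unitary_group N"
  shows "mat_adjoint U \<in> unitary_group N"
  using assms unitary_group_left_inverse[OF assms]
  by (auto simp: unitary_group_def mat_adjoint_adjoint intro: mat_adjoint_carrier)

text \<open>A 2 by 2 block acting on the coordinates i and j, and the identity elsewhere. Real rotations in
a coordinate plane and changes of phase of a single coordinate are both of this form.\<close>

definition plane_mat :: "nat \<Rightarrow> nat \<Rightarrow> nat \<Rightarrow> 'a::conjugatable_field \<Rightarrow> 'a \<Rightarrow> 'a \<Rightarrow> 'a \<Rightarrow> 'a mat" where
  "plane_mat N i j a b c d = mat N N (\<lambda>(p, q).
     if p = i then (if q = i then a else if q = j then b else 0)
     else if p = j then (if q = i then c else if q = j then d else 0)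
     else if p = q then 1 else 0)"

lemma plane_mat_sum:
  assumes "i < N" "j < N" "i \<noteq> j" "p < N"
  shows "(\<Sum>k<N. plane_mat N i j a b c d $$ (p, k) * x k)
       = (if p = i then a * x i + b * x j else if p = j then c * x i + d * x j else x p)"
proof -
  have two: "(\<Sum>k<N. (if k = i then s else if k = j then t else 0) * x k) = s * x i + t * x j" for s t
  proof -
    have "(\<Sum>k<N. (if k = i then s else if k = j then t else 0) * x k)
        = (\<Sum>k<N. (if k = i then s * x k else 0) + (if k = j then t * x k else 0))"
      using assms(3) by (intro sum.cong refl) auto
    then show ?thesis using assms(1,2) by (simp add: sum.distrib)
  qed
  have one: "(\<Sum>k<N. (if p = k then 1 else 0) * x k) = x p"
    using assms(4) by (simp add: if_distrib[of "\<lambda>y. y * _"] cong: if_cong)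
  have "(\<Sum>k<N. plane_mat N i j a b c d $$ (p, k) * x k)
      = (\<Sum>k<N. (if p = i then (if k = i then a else if k = j then b else 0)
     else if p = j then (if k = i then c else if k = j then d else 0)
     else if p = k then 1 else 0) * x k)"
    using assms by (intro sum.cong refl) (simp add: plane_mat_def)
  then show ?thesis using two one by (cases "p = i"; cases "p = j") simp_all
qed

lemma conjugate_one [simp]: "conjugate (1 :: 'a :: conjugatable_field) = 1"
proof -
  have "conjugate (1::'a) * conjugate 1 = conjugate 1 * 1"
    by (simp flip: conjugate_dist_mul)
  then show ?thesis by (metis conjugate_zero_iff mult_left_cancel zero_neq_one)
qed

lemma plane_mat_unitary:
  fixes a b c d :: "'a :: conjugatable_field"
  assumes ij: "i < N" "j < N" "i \<noteq> j"
    and "a * conjugate a + b * conjugate b = 1" "c * conjugate c + d * conjugate d = 1"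
    and "a * conjugate c + b * conjugate d = 0" "c * conjugate a + d * conjugate b = 0"
  shows "plane_mat N i j a b c d \<in> unitary_group N"
proof -
  let ?B = "plane_mat N i j a b c d"
  have B: "?B \<in> carrier_mat N N" by (simp add: plane_mat_def)
  have "(?B * mat_adjoint ?B) $$ (p, q) = (if p = q then 1 else 0)" if pq: "p < N" "q < N" for p q
  proof -
    have "(?B * mat_adjoint ?B) $$ (p, q) = (\<Sum>k<N. ?B $$ (p, k) * conjugate (?B $$ (q, k)))"
      unfolding mult_index[OF B mat_adjoint_carrier[OF B] pq]
      using pq by (simp add: mat_adjoint_index[OF B])
    also have "\<dots> = (if p = q then 1 else 0)"
      unfolding plane_mat_sum[OF ij pq(1)] using ij pq assms by (auto simp: plane_mat_def)
    finally show ?thesis .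
  qed
  then have "?B * mat_adjoint ?B = 1\<^sub>m N"
    using B mat_adjoint_carrier[OF B] by (intro eq_matI) auto
  then show ?thesis using B by (simp add: unitary_group_def)
qed

lemma plane_mat_mult_col:
  assumes "i < N" "j < N" "i \<noteq> j" "p < N" "q < N" "U \<in> carrier_mat N N"
  shows "(plane_mat N i j a b c d * U) $$ (p, q)
       = (if p = i then a * U $$ (i, q) + b * U $$ (j, q)
          else if p = j then c * U $$ (i, q) + d * U $$ (j, q) else U $$ (p, q))"
proof -
  have B: "plane_mat N i j a b c d \<in> carrier_mat N N" by (simp add: plane_mat_def)
  show ?thesis unfolding mult_index[OF B assms(6,4,5)] by (rule plane_mat_sum[OF assms(1-4)])
qed

text \<open>A common frame for real and complex scalars. For both, the real inner product of x and y is the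
real part of the product of y with the conjugate of x.\<close>

locale haar_setting =
  fixes M :: "'a :: {conjugatable_field, real_normed_field, real_inner, second_countable_topology} mat measure"
    and N :: nat
  assumes haar: "haar_prob N M" and N: "0 < N"
    and mult_conjugate: "\<And>x :: 'a. x * conjugate x = of_real (norm x ^ 2)"
    and conjugate_of_real: "\<And>c. conjugate (of_real c :: 'a) = of_real c"
    and conjugate_measurable: "(conjugate :: 'a \<Rightarrow> 'a) \<in> borel_measurable borel"

sublocale haar_setting \<subseteq> prob_space M
  using haar by (simp add: haar_prob_def)

context haar_setting begin

lemma sets_M: "sets M = sets (unitary_borel N)"
  using haar by (simp add: haar_prob_def)

lemma space_M: "space M = unitary_group N"
  using sets_eq_imp_space_eq[OF sets_M] by (simp add: unitary_borel_def)

lemma entry_measurable: "i < N \<Longrightarrow> j < N \<Longrightarrow> (\<lambda>U. U $$ (i, j)) \<in> borel_measurable M"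
proof -
  assume ij: "i < N" "j < N"
  have "(\<lambda>U. \<lambda>ij\<in>{..<N} \<times> {..<N}. U $$ ij) \<in> unitary_borel N \<rightarrow>\<^sub>M (\<Pi>\<^sub>M ij\<in>{..<N} \<times> {..<N}. borel :: 'a measure)"
    unfolding unitary_borel_def by (rule measurable_vimage_algebra1) (auto simp: space_PiM)
  then have "(\<lambda>U. (\<lambda>ij\<in>{..<N} \<times> {..<N}. U $$ ij) (i, j)) \<in> unitary_borel N \<rightarrow>\<^sub>M (borel :: 'a measure)"
    by (rule measurable_compose) (use ij in \<open>auto intro!: measurable_component_singleton\<close>)
  then show ?thesis using ij by (simp cong: measurable_cong_sets[OF sets_M refl])
qed

lemma measurable_into_group:
  assumes "\<And>x. x \<in> space L \<Longrightarrow> f x \<in> unitary_group N"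
    and "\<And>i j. i < N \<Longrightarrow> j < N \<Longrightarrow> (\<lambda>x. f x $$ (i, j)) \<in> borel_measurable L"
  shows "f \<in> L \<rightarrow>\<^sub>M M"
proof -
  have "f \<in> L \<rightarrow>\<^sub>M unitary_borel N"
    unfolding unitary_borel_def
  proof (rule measurable_vimage_algebra2)
    show "f \<in> space L \<rightarrow> unitary_group N" using assms(1) by auto
    show "(\<lambda>x. \<lambda>ij\<in>{..<N} \<times> {..<N}. f x $$ ij) \<in> L \<rightarrow>\<^sub>M (\<Pi>\<^sub>M ij\<in>{..<N} \<times> {..<N}. borel)"
      using assms(2) by (intro measurable_restrict) auto
  qed
  then show ?thesis by (simp cong: measurable_cong_sets[OF refl sets_M])
qed

lemma mult_measurable:
  assumes f: "f \<in> L \<rightarrow>\<^sub>M M" and g: "g \<in> L \<rightarrow>\<^sub>M M"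
  shows "(\<lambda>x. f x * g x) \<in> L \<rightarrow>\<^sub>M M"
proof (rule measurable_into_group)
  have sp: "f x \<in> unitary_group N" "g x \<in> unitary_group N" if "x \<in> space L" for x
    using measurable_space[OF f that] measurable_space[OF g that] by (simp_all add: space_M)
  then show "f x * g x \<in> unitary_group N" if "x \<in> space L" for x
    using that by (intro unitary_group_mult)
  fix i j assume ij: "i < N" "j < N"
  have "(\<lambda>x. \<Sum>k<N. f x $$ (i, k) * g x $$ (k, j)) \<in> borel_measurable L"
    using ij by (intro borel_measurable_sum borel_measurable_times
        measurable_compose[OF f entry_measurable] measurable_compose[OF g entry_measurable]) auto
  then show "(\<lambda>x. (f x * g x) $$ (i, j)) \<in> borel_measurable L"
    by (subst measurable_cong[OF mult_index[OF unitary_group_carrier[OF sp(1)] unitary_group_carrier[OF sp(2)] ij]])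
qed

lemma adjoint_measurable:
  assumes f: "f \<in> L \<rightarrow>\<^sub>M M"
  shows "(\<lambda>x. mat_adjoint (f x)) \<in> L \<rightarrow>\<^sub>M M"
proof (rule measurable_into_group)
  have sp: "f x \<in> unitary_group N" if "x \<in> space L" for x
    using measurable_space[OF f that] by (simp add: space_M)
  then show "mat_adjoint (f x) \<in> unitary_group N" if "x \<in> space L" for x
    using that by (intro unitary_group_adjoint)
  fix i j assume ij: "i < N" "j < N"
  have "(\<lambda>x. conjugate (f x $$ (j, i))) \<in> borel_measurable L"
    by (rule measurable_compose[OF measurable_compose[OF f entry_measurable[OF ij(2,1)]] conjugate_measurable])
  then show "(\<lambda>x. mat_adjoint (f x) $$ (i, j)) \<in> borel_measurable L"
    by (subst measurable_cong[OF mat_adjoint_index[OF unitary_group_carrier[OF sp] ij]])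
qed

lemma left_invariant:
  fixes F :: "'a mat \<Rightarrow> real"
  assumes A: "A \<in> unitary_group N" and F: "F \<in> borel_measurable M"
  shows "expectation (\<lambda>U. F (A * U)) = expectation F"
proof -
  have m: "(\<lambda>U. A * U) \<in> M \<rightarrow>\<^sub>M M"
    by (intro mult_measurable measurable_const measurable_ident_sets refl) (use A in \<open>simp add: space_M\<close>)
  have "distr M M (\<lambda>U. A * U) = M" using haar A by (simp add: haar_prob_def)
  then have "expectation F = integral\<^sup>L (distr M M (\<lambda>U. A * U)) F" by simp
  also have "\<dots> = expectation (\<lambda>U. F (A * U))" by (rule integral_distr[OF m F])
  finally show ?thesis ..
qed

text \<open>Left invariance constrains columns, whereas the spherical integral involves a row. The double
integral of F(V* U), evaluated in both orders, equals the integral of F by left invariance in U,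
and the integral of F(U*) by left invariance in V after rewriting V* U as (U* V)*.\<close>

lemma inversion_invariant:
  fixes F :: "'a mat \<Rightarrow> real"
  assumes F: "F \<in> borel_measurable M" and bound: "\<And>U. U \<in> unitary_group N \<Longrightarrow> \<bar>F U\<bar> \<le> B"
  shows "expectation (\<lambda>U. F (mat_adjoint U)) = expectation F"
proof -
  interpret P: pair_prob_space M M ..
  have m: "(\<lambda>p. mat_adjoint (fst p) * snd p) \<in> M \<Otimes>\<^sub>M M \<rightarrow>\<^sub>M M"
    by (rule mult_measurable[OF adjoint_measurable[OF measurable_fst] measurable_snd])
  have int: "integrable (M \<Otimes>\<^sub>M M) (case_prod (\<lambda>V U. F (mat_adjoint V * U)))"
  proof (rule P.integrable_const_bound[where B = B])
    have "(\<lambda>p. F (mat_adjoint (fst p) * snd p)) \<in> borel_measurable (M \<Otimes>\<^sub>M M)"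
      using m F by (rule measurable_compose)
    then show "case_prod (\<lambda>V U. F (mat_adjoint V * U)) \<in> borel_measurable (M \<Otimes>\<^sub>M M)"
      by (simp add: case_prod_unfold)
    show "AE p in M \<Otimes>\<^sub>M M. norm (case p of (V, U) \<Rightarrow> F (mat_adjoint V * U)) \<le> B"
      by (intro AE_I2)
         (auto simp: space_pair_measure space_M intro!: bound unitary_group_mult unitary_group_adjoint)
  qed
  have "expectation F = (\<integral>V. (\<integral>U. F (mat_adjoint V * U) \<partial>M) \<partial>M)"
  proof -
    have "(\<integral>V. (\<integral>U. F (mat_adjoint V * U) \<partial>M) \<partial>M) = (\<integral>V. expectation F \<partial>M)"
    proof (rule Bochner_Integration.integral_cong[OF refl])
      fix V assume "V \<in> space M"
      then have "V \<in> unitary_group N" by (simp add: space_M)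
      then show "(\<integral>U. F (mat_adjoint V * U) \<partial>M) = expectation F"
        by (rule left_invariant[OF unitary_group_adjoint F])
    qed
    also have "\<dots> = expectation F" using prob_space by simp
    finally show ?thesis ..
  qed
  also have "\<dots> = (\<integral>U. (\<integral>V. F (mat_adjoint V * U) \<partial>M) \<partial>M)"
    by (rule P.Fubini_integral[OF int, symmetric])
  also have "\<dots> = (\<integral>U. expectation (\<lambda>V. F (mat_adjoint V)) \<partial>M)"
  proof (rule Bochner_Integration.integral_cong[OF refl])
    fix U assume "U \<in> space M"
    then have U: "U \<in> unitary_group N" by (simp add: space_M)
    have "(\<integral>V. F (mat_adjoint V * U) \<partial>M) = (\<integral>V. F (mat_adjoint (mat_adjoint U * V)) \<partial>M)"
    proof (rule Bochner_Integration.integral_cong[OF refl])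
      fix V assume "V \<in> space M"
      then have V: "V \<in> unitary_group N" by (simp add: space_M)
      have c: "U \<in> carrier_mat N N" "V \<in> carrier_mat N N" "mat_adjoint U \<in> carrier_mat N N"
        using U V by (auto intro: unitary_group_carrier mat_adjoint_carrier)
      show "F (mat_adjoint V * U) = F (mat_adjoint (mat_adjoint U * V))"
        unfolding mat_adjoint_mult[OF c(3,2)] mat_adjoint_adjoint[OF c(1)] ..
    qed
    also have "\<dots> = expectation (\<lambda>V. F (mat_adjoint V))"
    proof (rule left_invariant[OF unitary_group_adjoint[OF U]])
      show "(\<lambda>V. F (mat_adjoint V)) \<in> borel_measurable M"
        by (rule measurable_compose[OF adjoint_measurable[OF measurable_ident_sets[OF refl]] F])
    qed
    finally show "(\<integral>V. F (mat_adjoint V * U) \<partial>M) = expectation (\<lambda>V. F (mat_adjoint V))" .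
  qed
  also have "\<dots> = expectation (\<lambda>U. F (mat_adjoint U))" using prob_space by simp
  finally show ?thesis by (rule sym)
qed

end

section \<open>The spherical integral as a power series\<close>

context haar_setting begin

lemma norm_conjugate: "norm (conjugate x) = norm (x :: 'a)"
proof (cases "x = 0")
  case False
  have "norm x * norm (conjugate x) = norm x * norm x"
    using arg_cong[OF mult_conjugate[of x], of norm]
    by (simp add: norm_mult norm_power power2_eq_square)
  then show ?thesis using False by simp
qed simp

lemma column_norm:
  assumes "(U :: 'a mat) \<in> unitary_group N"
  shows "(\<Sum>j<N. norm (U $$ (j, 0)) ^ 2) = 1"
proof -
  have U: "U \<in> carrier_mat N N" using assms by (rule unitary_group_carrier)
  have "of_real (\<Sum>j<N. norm (U $$ (j, 0)) ^ 2) = (\<Sum>j<N. mat_adjoint U $$ (0, j) * U $$ (j, 0))"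
    using N by (simp add: mat_adjoint_index[OF U] mult.commute[of "conjugate _"] mult_conjugate)
  also have "\<dots> = (mat_adjoint U * U) $$ (0, 0)"
    using N by (simp only: mult_index[OF mat_adjoint_carrier[OF U] U])
  also have "\<dots> = 1" using N by (simp add: unitary_group_left_inverse[OF assms])
  finally show ?thesis by (simp only: of_real_eq_1_iff)
qed

lemma conjugation_entry:
  assumes U: "U \<in> carrier_mat N N" and A: "A \<in> carrier_mat N N" "diagonal_mat A"
  shows "(U * map_mat of_real A * mat_adjoint U) $$ (0, 0)
       = (of_real (\<Sum>j<N. A $$ (j, j) * norm (U $$ (0, j)) ^ 2) :: 'a)"
proof -
  let ?D = "map_mat of_real A :: 'a mat"
  have D: "?D \<in> carrier_mat N N" using A by simp
  have UD: "(U * ?D) $$ (0, j) = U $$ (0, j) * of_real (A $$ (j, j))" if "j < N" for j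
  proof -
    have "(U * ?D) $$ (0, j) = (\<Sum>k<N. U $$ (0, k) * ?D $$ (k, j))"
      using N that by (rule mult_index[OF U D])
    also have "\<dots> = (\<Sum>k<N. if k = j then U $$ (0, k) * of_real (A $$ (j, j)) else 0)"
      using A that by (intro sum.cong refl) (auto simp: diagonal_mat_def)
    finally show ?thesis using that by simp
  qed
  have "(U * ?D * mat_adjoint U) $$ (0, 0) = (\<Sum>j<N. (U * ?D) $$ (0, j) * mat_adjoint U $$ (j, 0))"
    by (rule mult_index[OF mult_carrier_mat[OF U D] mat_adjoint_carrier[OF U] N N])
  also have "\<dots> = (\<Sum>j<N. of_real (A $$ (j, j)) * (U $$ (0, j) * conjugate (U $$ (0, j))))"
    using N by (intro sum.cong refl) (simp add: UD mat_adjoint_index[OF U])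
  finally show ?thesis by (simp add: mult_conjugate)
qed

lemma entry_norm_measurable:
  "i < N \<Longrightarrow> j < N \<Longrightarrow> (\<lambda>U. norm (U $$ (i, j))) \<in> borel_measurable M"
  by (rule measurable_compose[OF entry_measurable borel_measurable_norm])

lemma row_column_exchange:
  "expectation (\<lambda>U. exp (x * (\<Sum>j<N. l j * norm (U $$ (0, j)) ^ 2)))
     = expectation (\<lambda>U. exp (x * (\<Sum>j<N. l j * norm (U $$ (j, 0)) ^ 2)))"
proof -
  let ?F = "\<lambda>U. exp (x * (\<Sum>j<N. l j * norm (U $$ (j, 0)) ^ 2))"
  have F: "?F \<in> borel_measurable M"
    using N by (intro measurable_compose[OF _ borel_measurable_exp] borel_measurable_times borel_measurable_const
        borel_measurable_sum borel_measurable_power entry_norm_measurable entry_measurable) auto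
  have "\<bar>?F U\<bar> \<le> exp (\<bar>x\<bar> * (\<Sum>j<N. \<bar>l j\<bar>))" if U: "U \<in> unitary_group N" for U :: "'a mat"
  proof -
    have "norm (U $$ (j, 0)) ^ 2 \<le> 1" if "j < N" for j
      using member_le_sum[of j "{..<N}" "\<lambda>j. norm (U $$ (j, 0)) ^ 2"] column_norm[OF U] that by simp
    then have "\<bar>l j * norm (U $$ (j, 0)) ^ 2\<bar> \<le> \<bar>l j\<bar>" if "j < N" for j
      using that mult_left_mono[of "norm (U $$ (j, 0)) ^ 2" 1 "\<bar>l j\<bar>"] by (simp add: abs_mult)
    then have "\<bar>\<Sum>j<N. l j * norm (U $$ (j, 0)) ^ 2\<bar> \<le> (\<Sum>j<N. \<bar>l j\<bar>)"
      by (intro order_trans[OF sum_abs] sum_mono) auto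
    then have "\<bar>x * (\<Sum>j<N. l j * norm (U $$ (j, 0)) ^ 2)\<bar> \<le> \<bar>x\<bar> * (\<Sum>j<N. \<bar>l j\<bar>)"
      unfolding abs_mult by (intro mult_left_mono) auto
    then show ?thesis by simp
  qed
  from inversion_invariant[OF F this]
  have "expectation ?F = expectation (\<lambda>U. ?F (mat_adjoint U))" by simp
  also have "\<dots> = expectation (\<lambda>U. exp (x * (\<Sum>j<N. l j * norm (U $$ (0, j)) ^ 2)))"
  proof (rule Bochner_Integration.integral_cong[OF refl])
    fix U assume "U \<in> space M"
    then have U: "U \<in> carrier_mat N N" by (simp add: space_M unitary_group_carrier)
    have "norm (mat_adjoint U $$ (j, 0)) = norm (U $$ (0, j))" if "j < N" for j
      unfolding mat_adjoint_index[OF U that N] by (rule norm_conjugate)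
    then show "?F (mat_adjoint U) = exp (x * (\<Sum>j<N. l j * norm (U $$ (0, j)) ^ 2))"
      by simp
  qed
  finally show ?thesis ..
qed

text \<open>The left hand side is the right hand side with U replaced by its product with a rotation by t/2
in the plane of the coordinates i and j.\<close>

lemma rotation_invariance:
  assumes ij: "i < N" "j < N" "i \<noteq> j"
  defines "w \<equiv> \<lambda>j U. norm (U $$ (j, 0)) ^ 2" and "r \<equiv> \<lambda>i j U. inner (U $$ (i, 0)) (U $$ (j, 0))"
  shows "expectation (\<lambda>x. (cos t * r i j x + sin t / 2 * (w j x - w i x)) *
          ((\<Sum>j<N. l j * w j x) + (l i - l j) * ((cos t - 1) / 2 * (w i x - w j x) + sin t * r i j x)) ^ k)
      = expectation (\<lambda>x. r i j x * (\<Sum>j<N. l j * w j x) ^ k)"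
proof -
  define c where "c = cos (t / 2)"
  define s where "s = sin (t / 2)"
  have cs: "c ^ 2 + s ^ 2 = 1" by (simp add: c_def s_def)
  have ct: "cos t = c ^ 2 - s ^ 2" "sin t = 2 * s * c"
    using cos_double[of "t / 2"] sin_double[of "t / 2"] by (simp_all add: c_def s_def)
  define G where "G = plane_mat N i j (of_real c :: 'a) (of_real s) (of_real (- s)) (of_real c)"
  have G: "G \<in> unitary_group N"
    unfolding G_def using cs
    by (intro plane_mat_unitary ij)
       (simp_all add: conjugate_of_real power2_eq_square add.commute flip: of_real_mult of_real_add of_real_minus)
  let ?F = "\<lambda>U. r i j U * (\<Sum>j<N. l j * w j U) ^ k"
  have F: "?F \<in> borel_measurable M"
    unfolding r_def w_def using N ij
    by (intro borel_measurable_times borel_measurable_inner borel_measurable_const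
        borel_measurable_sum borel_measurable_power entry_norm_measurable entry_measurable) auto
  have "expectation ?F = expectation (\<lambda>U. ?F (G * U))"
    by (rule left_invariant[OF G F, symmetric])
  also have "\<dots> = expectation (\<lambda>x. (cos t * r i j x + sin t / 2 * (w j x - w i x)) *
          ((\<Sum>j<N. l j * w j x) + (l i - l j) * ((cos t - 1) / 2 * (w i x - w j x) + sin t * r i j x)) ^ k)"
  proof (rule Bochner_Integration.integral_cong[OF refl])
    fix U assume "U \<in> space M"
    then have U: "U \<in> carrier_mat N N" by (simp add: space_M unitary_group_carrier)
    define u where "u = U $$ (i, 0)"
    define v where "v = U $$ (j, 0)"
    have GU: "(G * U) $$ (p, 0) = (if p = i then c *\<^sub>R u + s *\<^sub>R v
        else if p = j then c *\<^sub>R v - s *\<^sub>R u else U $$ (p, 0))" if "p < N" for p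
      unfolding G_def plane_mat_mult_col[OF ij that N U]
      by (simp add: scaleR_conv_of_real u_def v_def)
    define \<Delta> where "\<Delta> = (cos t - 1) / 2 * (w i U - w j U) + sin t * r i j U"
    have wr: "w i U = inner u u" "w j U = inner v v" "r i j U = inner u v"
      by (simp_all add: w_def r_def u_def v_def power2_norm_eq_inner)
    have c2: "c ^ 2 = 1 - s ^ 2" using cs by simp
    have "r i j (G * U) = inner (c *\<^sub>R u + s *\<^sub>R v) (c *\<^sub>R v - s *\<^sub>R u)"
      unfolding r_def using GU[of i] GU[of j] ij by simp
    also have "\<dots> = (c ^ 2 - s ^ 2) * inner u v + s * c * (inner v v - inner u u)"
      by (simp add: inner_add_left inner_diff_right inner_commute[of v u] power2_eq_square algebra_simps)
    finally have R: "r i j (G * U) = cos t * r i j U + sin t / 2 * (w j U - w i U)"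
      unfolding wr ct by simp
    have Wi: "w i (G * U) = w i U + \<Delta>"
    proof -
      have "w i (G * U) = inner (c *\<^sub>R u + s *\<^sub>R v) (c *\<^sub>R u + s *\<^sub>R v)"
        unfolding w_def using GU[of i] ij by (simp add: power2_norm_eq_inner)
      also have "\<dots> = c ^ 2 * inner u u + 2 * s * c * inner u v + s ^ 2 * inner v v"
        by (simp add: inner_add_left inner_add_right inner_commute[of v u] power2_eq_square algebra_simps)
      finally show ?thesis unfolding \<Delta>_def wr ct c2 by (simp add: algebra_simps)
    qed
    have Wj: "w j (G * U) = w j U - \<Delta>"
    proof -
      have "w j (G * U) = inner (c *\<^sub>R v - s *\<^sub>R u) (c *\<^sub>R v - s *\<^sub>R u)"
        unfolding w_def using GU[of j] ij by (simp add: power2_norm_eq_inner)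
      also have "\<dots> = c ^ 2 * inner v v - 2 * s * c * inner u v + s ^ 2 * inner u u"
        by (simp add: inner_diff_left inner_diff_right inner_commute[of v u] power2_eq_square algebra_simps)
      finally show ?thesis unfolding \<Delta>_def wr ct c2 by (simp add: algebra_simps)
    qed
    have "(\<Sum>p<N. l p * w p (G * U))
        = (\<Sum>p<N. l p * w p U + (if p = i then l i * \<Delta> else 0) - (if p = j then l j * \<Delta> else 0))"
    proof (intro sum.cong refl)
      fix p assume "p \<in> {..<N}"
      then have "w p (G * U) = w p U" if "p \<noteq> i" "p \<noteq> j"
        unfolding w_def using GU[of p] that by simp
      then show "l p * w p (G * U)
          = l p * w p U + (if p = i then l i * \<Delta> else 0) - (if p = j then l j * \<Delta> else 0)"
        using ij(3) by (cases "p = i"; cases "p = j") (simp_all add: Wi Wj distrib_left right_diff_distrib)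
    qed
    also have "\<dots> = (\<Sum>p<N. l p * w p U) + (l i - l j) * \<Delta>"
      using ij by (simp add: sum.distrib sum_subtractf algebra_simps)
    finally show "?F (G * U) = (cos t * r i j U + sin t / 2 * (w j U - w i U)) *
          ((\<Sum>j<N. l j * w j U) + (l i - l j) * ((cos t - 1) / 2 * (w i U - w j U) + sin t * r i j U)) ^ k"
      unfolding R \<Delta>_def by simp
  qed
  finally show ?thesis ..
qed

end

text \<open>The extra assumption separates the two groups: it holds with \<alpha> = 1/2 for the orthogonal and with
\<alpha> = 1 for the unitary group.\<close>

locale haar_isotropic = haar_setting M N
  for M :: "'a :: {conjugatable_field, real_normed_field, real_inner, second_countable_topology} mat measure"
    and N :: nat +
  fixes \<alpha> :: real
  assumes \<alpha>: "0 < \<alpha>"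
    and second_moment: "\<And>i j k l. i < N \<Longrightarrow> j < N \<Longrightarrow> i \<noteq> j \<Longrightarrow>
      2 * \<alpha> * expectation (\<lambda>U. inner (U $$ (i, 0)) (U $$ (j, 0)) ^ 2
          * (\<Sum>j<N. l j * norm (U $$ (j, 0)) ^ 2) ^ k)
      = expectation (\<lambda>U. norm (U $$ (i, 0)) ^ 2 * norm (U $$ (j, 0)) ^ 2
          * (\<Sum>j<N. l j * norm (U $$ (j, 0)) ^ 2) ^ k)"
begin

lemma expectation_exp_column:
  "expectation (\<lambda>U. exp (x * (\<Sum>j<N. l j * norm (U $$ (j, 0)) ^ 2))) = sphere_series \<alpha> N l x"
proof -
  have le1: "norm (U $$ (j, 0)) \<le> 1" if "U \<in> space M" "j < N" for U j
  proof -
    have "norm (U $$ (j, 0)) ^ 2 \<le> 1"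
      using member_le_sum[of j "{..<N}" "\<lambda>j. norm (U $$ (j, 0)) ^ 2"] column_norm[of U] that
      by (simp add: space_M)
    then show ?thesis by (simp add: abs_square_le_1)
  qed
  interpret isotropic_weights M \<alpha> N "\<lambda>j U. norm (U $$ (j, 0)) ^ 2"
    "\<lambda>i j U. inner (U $$ (i, 0)) (U $$ (j, 0))" l
  proof
    show "0 < \<alpha>" "0 < N" by (fact \<alpha> N)+
    show "(\<lambda>U. norm (U $$ (j, 0)) ^ 2) \<in> borel_measurable M" if "j < N" for j
      using N that by (intro borel_measurable_power entry_norm_measurable entry_measurable)
    show "(\<lambda>U. inner (U $$ (i, 0)) (U $$ (j, 0))) \<in> borel_measurable M" if "i < N" "j < N" for i j
      using N that by (intro borel_measurable_inner entry_measurable)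
    show "(\<Sum>j<N. norm (U $$ (j, 0)) ^ 2) = 1" if "U \<in> space M" for U
      using that by (intro column_norm) (simp add: space_M)
    show "\<bar>inner (U $$ (i, 0)) (U $$ (j, 0))\<bar> \<le> 1" if "U \<in> space M" "i < N" "j < N" for U i j
    proof -
      have "\<bar>inner (U $$ (i, 0)) (U $$ (j, 0))\<bar> \<le> norm (U $$ (i, 0)) * norm (U $$ (j, 0))"
        by (rule Cauchy_Schwarz_ineq2)
      also have "\<dots> \<le> 1" using that by (intro mult_le_one le1) auto
      finally show ?thesis .
    qed
  qed (rule rotation_invariance second_moment zero_le_power2 | assumption)+
  show ?thesis by (rule expectation_exp_eq_sphere_series[unfolded q_def])
qed

lemma expectation_exp_row:
  "expectation (\<lambda>U. exp (x * (\<Sum>j<N. l j * norm (U $$ (0, j)) ^ 2))) = sphere_series \<alpha> N l x"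
  unfolding row_column_exchange by (rule expectation_exp_column)

text \<open>Because the weights sum to 1, an affine change of the eigenvalues acts on q by the same affine
map. This serves to make the spectrum nonnegative and to change the sign of \<theta>; the effect of a
shift is hard to see on the coefficients of the series.\<close>

lemma sphere_series_affine:
  "sphere_series \<alpha> N (\<lambda>j. s * l j + c) x = exp (x * c) * sphere_series \<alpha> N l (s * x)"
proof -
  have "sphere_series \<alpha> N (\<lambda>j. s * l j + c) x
      = expectation (\<lambda>U. exp (x * (\<Sum>j<N. (s * l j + c) * norm (U $$ (j, 0)) ^ 2)))"
    by (rule expectation_exp_column[symmetric])
  also have "\<dots> = expectation (\<lambda>U. exp (x * c) * exp (s * x * (\<Sum>j<N. l j * norm (U $$ (j, 0)) ^ 2)))"
  proof (rule Bochner_Integration.integral_cong[OF refl])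
    fix U assume "U \<in> space M"
    then have "(\<Sum>j<N. norm (U $$ (j, 0)) ^ 2) = 1" by (simp add: space_M column_norm)
    moreover have "(\<Sum>j<N. (s * l j + c) * norm (U $$ (j, 0)) ^ 2)
        = s * (\<Sum>j<N. l j * norm (U $$ (j, 0)) ^ 2) + c * (\<Sum>j<N. norm (U $$ (j, 0)) ^ 2)"
      by (simp add: distrib_right sum.distrib sum_distrib_left mult.assoc)
    ultimately show "exp (x * (\<Sum>j<N. (s * l j + c) * norm (U $$ (j, 0)) ^ 2))
        = exp (x * c) * exp (s * x * (\<Sum>j<N. l j * norm (U $$ (j, 0)) ^ 2))"
      by (simp add: exp_add[symmetric] algebra_simps)
  qed
  also have "\<dots> = exp (x * c) * sphere_series \<alpha> N l (s * x)"
    unfolding integral_mult_right_zero expectation_exp_column ..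
  finally show ?thesis .
qed

end

lemma haar_setting_real:
  assumes "haar_prob N (M :: real mat measure)" "0 < N"
  shows "haar_setting M N"
proof
  show "x * conjugate x = of_real (norm x ^ 2)" for x :: real by (simp add: power2_eq_square)
  have "(\<lambda>x. conjugate x) \<in> borel_measurable (borel :: real measure)"
    by (simp only: conjugate_real_def) measurable
  then show "(conjugate :: real \<Rightarrow> real) \<in> borel_measurable borel" .
qed (use assms in simp_all)

lemma haar_setting_complex:
  assumes "haar_prob N (M :: complex mat measure)" "0 < N"
  shows "haar_setting M N"
proof
  show "x * conjugate x = of_real (norm x ^ 2)" for x :: complex
    using complex_norm_square[of x] by simp
  show "(conjugate :: complex \<Rightarrow> complex) \<in> borel_measurable borel"
    by (intro borel_measurable_continuous_onI) (simp add: continuous_intros)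
qed (use assms in simp_all)

lemma haar_isotropic_real:
  assumes "haar_prob N (M :: real mat measure)" "0 < N"
  shows "haar_isotropic M N (1 / 2)"
proof -
  interpret haar_setting M N using assms by (rule haar_setting_real)
  show ?thesis by unfold_locales (simp_all add: power_mult_distrib)
qed

text \<open>Multiplying the coordinate j by the imaginary unit preserves the moduli and turns the real part
of the product of the conjugate of x with y into minus its imaginary part. The squares of the
two parts add up to |x|^2 |y|^2.\<close>

lemma haar_isotropic_complex:
  assumes "haar_prob N (M :: complex mat measure)" "0 < N"
  shows "haar_isotropic M N 1"
proof -
  interpret haar_setting M N using assms by (rule haar_setting_complex)
  show ?thesis
  proof
    fix i j k and l :: "nat \<Rightarrow> real" assume ij: "i < N" "j < N" "i \<noteq> j"
    define q where "q = (\<lambda>U :: complex mat. \<Sum>j<N. l j * norm (U $$ (j, 0)) ^ 2)"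
    define G :: "complex mat" where "G = plane_mat N i j 1 0 0 \<i>"
    have G: "G \<in> unitary_group N"
      unfolding G_def by (intro plane_mat_unitary ij) simp_all
    let ?F = "\<lambda>U. inner (U $$ (i, 0)) (U $$ (j, 0)) ^ 2 * q U ^ k"
    let ?F' = "\<lambda>U. inner (U $$ (i, 0)) (\<i> * U $$ (j, 0)) ^ 2 * q U ^ k"
    have q_meas: "q \<in> borel_measurable M"
      unfolding q_def using N
      by (intro borel_measurable_times borel_measurable_const
        borel_measurable_sum borel_measurable_power entry_norm_measurable entry_measurable) auto
    have F: "?F \<in> borel_measurable M" "?F' \<in> borel_measurable M"
      using N ij by (intro borel_measurable_times borel_measurable_inner borel_measurable_const
        borel_measurable_power entry_measurable q_meas; simp)+
    have int: "integrable M ?F" "integrable M ?F'"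
    proof -
      have le1: "norm (U $$ (p, 0)) ^ 2 \<le> 1" if "U \<in> space M" "p < N" for U p
        using member_le_sum[of p "{..<N}" "\<lambda>j. norm (U $$ (j, 0)) ^ 2"] column_norm[of U] that
        by (simp add: space_M)
      have q: "\<bar>q U\<bar> \<le> (\<Sum>j<N. \<bar>l j\<bar>)" if "U \<in> space M" for U
        unfolding q_def
      proof (rule order_trans[OF sum_abs], rule sum_mono)
        fix p assume "p \<in> {..<N}"
        then show "\<bar>l p * norm (U $$ (p, 0)) ^ 2\<bar> \<le> \<bar>l p\<bar>"
          using le1[OF that, of p] mult_left_mono[of "norm (U $$ (p, 0)) ^ 2" 1 "\<bar>l p\<bar>"]
          by (simp add: abs_mult)
      qed
      have bound: "norm (inner x y ^ 2 * q U ^ k) \<le> 1 * (\<Sum>j<N. \<bar>l j\<bar>) ^ k"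
        if "U \<in> space M" "norm x ^ 2 \<le> 1" "norm y ^ 2 \<le> 1" for U and x y :: complex
      proof -
        have "inner x y ^ 2 \<le> (norm x * norm y) ^ 2"
          using power_mono[OF Cauchy_Schwarz_ineq2[of x y], of 2] by simp
        also have "\<dots> \<le> 1" unfolding power_mult_distrib using that by (intro mult_le_one) auto
        finally show ?thesis using q[OF that(1)]
          unfolding real_norm_def abs_mult power_abs by (intro mult_mono power_mono) (auto intro: sum_nonneg)
      qed
      show "integrable M ?F" "integrable M ?F'"
        using le1 ij by (intro integrable_const_bound[OF AE_I2[OF bound]] F; simp add: norm_mult)+
    qed
    have "expectation ?F = expectation (\<lambda>U. ?F (G * U))" by (rule left_invariant[OF G F(1), symmetric])
    also have "\<dots> = expectation ?F'"
    proof (rule Bochner_Integration.integral_cong[OF refl])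
      fix U assume "U \<in> space M"
      then have U: "U \<in> carrier_mat N N" by (simp add: space_M unitary_group_carrier)
      have GU: "(G * U) $$ (p, 0) = (if p = j then \<i> * U $$ (j, 0) else U $$ (p, 0))" if "p < N" for p
        unfolding G_def plane_mat_mult_col[OF ij that N U] using ij by auto
      have "norm ((G * U) $$ (p, 0)) = norm (U $$ (p, 0))" if "p < N" for p
        unfolding GU[OF that] by (simp add: norm_mult)
      then have "q (G * U) = q U" unfolding q_def by simp
      then show "?F (G * U) = ?F' U" using GU[of i] GU[of j] ij by simp
    qed
    finally have "2 * expectation ?F = expectation ?F + expectation ?F'" by simp
    also have "\<dots> = expectation (\<lambda>U. ?F U + ?F' U)"
      using int by simp
    also have "\<dots> = expectation (\<lambda>U. norm (U $$ (i, 0)) ^ 2 * norm (U $$ (j, 0)) ^ 2 * q U ^ k)"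
    proof (rule Bochner_Integration.integral_cong[OF refl])
      fix U :: "complex mat"
      have "inner x y ^ 2 + inner x (\<i> * y) ^ 2 = norm x ^ 2 * norm y ^ 2" for x y :: complex
        unfolding cmod_power2 inner_complex_def by (simp add: power2_eq_square algebra_simps)
      then show "?F U + ?F' U = norm (U $$ (i, 0)) ^ 2 * norm (U $$ (j, 0)) ^ 2 * q U ^ k"
        by (simp flip: distrib_right)
    qed
    finally show "2 * 1 * expectation (\<lambda>U. inner (U $$ (i, 0)) (U $$ (j, 0)) ^ 2
          * (\<Sum>j<N. l j * norm (U $$ (j, 0)) ^ 2) ^ k)
      = expectation (\<lambda>U. norm (U $$ (i, 0)) ^ 2 * norm (U $$ (j, 0)) ^ 2
          * (\<Sum>j<N. l j * norm (U $$ (j, 0)) ^ 2) ^ k)"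
      unfolding q_def by simp
  qed simp
qed

lemma orthogonal_integral_eq_sphere_series:
  assumes "haar_prob N M" "0 < N" "A \<in> carrier_mat N N" "diagonal_mat A"
  shows "orthogonal_integral M N \<theta> A = sphere_series (1 / 2) N (\<lambda>j. A $$ (j, j)) (\<theta> * real N)"
proof -
  interpret haar_isotropic M N "1 / 2" using assms by (intro haar_isotropic_real)
  have "orthogonal_integral M N \<theta> A
      = expectation (\<lambda>U. exp (\<theta> * real N * (\<Sum>j<N. A $$ (j, j) * norm (U $$ (0, j)) ^ 2)))"
    unfolding orthogonal_integral_def
  proof (rule Bochner_Integration.integral_cong[OF refl])
    fix U assume "U \<in> space M"
    then have U: "U \<in> carrier_mat N N" by (simp add: space_M unitary_group_carrier)
    have "map_mat of_real A = A" using assms(3) by (intro eq_matI) auto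
    then show "exp (\<theta> * real N * (U * A * mat_adjoint U) $$ (0, 0))
        = exp (\<theta> * real N * (\<Sum>j<N. A $$ (j, j) * norm (U $$ (0, j)) ^ 2))"
      using conjugation_entry[OF U assms(3,4)] by simp
  qed
  also have "\<dots> = sphere_series (1 / 2) N (\<lambda>j. A $$ (j, j)) (\<theta> * real N)"
    by (rule expectation_exp_row)
  finally show ?thesis .
qed

lemma unitary_integral_eq_sphere_series:
  assumes "haar_prob N M" "0 < N" "A \<in> carrier_mat N N" "diagonal_mat A"
  shows "unitary_integral M N \<theta> A = sphere_series 1 N (\<lambda>j. A $$ (j, j)) (\<theta> * real N)"
proof -
  interpret haar_isotropic M N 1 using assms by (intro haar_isotropic_complex)
  have "unitary_integral M N \<theta> A
      = expectation (\<lambda>U. exp (\<theta> * real N * (\<Sum>j<N. A $$ (j, j) * norm (U $$ (0, j)) ^ 2)))"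
    unfolding unitary_integral_def
  proof (rule Bochner_Integration.integral_cong[OF refl])
    fix U assume "U \<in> space M"
    then have U: "U \<in> carrier_mat N N" by (simp add: space_M unitary_group_carrier)
    show "exp (\<theta> * real N * Re ((U * map_mat complex_of_real A * mat_adjoint U) $$ (0, 0)))
        = exp (\<theta> * real N * (\<Sum>j<N. A $$ (j, j) * norm (U $$ (0, j)) ^ 2))"
      unfolding conjugation_entry[OF U assms(3,4)] by (simp only: Re_complex_of_real)
  qed
  also have "\<dots> = sphere_series 1 N (\<lambda>j. A $$ (j, j)) (\<theta> * real N)"
    by (rule expectation_exp_row)
  finally show ?thesis .
qed

section \<open>Two-sided bounds for the power series\<close>

text \<open>The antiderivative of the logarithm; differences of it approximate logarithms of rising
factorials.\<close>

definition xlogx :: "real \<Rightarrow> real" where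
  "xlogx x = x * ln x - x"

lemma xlogx_step:
  assumes "0 < (y::real)"
  shows "ln y \<le> xlogx (y + 1) - xlogx y"
    and "xlogx (y + 1) - xlogx y - ln ((y + 1) / y) \<le> ln y"
proof -
  have "ln (y / (y + 1)) \<le> y / (y + 1) - 1" using assms by (intro ln_le_minus_one) auto
  also have "\<dots> = - (1 / (y + 1))" using assms by (simp add: field_simps)
  finally have "1 / (y + 1) \<le> ln (y + 1) - ln y" using assms by (simp add: ln_div)
  from mult_left_mono[OF this, of "y + 1"] have "1 \<le> (y + 1) * (ln (y + 1) - ln y)"
    using assms by simp
  then show "ln y \<le> xlogx (y + 1) - xlogx y" by (simp add: xlogx_def algebra_simps)
  have "ln ((y + 1) / y) \<le> (y + 1) / y - 1" using assms by (intro ln_le_minus_one) auto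
  also have "\<dots> = 1 / y" using assms by (simp add: field_simps)
  finally have "ln (y + 1) - ln y \<le> 1 / y" using assms by (simp add: ln_div)
  from mult_left_mono[OF this, of "y"] have "y * (ln (y + 1) - ln y) \<le> 1"
    using assms by simp
  then show "xlogx (y + 1) - xlogx y - ln ((y + 1) / y) \<le> ln y"
    using assms by (simp add: xlogx_def algebra_simps ln_div)
qed

text \<open>The sum of ln (a + i) compared with the integral of ln. The error ln ((a + n)/a) is negligible
on the exponential scale.\<close>

lemma ln_pochhammer_bounds:
  assumes "0 < (a::real)"
  shows "ln (pochhammer a n) \<le> xlogx (a + real n) - xlogx a"
    and "xlogx (a + real n) - xlogx a - ln ((a + real n) / a) \<le> ln (pochhammer a n)"
proof (induction n)
  case (Suc n)
  have pos: "0 < pochhammer a n" using assms by (rule pochhammer_pos)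
  have e: "ln (pochhammer a (Suc n)) = ln (pochhammer a n) + ln (a + real n)"
    unfolding pochhammer_Suc using pos assms by (subst ln_mult) auto
  have f: "a + real (Suc n) = (a + real n) + 1" by simp
  have g: "ln ((a + real n + 1) / a) = ln ((a + real n) / a) + ln ((a + real n + 1) / (a + real n))"
    using assms by (simp add: ln_div)
  note s = xlogx_step[of "a + real n"]
  { case 1 then show ?case unfolding e f using Suc.IH(1) s(1) assms by simp }
  { case 2 then show ?case unfolding e f g using Suc.IH(2) s(2) assms by simp }
qed (use assms in simp_all)

text \<open>The tangent at w of the convex function \<open>xlogx\<close>.\<close>

lemma xlogx_ge_tangent:
  assumes "0 < y" "0 < w" shows "y * ln w - w \<le> xlogx y"
proof -
  have "ln (w / y) \<le> w / y - 1" using assms by (intro ln_le_minus_one) auto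
  from mult_left_mono[OF this, of y] show ?thesis
    using assms by (simp add: xlogx_def ln_div algebra_simps)
qed

text \<open>The tangent at w plus a quadratic correction, which is affordable because it will be averaged
over a variable of mean close to w and variance of order w.\<close>

lemma xlogx_le_parabola:
  assumes "0 < y" "0 < w" shows "xlogx y \<le> y * ln w - w + (y - w) ^ 2 / w"
proof -
  have "ln (y / w) \<le> y / w - 1" using assms by (intro ln_le_minus_one) auto
  from mult_left_mono[OF this, of y] have "y * ln y - y * ln w \<le> y * (y / w - 1)"
    using assms by (simp add: ln_div algebra_simps)
  also have "y * (y / w - 1) = y - w + (y - w)^2 / w"
    using assms by (simp add: field_simps power2_eq_square)
  finally show ?thesis by (simp add: xlogx_def)
qed

context
  fixes \<alpha> x z w a C G m v :: real and N :: nat and l :: "nat \<Rightarrow> real"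
  assumes \<alpha>: "0 < \<alpha>" "\<alpha> \<le> 1" and N: "0 < N" and x: "0 < x" and z: "0 < z"
    and l: "\<And>j. j < N \<Longrightarrow> 0 \<le> l j" "\<And>j. j < N \<Longrightarrow> l j < z"
  defines "w \<equiv> x * z" and "a \<equiv> real N * \<alpha>"
    and "C \<equiv> x * z - real N * \<alpha> * ln (x * z) + xlogx (real N * \<alpha>)"
    and "G \<equiv> (\<Prod>j<N. (1 - l j / z) powr (-\<alpha>))"
    and "m \<equiv> \<alpha> * (\<Sum>j<N. l j / (z - l j))"
    and "v \<equiv> \<alpha> * (\<Sum>j<N. z * l j / (z - l j) ^ 2)"
begin

lemma pos_w_a: "0 < w" "0 < a" using x z N \<alpha> by (auto simp: w_def a_def)

lemma weights_nonneg: "0 \<le> spectral_coeff \<alpha> N l k * (1 / z) ^ k"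
  using \<alpha> l z by (intro mult_nonneg_nonneg spectral_coeff_nonneg) auto

lemma weights_sums:
  "(\<lambda>k. spectral_coeff \<alpha> N l k * (1 / z) ^ k) sums G"
  "(\<lambda>k. real k * (spectral_coeff \<alpha> N l k * (1 / z) ^ k)) sums (m * G)"
  "(\<lambda>k. real k ^ 2 * (spectral_coeff \<alpha> N l k * (1 / z) ^ k)) sums ((v + m ^ 2) * G)"
proof -
  have 1: "0 \<le> 1 / z" "\<And>j. j < N \<Longrightarrow> 1 / z * l j < 1" using z l by auto
  have 2: "1 / z * l j = l j / z" for j by simp
  have 3: "l j / z / (1 - l j / z) = l j / (z - l j)" "l j / z / (1 - l j / z) ^ 2 = z * l j / (z - l j) ^ 2"
    if "j < N" for j
  proof -
    have e: "1 - l j / z = (z - l j) / z" using z by (simp add: field_simps)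
    show "l j / z / (1 - l j / z) = l j / (z - l j)" "l j / z / (1 - l j / z) ^ 2 = z * l j / (z - l j) ^ 2"
      unfolding e power_divide using z by (simp_all add: power2_eq_square)
  qed
  have 4: "(\<Sum>j<N. l j / z / (1 - l j / z)) = (\<Sum>j<N. l j / (z - l j))"
    "(\<Sum>j<N. l j / z / (1 - l j / z) ^ 2) = (\<Sum>j<N. z * l j / (z - l j) ^ 2)"
    by (intro sum.cong refl 3; simp)+
  show "(\<lambda>k. spectral_coeff \<alpha> N l k * (1 / z) ^ k) sums G"
    using spectral_coeff_sums[of \<alpha> "1 / z" N l] \<alpha> 1 l unfolding 2 G_def by blast
  show "(\<lambda>k. real k * (spectral_coeff \<alpha> N l k * (1 / z) ^ k)) sums (m * G)"
    using spectral_moment_sums(1)[of \<alpha> "1 / z" N l] \<alpha> 1 l unfolding 2 4 G_def m_def by blast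
  show "(\<lambda>k. real k ^ 2 * (spectral_coeff \<alpha> N l k * (1 / z) ^ k)) sums ((v + m ^ 2) * G)"
    using spectral_moment_sums(2)[of \<alpha> "1 / z" N l] \<alpha> 1 l unfolding 2 4 G_def m_def v_def by blast
qed

lemma power_over_pochhammer_le:
  "w ^ k / pochhammer a k \<le> (1 + real k / a) * exp C"
proof -
  note p = pos_w_a
  have pp: "0 < pochhammer a k" using p by (intro pochhammer_pos) auto
  have "ln (w ^ k / pochhammer a k) = real k * ln w - ln (pochhammer a k)"
    using p pp by (simp add: ln_div ln_realpow)
  also have "\<dots> \<le> real k * ln w - xlogx (a + real k) + xlogx a + ln ((a + real k) / a)"
    using ln_pochhammer_bounds(2)[of a k] p by linarith
  also have "\<dots> \<le> C + ln (1 + real k / a)"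
  proof -
    have "(a + real k) / a = 1 + real k / a" using p by (simp add: field_simps)
    moreover have "(a + real k) * ln w - w \<le> xlogx (a + real k)"
      using p by (intro xlogx_ge_tangent) auto
    ultimately show ?thesis
      unfolding C_def w_def[symmetric] a_def[symmetric] by (simp add: algebra_simps)
  qed
  finally have "exp (ln (w ^ k / pochhammer a k)) \<le> exp (C + ln (1 + real k / a))" by simp
  moreover have "0 < w ^ k / pochhammer a k" using p pp by auto
  moreover have "0 < 1 + real k / a" using p by (simp add: add_pos_nonneg)
  ultimately show ?thesis by (simp only: exp_add exp_ln mult.commute)
qed

lemma power_over_pochhammer_ge:
  "exp (C - (a + real k - w) ^ 2 / w) \<le> w ^ k / pochhammer a k"
proof -
  note p = pos_w_a
  have pp: "0 < pochhammer a k" using p by (intro pochhammer_pos) auto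
  have "C - (a + real k - w) ^ 2 / w \<le> real k * ln w - xlogx (a + real k) + xlogx a"
    using xlogx_le_parabola[of "a + real k" w] p
    by (simp add: C_def w_def a_def algebra_simps)
  also have "\<dots> \<le> real k * ln w - ln (pochhammer a k)"
    using ln_pochhammer_bounds(1)[of a k] p by linarith
  also have "\<dots> = ln (w ^ k / pochhammer a k)"
    using p pp by (simp add: ln_div ln_realpow)
  finally have "exp (C - (a + real k - w) ^ 2 / w) \<le> exp (ln (w ^ k / pochhammer a k))" by simp
  moreover have "0 < w ^ k / pochhammer a k" using p pp by auto
  ultimately show ?thesis by (simp only: exp_ln)
qed

lemma sphere_series_term:
  "x ^ k * spectral_coeff \<alpha> N l k / pochhammer a k
     = spectral_coeff \<alpha> N l k * (1 / z) ^ k * (w ^ k / pochhammer a k)"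
  using z by (simp add: w_def power_mult_distrib field_simps)

text \<open>Up to a constant factor the bound for w^k over the rising factorial is linear in k, so averaging
it involves only the mean m.\<close>

lemma sphere_series_upper:
  "summable (\<lambda>k. x ^ k * spectral_coeff \<alpha> N l k / pochhammer a k)"
  "sphere_series \<alpha> N l x \<le> G * (1 + m / a) * exp C"
proof -
  let ?p = "\<lambda>k. spectral_coeff \<alpha> N l k * (1 / z) ^ k"
  have "(\<lambda>k. (?p k + real k * ?p k / a) * exp C) sums ((G + m * G / a) * exp C)"
    by (intro sums_mult2 sums_add sums_divide weights_sums)
  moreover have "(?p k + real k * ?p k / a) * exp C = ?p k * ((1 + real k / a) * exp C)" for k
    by (simp add: algebra_simps)
  ultimately have dom: "(\<lambda>k. ?p k * ((1 + real k / a) * exp C)) sums (G * (1 + m / a) * exp C)"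
    by (simp add: algebra_simps)
  have nn: "0 \<le> w ^ k / pochhammer a k" for k
    using pos_w_a by (auto intro!: divide_nonneg_nonneg pochhammer_nonneg)
  have le: "x ^ k * spectral_coeff \<alpha> N l k / pochhammer a k \<le> ?p k * ((1 + real k / a) * exp C)" for k
    unfolding sphere_series_term by (intro mult_left_mono power_over_pochhammer_le weights_nonneg)
  have ge: "0 \<le> x ^ k * spectral_coeff \<alpha> N l k / pochhammer a k" for k
    unfolding sphere_series_term by (intro mult_nonneg_nonneg weights_nonneg nn)
  show summ: "summable (\<lambda>k. x ^ k * spectral_coeff \<alpha> N l k / pochhammer a k)"
  proof (rule summable_comparison_test'[OF sums_summable[OF dom], of 0])
    fix k show "norm (x ^ k * spectral_coeff \<alpha> N l k / pochhammer a k) \<le> ?p k * ((1 + real k / a) * exp C)"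
      unfolding real_norm_def abs_of_nonneg[OF ge] by (rule le)
  qed
  show "sphere_series \<alpha> N l x \<le> G * (1 + m / a) * exp C"
    unfolding sphere_series_def a_def[symmetric] sums_unique[OF dom]
    by (intro suminf_le le summ sums_summable[OF dom])
qed

lemma sphere_series_pos: "0 < sphere_series \<alpha> N l x"
proof -
  let ?t = "\<lambda>k. x ^ k * spectral_coeff \<alpha> N l k / pochhammer a k"
  have "0 \<le> ?t k" for k
    using pos_w_a x \<alpha> l
    by (intro divide_nonneg_nonneg mult_nonneg_nonneg spectral_coeff_nonneg pochhammer_nonneg) auto
  then have "(\<Sum>k<Suc 0. ?t k) \<le> (\<Sum>k. ?t k)"
    by (intro sum_le_suminf sphere_series_upper(1)) auto
  then show ?thesis by (simp add: sphere_series_def a_def)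
qed

text \<open>Drop the first n terms, move the index of the others back by n at the price given by
\<open>spectral_coeff_shift\<close>, and apply Jensen's inequality to exp (C - (a + n + J - w)^2/w), where J
has the weights of \<open>weights_sums\<close> as its law. The expectation of the square is the variance v
plus the squared bias.\<close>

lemma sphere_series_lower:
  assumes "i < N"
  shows "pochhammer \<alpha> n / fact n * (l i / z) ^ n * G
           * exp (C - (v + (a + real n + m - w) ^ 2) / w) \<le> sphere_series \<alpha> N l x"
proof -
  let ?p = "\<lambda>k. spectral_coeff \<alpha> N l k * (1 / z) ^ k"
  let ?c = "pochhammer \<alpha> n / fact n * (l i / z) ^ n"
  let ?t = "\<lambda>k. x ^ k * spectral_coeff \<alpha> N l k / pochhammer a k"
  note w = pos_w_a(1)
  have c: "0 \<le> ?c" using \<alpha> l(1)[OF assms] z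
    by (intro mult_nonneg_nonneg divide_nonneg_nonneg pochhammer_nonneg) auto
  define b where "b = a + real n - w"
  define V where "V = (v + (b + m) ^ 2) / w"
  have nn: "0 \<le> w ^ k / pochhammer a k" for k
    using pos_w_a by (auto intro!: divide_nonneg_nonneg pochhammer_nonneg)
  have shift: "?c * ?p k * (w ^ (k + n) / pochhammer a (k + n)) \<le> ?t (k + n)" for k
  proof -
    have "?c * ?p k = (pochhammer \<alpha> n / fact n * l i ^ n * spectral_coeff \<alpha> N l k) * (1 / z) ^ (k + n)"
      by (simp add: power_add power_divide field_simps)
    also have "\<dots> \<le> ?p (k + n)"
      using \<alpha> l z assms by (intro mult_right_mono spectral_coeff_shift) auto
    finally show ?thesis unfolding sphere_series_term by (intro mult_right_mono nn)
  qed
  have ge: "exp (C - V) * (1 + V - (b + real k) ^ 2 / w) \<le> w ^ (k + n) / pochhammer a (k + n)" for k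
  proof -
    \<comment> \<open>Jensen's inequality in the form exp y \<ge> exp m (1 + y - m), with m = C - V the mean of the exponents\<close>
    have "exp (C - V) * (1 + (V - (b + real k) ^ 2 / w)) \<le> exp (C - V) * exp (V - (b + real k) ^ 2 / w)"
      by (intro mult_left_mono exp_ge_add_one_self) auto
    also have "\<dots> = exp (C - (a + real (k + n) - w) ^ 2 / w)"
      by (simp add: b_def algebra_simps flip: exp_add)
    also have "\<dots> \<le> w ^ (k + n) / pochhammer a (k + n)" by (rule power_over_pochhammer_ge)
    finally show ?thesis by (simp add: algebra_simps)
  qed
  have "(\<lambda>k. exp (C - V) * ((1 + V - b ^ 2 / w) * ?p k - 2 * b / w * (real k * ?p k) - (real k ^ 2 * ?p k) / w))
        sums (exp (C - V) * ((1 + V - b ^ 2 / w) * G - 2 * b / w * (m * G) - ((v + m ^ 2) * G) / w))"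
    by (intro sums_mult sums_diff sums_divide weights_sums)
  moreover have "exp (C - V) * ((1 + V - b ^ 2 / w) * P - 2 * b / w * (q * P) - (q ^ 2 * P) / w)
      = P * (exp (C - V) * (1 + V - (b + q) ^ 2 / w))" for P q
    using w by (simp add: field_simps power2_eq_square)
  moreover have "exp (C - V) * ((1 + V - b ^ 2 / w) * G - 2 * b / w * (m * G) - ((v + m ^ 2) * G) / w)
      = G * exp (C - V)"
    using w by (simp add: V_def field_simps power2_eq_square)
  ultimately have "(\<lambda>k. ?p k * (exp (C - V) * (1 + V - (b + real k) ^ 2 / w))) sums (G * exp (C - V))"
    by (simp only:)
  then have dom: "(\<lambda>k. ?c * (?p k * (exp (C - V) * (1 + V - (b + real k) ^ 2 / w)))) sums (?c * (G * exp (C - V)))"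
    by (rule sums_mult)
  have le: "?c * (?p k * (exp (C - V) * (1 + V - (b + real k) ^ 2 / w))) \<le> ?t (k + n)" for k
  proof -
    have "?c * (?p k * (exp (C - V) * (1 + V - (b + real k) ^ 2 / w)))
        \<le> ?c * (?p k * (w ^ (k + n) / pochhammer a (k + n)))"
      by (intro mult_left_mono c weights_nonneg ge)
    also have "\<dots> \<le> ?t (k + n)" using shift[of k] by (simp only: mult.assoc)
    finally show ?thesis .
  qed
  have "?c * (G * exp (C - V)) \<le> (\<Sum>k. ?t (k + n))"
    unfolding sums_unique[OF dom]
    by (intro suminf_le le sums_summable[OF dom] summable_ignore_initial_segment sphere_series_upper(1))
  also have "\<dots> \<le> (\<Sum>k. ?t k)"
  proof -
    have "0 \<le> (\<Sum>k<n. ?t k)"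
      unfolding sphere_series_term by (intro sum_nonneg mult_nonneg_nonneg weights_nonneg nn)
    then show ?thesis
      using suminf_split_initial_segment[OF sphere_series_upper(1), of n] by linarith
  qed
  finally show ?thesis
    unfolding sphere_series_def a_def[symmetric] V_def b_def by (simp add: algebra_simps)
qed

end

section \<open>The Hilbert transform above the support\<close>

text \<open>The point b is an upper bound of the support, not necessarily its supremum; -c is a lower bound.\<close>

locale bounded_support = real_distribution \<mu> for \<mu> :: "real measure" +
  fixes b c :: real
  assumes support: "AE x in \<mu>. x \<le> b" "AE x in \<mu>. - c \<le> x" and c_pos: "0 < b + c"
begin

lemma integrable_bounded_on_support:
  fixes f :: "real \<Rightarrow> real"
  assumes "f \<in> borel_measurable borel" "\<And>x. - c \<le> x \<Longrightarrow> x \<le> b \<Longrightarrow> \<bar>f x\<bar> \<le> B"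
  shows "integrable \<mu> f"
proof (rule integrable_const_bound[where B = B])
  show "AE x in \<mu>. norm (f x) \<le> B" using support by eventually_elim (auto intro: assms(2))
qed (use assms(1) in simp)

lemma integrable_continuous_on_support:
  fixes f :: "real \<Rightarrow> real"
  assumes "f \<in> borel_measurable borel" "continuous_on {-c..b} f"
  shows "integrable \<mu> f"
proof -
  have "bounded (f ` {-c..b})"
    using assms(2) by (intro compact_imp_bounded compact_continuous_image) auto
  then obtain B where "\<forall>x\<in>{-c..b}. \<bar>f x\<bar> \<le> B" by (auto simp: bounded_iff)
  then show ?thesis using assms(1) by (intro integrable_bounded_on_support[where B = B]) auto
qed

lemma hilbert_transform_antimono:
  assumes "b < z" "z \<le> z'"
  shows "hilbert_transform \<mu> z' \<le> hilbert_transform \<mu> z"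
  unfolding hilbert_transform_def
proof (rule integral_mono_AE)
  show "integrable \<mu> (\<lambda>x. 1 / (z' - x))" "integrable \<mu> (\<lambda>x. 1 / (z - x))"
    using assms by (auto intro!: integrable_continuous_on_support continuous_intros)
  show "AE x in \<mu>. 1 / (z' - x) \<le> 1 / (z - x)"
    using support(1) by eventually_elim (use assms in \<open>auto intro!: divide_left_mono\<close>)
qed

lemma integrable_resolvent: "b < z \<Longrightarrow> integrable \<mu> (\<lambda>x. 1 / (z - x))"
  by (auto intro!: integrable_continuous_on_support continuous_intros)

lemma hilbert_transform_strict_antimono:
  assumes "b < z" "z < z'"
  shows "hilbert_transform \<mu> z' < hilbert_transform \<mu> z"
proof -
  define e where "e = 1 / (z + c) - 1 / (z' + c)"
  have e: "0 < e" using assms c_pos unfolding e_def by (simp add: divide_strict_left_mono)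
  have "e = (\<integral>x. e \<partial>\<mu>)" using prob_space by simp
  also have "\<dots> \<le> (\<integral>x. 1 / (z - x) - 1 / (z' - x) \<partial>\<mu>)"
  proof (rule integral_mono_AE)
    show "AE x in \<mu>. e \<le> 1 / (z - x) - 1 / (z' - x)"
      using support
    proof eventually_elim
      case (elim x)
      have "e = (z' - z) / ((z + c) * (z' + c))"
        using assms c_pos unfolding e_def by (simp add: field_simps)
      also have "\<dots> \<le> (z' - z) / ((z - x) * (z' - x))"
        using assms elim by (intro divide_left_mono mult_mono mult_pos_pos) auto
      also have "\<dots> = 1 / (z - x) - 1 / (z' - x)"
        using assms elim by (simp add: field_simps)
      finally show ?case .
    qed
  qed (use assms in \<open>simp_all add: integrable_resolvent\<close>)
  also have "\<dots> = hilbert_transform \<mu> z - hilbert_transform \<mu> z'"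
    unfolding hilbert_transform_def using assms by (simp add: integrable_resolvent)
  finally show ?thesis using e by simp
qed

lemma hilbert_transform_bounds:
  assumes "b < z"
  shows "0 < hilbert_transform \<mu> z" "hilbert_transform \<mu> z \<le> 1 / (z - b)"
proof -
  have "0 \<le> hilbert_transform \<mu> (z + 1)"
    unfolding hilbert_transform_def
    by (rule integral_nonneg_AE, use support(1) in eventually_elim, use assms in auto)
  also have "\<dots> < hilbert_transform \<mu> z" using assms by (intro hilbert_transform_strict_antimono) auto
  finally show "0 < hilbert_transform \<mu> z" .
  have "hilbert_transform \<mu> z \<le> (\<integral>x. 1 / (z - b) \<partial>\<mu>)"
    unfolding hilbert_transform_def
  proof (rule integral_mono_AE)
    show "AE x in \<mu>. 1 / (z - x) \<le> 1 / (z - b)"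
      using support(1) by eventually_elim (use assms in \<open>auto intro!: divide_left_mono\<close>)
  qed (use assms in \<open>simp_all add: integrable_resolvent\<close>)
  then show "hilbert_transform \<mu> z \<le> 1 / (z - b)" using prob_space by simp
qed

lemma hilbert_transform_continuous:
  assumes "b < z0"
  shows "continuous_on {z0..} (hilbert_transform \<mu>)"
proof -
  define L where "L = 1 / (z0 - b) ^ 2"
  have *: "hilbert_transform \<mu> y - hilbert_transform \<mu> z \<le> L * (z - y)" if "z0 \<le> y" "y \<le> z" for y z
  proof -
    have "hilbert_transform \<mu> y - hilbert_transform \<mu> z = (\<integral>x. 1 / (y - x) - 1 / (z - x) \<partial>\<mu>)"
      unfolding hilbert_transform_def using assms that by (simp add: integrable_resolvent)
    also have "\<dots> \<le> (\<integral>x. L * (z - y) \<partial>\<mu>)"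
    proof (rule integral_mono_AE)
      show "AE x in \<mu>. 1 / (y - x) - 1 / (z - x) \<le> L * (z - y)"
        using support(1)
      proof eventually_elim
        case (elim x)
        have "1 / (y - x) - 1 / (z - x) = (z - y) / ((y - x) * (z - x))"
          using assms that elim by (simp add: field_simps)
        also have "\<dots> \<le> (z - y) / ((z0 - b) * (z0 - b))"
          using assms that elim by (intro divide_left_mono mult_mono mult_pos_pos) auto
        finally show ?case by (simp add: L_def power2_eq_square)
      qed
    qed (use assms that in \<open>simp_all add: integrable_resolvent\<close>)
    finally show ?thesis using prob_space by simp
  qed
  have "L-lipschitz_on {z0..} (hilbert_transform \<mu>)"
  proof (rule lipschitz_onI)
    fix y z assume yz: "y \<in> {z0..}" "z \<in> {z0..}"
    show "dist (hilbert_transform \<mu> y) (hilbert_transform \<mu> z) \<le> L * dist y z"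
    proof (cases "y \<le> z")
      case True
      then show ?thesis
        using *[of y z] hilbert_transform_antimono[of y z] yz assms by (simp add: dist_real_def)
    next
      case False
      then show ?thesis
        using *[of z y] hilbert_transform_antimono[of z y] yz assms by (simp add: dist_real_def)
    qed
  qed (simp add: L_def)
  then show ?thesis by (rule lipschitz_on_continuous_on)
qed

lemma H_max_tendsto: "((\<lambda>z. ereal (hilbert_transform \<mu> z)) \<longlongrightarrow> H_max \<mu> b) (at_right b)"
  and hilbert_transform_le_H_max: "b < z \<Longrightarrow> ereal (hilbert_transform \<mu> z) \<le> H_max \<mu> b"
proof -
  define L where "L = (SUP z\<in>{b<..}. ereal (hilbert_transform \<mu> z))"
  have lim: "((\<lambda>z. ereal (hilbert_transform \<mu> z)) \<longlongrightarrow> L) (at_right b)"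
  proof (rule order_tendstoI)
    fix y assume "y < L"
    then obtain z0 where z0: "b < z0" "y < ereal (hilbert_transform \<mu> z0)"
      unfolding L_def less_SUP_iff by auto
    show "\<forall>\<^sub>F z in at_right b. y < ereal (hilbert_transform \<mu> z)"
      using eventually_at_right_less[of b] eventually_at_right_real[OF z0(1)]
    proof eventually_elim
      case (elim z)
      then have "hilbert_transform \<mu> z0 \<le> hilbert_transform \<mu> z"
        by (intro hilbert_transform_antimono) auto
      then show ?case using z0(2) by (simp add: less_le_trans)
    qed
  next
    fix y assume "L < y"
    show "\<forall>\<^sub>F z in at_right b. ereal (hilbert_transform \<mu> z) < y"
      using eventually_at_right_less[of b]
    proof eventually_elim
      case (elim z)
      then have "ereal (hilbert_transform \<mu> z) \<le> L" unfolding L_def by (intro SUP_upper) auto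
      then show ?case using \<open>L < y\<close> by (rule le_less_trans)
    qed
  qed
  have eq: "H_max \<mu> b = L" unfolding H_max_def by (rule tendsto_Lim[OF _ lim]) simp
  show "((\<lambda>z. ereal (hilbert_transform \<mu> z)) \<longlongrightarrow> H_max \<mu> b) (at_right b)" using lim eq by simp
  show "ereal (hilbert_transform \<mu> z) \<le> H_max \<mu> b" if "b < z"
    unfolding eq L_def using that by (intro SUP_upper) auto
qed

text \<open>H decreases continuously from its limit at b to 0, because H(z) is at most 1/(z - b).\<close>

lemma hilbert_transform_attains:
  assumes "0 < \<gamma>" "ereal \<gamma> < H_max \<mu> b"
  shows "\<exists>z>b. hilbert_transform \<mu> z = \<gamma>"
proof -
  have "\<forall>\<^sub>F z in at_right b. b < z \<and> \<gamma> < hilbert_transform \<mu> z"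
    using order_tendstoD(1)[OF H_max_tendsto assms(2)] eventually_at_right_less[of b]
    by eventually_elim simp
  then obtain y where y: "b < y" "\<gamma> < hilbert_transform \<mu> y"
    using eventually_happens[of _ "at_right b"] by auto
  define z where "z = y + 1 / \<gamma>"
  have "0 < 1 / \<gamma>" using assms by simp
  then have z: "b < z" "y \<le> z" using y unfolding z_def by linarith+
  have "hilbert_transform \<mu> z \<le> 1 / (z - b)" using z(1) by (rule hilbert_transform_bounds)
  also have "\<dots> \<le> 1 / (1 / \<gamma>)"
    using y assms z by (intro divide_left_mono) (auto simp: z_def)
  finally have "hilbert_transform \<mu> z \<le> \<gamma>" by simp
  moreover have "continuous_on {y..z} (hilbert_transform \<mu>)"
    by (rule continuous_on_subset[OF hilbert_transform_continuous[OF y(1)]]) auto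
  ultimately obtain x where "y \<le> x" "hilbert_transform \<mu> x = \<gamma>"
    using IVT2'[of "hilbert_transform \<mu>" z \<gamma> y] y z by auto
  then show ?thesis using y by (intro exI[of _ x]) auto
qed

end

section \<open>The limit of the power series\<close>

lemma powr_prod_ln:
  fixes f :: "nat \<Rightarrow> real"
  assumes "\<And>j. j < N \<Longrightarrow> 0 < f j"
  shows "0 < (\<Prod>j<N. f j powr r)" and "ln (\<Prod>j<N. f j powr r) = r * (\<Sum>j<N. ln (f j))"
proof -
  have nz: "f j \<noteq> 0" if "j < N" for j using assms[OF that] by simp
  show "0 < (\<Prod>j<N. f j powr r)" using nz by (intro prod_pos) auto
  have "ln (\<Prod>j<N. f j powr r) = (\<Sum>j<N. ln (f j powr r))"
    using nz by (intro ln_prod) auto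
  also have "\<dots> = (\<Sum>j<N. r * ln (f j))"
    using nz by (intro sum.cong refl) (auto simp: ln_powr)
  finally show "ln (\<Prod>j<N. f j powr r) = r * (\<Sum>j<N. ln (f j))" by (simp add: sum_distrib_left)
qed

text \<open>The eigenvalues are shifted by c in all uses of the power series, because its bounds require
nonnegative arguments; the quantities z and b keep their meaning, and z - x does not feel the
shift.\<close>

locale spectral_limit = bounded_support \<mu> b c for \<mu> :: "real measure" and b c :: real +
  fixes lam :: "nat \<Rightarrow> nat \<Rightarrow> real" and top_index :: "nat \<Rightarrow> nat"
  assumes empirical_limit:
      "\<And>f hi. b < hi \<Longrightarrow> f \<in> borel_measurable borel \<Longrightarrow> continuous_on {-c..hi} f \<Longrightarrow>
        (\<lambda>N. (\<Sum>j<N. f (lam N j)) / real N) \<longlonglongrightarrow> integral\<^sup>L \<mu> f"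
    and lam_ge: "\<And>N j. j < N \<Longrightarrow> 0 \<le> lam N j + c"
    and top_index: "\<And>N. 0 < N \<Longrightarrow> top_index N < N"
    and lam_le_top: "\<And>N j. j < N \<Longrightarrow> lam N j \<le> lam N (top_index N)"
    and top_limit: "(\<lambda>N. lam N (top_index N)) \<longlonglongrightarrow> b"
begin

lemma eventually_below:
  assumes "b < z"
  shows "\<forall>\<^sub>F N in sequentially. 0 < N \<and> - c < lam N (top_index N) \<and> (\<forall>j<N. lam N j < z)"
proof -
  have "\<forall>\<^sub>F N in sequentially. lam N (top_index N) < z" "\<forall>\<^sub>F N in sequentially. - c < lam N (top_index N)"
    using order_tendstoD[OF top_limit] assms c_pos by auto
  then show ?thesis
    using eventually_gt_at_top[of 0] by eventually_elim (metis lam_le_top le_less_trans)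
qed

context
  fixes \<alpha> \<theta> :: real
  assumes \<alpha>: "0 < \<alpha>" "\<alpha> \<le> 1" and \<theta>: "0 < \<theta>"
begin

text \<open>The function F of the introduction. Its derivative \<theta> - \<alpha> H(z) vanishes exactly when H(z) = \<theta>/\<alpha>,
and H decreases, so the limit found below is the infimum of F over z > b.\<close>

definition free_energy :: "real \<Rightarrow> real" where
  "free_energy z = \<theta> * z - \<alpha> - \<alpha> * (\<integral>x. ln (\<theta> / \<alpha> * (z - x)) \<partial>\<mu>)"

definition log_series :: "nat \<Rightarrow> real" where
  "log_series N = ln (sphere_series \<alpha> N (\<lambda>j. lam N j + c) (\<theta> * real N)) / real N - \<theta> * c"

text \<open>The logarithm of G e^C, the main term common to both bounds, on the scale of N and with the
shift by c undone.\<close>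

definition prefactor :: "real \<Rightarrow> nat \<Rightarrow> real" where
  "prefactor z N = (\<theta> * real N * (z + c) - real N * \<alpha> * ln (\<theta> * real N * (z + c)) + xlogx (real N * \<alpha>)
      + ln (\<Prod>j<N. (1 - (lam N j + c) / (z + c)) powr - \<alpha>)) / real N - \<theta> * c"

lemma prefactor_tendsto:
  assumes z: "b < z"
  shows "prefactor z \<longlonglongrightarrow> free_energy z"
proof -
  have zc: "0 < z + c" using z c_pos by simp
  let ?s = "\<lambda>N. (\<Sum>j<N. ln (\<theta> / \<alpha> * (z - lam N j))) / real N"
  have "?s \<longlonglongrightarrow> (\<integral>x. ln (\<theta> / \<alpha> * (z - x)) \<partial>\<mu>)"
    using z \<alpha> \<theta> by (intro empirical_limit[where hi = "(b + z) / 2"]) (auto intro!: continuous_intros)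
  then have "(\<lambda>N. \<theta> * z - \<alpha> - \<alpha> * ?s N) \<longlonglongrightarrow> free_energy z"
    unfolding free_energy_def by (intro tendsto_intros)
  moreover have "\<forall>\<^sub>F N in sequentially. \<theta> * z - \<alpha> - \<alpha> * ?s N = prefactor z N"
    using eventually_below[OF z]
  proof eventually_elim
    case (elim N)
    have e: "1 - (lam N j + c) / (z + c) = (z - lam N j) / (z + c)" for j
      using zc by (simp add: field_simps)
    have pos: "0 < 1 - (lam N j + c) / (z + c)" if "j < N" for j
      unfolding e using elim that zc by simp
    have "ln (1 - (lam N j + c) / (z + c)) = ln (\<theta> / \<alpha> * (z - lam N j)) - ln (\<theta> * (z + c) / \<alpha>)"
      if "j < N" for j
    proof -
      have "0 < z - lam N j" using elim that by simp
      then show ?thesis unfolding e using zc \<alpha> \<theta> by (simp only: ln_div ln_mult mult_pos_pos divide_pos_pos) simp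
    qed
    then have "ln (\<Prod>j<N. (1 - (lam N j + c) / (z + c)) powr - \<alpha>)
        = - \<alpha> * ((\<Sum>j<N. ln (\<theta> / \<alpha> * (z - lam N j))) - real N * ln (\<theta> * (z + c) / \<alpha>))"
      by (subst powr_prod_ln(2)[OF pos]) (simp_all add: sum_subtractf)
    moreover have "ln (\<theta> * real N * (z + c)) = ln (\<theta> * (z + c) / \<alpha>) + ln (real N * \<alpha>)"
      using elim zc \<alpha> \<theta> by (simp add: ln_div ln_mult)
    ultimately show ?case
      using elim by (simp add: prefactor_def xlogx_def field_simps)
  qed
  ultimately show ?thesis by (rule Lim_transform_eventually)
qed

text \<open>The only loss in the upper bound is the factor 1 + m/a, which stays bounded as N grows.\<close>

lemma log_series_upper:
  assumes z: "b < z"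
  shows "\<exists>u. u \<longlonglongrightarrow> free_energy z \<and> (\<forall>\<^sub>F N in sequentially. log_series N \<le> u N)"
proof -
  have zc: "0 < z + c" using z c_pos by simp
  let ?s = "\<lambda>N. (\<Sum>j<N. (lam N j + c) / (z - lam N j)) / real N"
  have s_lim: "?s \<longlonglongrightarrow> (\<integral>x. (x + c) / (z - x) \<partial>\<mu>)"
    using z by (intro empirical_limit[where hi = "(b + z) / 2"]) (auto intro!: continuous_intros)
  have "0 \<le> (\<integral>x. (x + c) / (z - x) \<partial>\<mu>)"
  proof (rule integral_nonneg_AE)
    show "AE x in \<mu>. 0 \<le> (x + c) / (z - x)"
      using support by eventually_elim (use z in auto)
  qed
  then have "1 + (\<integral>x. (x + c) / (z - x) \<partial>\<mu>) \<noteq> 0" by linarith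
  from tendsto_mult[OF tendsto_ln[OF tendsto_add[OF tendsto_const s_lim] this] lim_1_over_n]
  have "(\<lambda>N. ln (1 + ?s N) * (1 / real N)) \<longlonglongrightarrow> 0"
    by simp
  from tendsto_add[OF prefactor_tendsto[OF z] this]
  have "(\<lambda>N. prefactor z N + ln (1 + ?s N) * (1 / real N)) \<longlonglongrightarrow> free_energy z"
    by (simp only: add_0_right)
  moreover have "\<forall>\<^sub>F N in sequentially. log_series N \<le> prefactor z N + ln (1 + ?s N) * (1 / real N)"
    using eventually_below[OF z]
  proof eventually_elim
    case (elim N)
    let ?G = "\<Prod>j<N. (1 - (lam N j + c) / (z + c)) powr - \<alpha>"
    let ?C = "\<theta> * real N * (z + c) - real N * \<alpha> * ln (\<theta> * real N * (z + c)) + xlogx (real N * \<alpha>)"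
    let ?S = "sphere_series \<alpha> N (\<lambda>j. lam N j + c) (\<theta> * real N)"
    have l: "0 \<le> lam N j + c" "lam N j + c < z + c" if "j < N" for j
      using elim lam_ge that by auto
    have "0 \<le> (lam N j + c) / (z - lam N j)" if "j < N" for j
      using l[OF that] by simp
    then have "0 \<le> (\<Sum>j<N. (lam N j + c) / (z - lam N j))" by (intro sum_nonneg) auto
    then have s: "0 \<le> ?s N" by simp
    have G: "0 < ?G" using l zc by (intro powr_prod_ln(1)) auto
    have pre: "0 < N" "0 < \<theta> * real N" using elim \<theta> by auto
    have d: "z + c - (lam N j + c) = z - lam N j" for j by simp
    have "?S \<le> ?G * (1 + \<alpha> * (\<Sum>j<N. (lam N j + c) / (z - lam N j)) / (real N * \<alpha>)) * exp ?C"
      by (rule sphere_series_upper(2)[of \<alpha> N "\<theta> * real N" "z + c" "\<lambda>j. lam N j + c",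
            unfolded d, OF \<alpha> pre zc l])
    also have "\<alpha> * (\<Sum>j<N. (lam N j + c) / (z - lam N j)) / (real N * \<alpha>) = ?s N"
      using \<alpha> by simp
    finally have up: "?S \<le> ?G * (1 + ?s N) * exp ?C" .
    have "0 < ?S" using \<alpha> pre zc l by (rule sphere_series_pos)
    have ln_prod3: "ln (E * F * exp D) = ln E + ln F + D" if "0 < E" "0 < F" for E F D :: real
      using that by (simp add: ln_mult)
    have "0 < 1 + ?s N" using s by linarith
    note ln_eq = ln_prod3[OF G this]
    have "ln ?S \<le> ln (?G * (1 + ?s N) * exp ?C)" by (rule ln_mono[OF up \<open>0 < ?S\<close>])
    then have "ln ?S \<le> ln ?G + ln (1 + ?s N) + ?C" unfolding ln_eq .
    then have "ln ?S / real N \<le> (ln ?G + ln (1 + ?s N) + ?C) / real N"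
      by (intro divide_right_mono) auto
    then show ?case
      unfolding log_series_def prefactor_def by (simp add: add_divide_distrib diff_divide_distrib)
  qed
  ultimately show ?thesis by auto
qed

text \<open>The shift n is chosen so that the mean a + n + m of the shifted variable agrees with w = \<theta>N(z +
c) up to o(N); it is nonnegative exactly under the hypothesis on H. Bias and variance are then
negligible, and what remains besides the main term is the cost of the shift.\<close>

lemma log_series_lower:
  assumes z: "b < z" and H: "\<alpha> * hilbert_transform \<mu> z \<le> \<theta>"
  defines "\<mu>0 \<equiv> (z + c) * (\<theta> - \<alpha> * hilbert_transform \<mu> z)"
  shows "\<exists>u. u \<longlonglongrightarrow> free_energy z + \<mu>0 * ln ((b + c) / (z + c))
           \<and> (\<forall>\<^sub>F N in sequentially. u N \<le> log_series N)"
proof -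
  have zc: "0 < z + c" using z c_pos by simp
  have \<mu>0: "0 \<le> \<mu>0" using zc H by (simp add: \<mu>0_def)
  \<comment> \<open>\<mu>0 is the amount per N by which the mean of the unshifted variable falls short of w\<close>
  define n where "n = (\<lambda>N. nat \<lfloor>\<mu>0 * real N\<rfloor>)"
  have n: "real (n N) \<le> \<mu>0 * real N" "\<mu>0 * real N - 1 \<le> real (n N)" for N
    using \<mu>0 unfolding n_def by simp_all
  let ?s = "\<lambda>N. (\<Sum>j<N. (lam N j + c) / (z - lam N j)) / real N"
  let ?v = "\<lambda>N. (\<Sum>j<N. (z + c) * (lam N j + c) / (z - lam N j) ^ 2) / real N"
  let ?t = "\<lambda>N. lam N (top_index N)"
  let ?e = "\<lambda>N. \<alpha> + real (n N) / real N + \<alpha> * ?s N - \<theta> * (z + c)"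
  have n_lim: "(\<lambda>N. real (n N) / real N) \<longlonglongrightarrow> \<mu>0"
  proof (rule tendsto_sandwich)
    show "\<forall>\<^sub>F N in sequentially. \<mu>0 - 1 / real N \<le> real (n N) / real N"
      using eventually_gt_at_top[of 0]
    proof eventually_elim
      case (elim N)
      have "(\<mu>0 * real N - 1) / real N \<le> real (n N) / real N" using n(2) by (intro divide_right_mono) auto
      then show ?case using elim by (simp add: diff_divide_distrib)
    qed
    show "\<forall>\<^sub>F N in sequentially. real (n N) / real N \<le> \<mu>0"
      using eventually_gt_at_top[of 0] by eventually_elim (use n(1) in \<open>simp add: field_simps\<close>)
    show "(\<lambda>N. \<mu>0 - 1 / real N) \<longlonglongrightarrow> \<mu>0"
      using tendsto_diff[OF tendsto_const lim_1_over_n, of \<mu>0] by simp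
  qed simp
  have s_lim: "?s \<longlonglongrightarrow> (\<integral>x. (x + c) / (z - x) \<partial>\<mu>)"
    using z by (intro empirical_limit[where hi = "(b + z) / 2"]) (auto intro!: continuous_intros)
  have s_val: "(\<integral>x. (x + c) / (z - x) \<partial>\<mu>) = (z + c) * hilbert_transform \<mu> z - 1"
  proof -
    have i: "integrable \<mu> (\<lambda>x. 1 / (z - x))"
      using z by (auto intro!: integrable_continuous_on_support continuous_intros)
    have "(\<integral>x. (x + c) / (z - x) \<partial>\<mu>) = (\<integral>x. (z + c) * (1 / (z - x)) - 1 \<partial>\<mu>)"
    proof (rule integral_cong_AE)
      show "AE x in \<mu>. (x + c) / (z - x) = (z + c) * (1 / (z - x)) - 1"
        using support(1) by eventually_elim (use z in \<open>simp add: field_simps\<close>)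
    qed simp_all
    also have "\<dots> = (z + c) * hilbert_transform \<mu> z - 1"
      unfolding hilbert_transform_def
        Bochner_Integration.integral_diff[OF integrable_mult_right[OF i] integrable_const]
        integral_mult_right_zero
      using prob_space by simp
    finally show ?thesis .
  qed
  have v_lim: "?v \<longlonglongrightarrow> (\<integral>x. (z + c) * (x + c) / (z - x) ^ 2 \<partial>\<mu>)"
    using z by (intro empirical_limit[where hi = "(b + z) / 2"]) (auto intro!: continuous_intros)
  have "?e \<longlonglongrightarrow> \<alpha> + \<mu>0 + \<alpha> * ((z + c) * hilbert_transform \<mu> z - 1) - \<theta> * (z + c)"
    using tendsto_diff[OF tendsto_add[OF tendsto_add[OF tendsto_const n_lim]
        tendsto_mult[OF tendsto_const s_lim]] tendsto_const]
    unfolding s_val .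
  also have "\<alpha> + \<mu>0 + \<alpha> * ((z + c) * hilbert_transform \<mu> z - 1) - \<theta> * (z + c) = 0"
    by (simp add: \<mu>0_def algebra_simps)
  finally have e_lim: "?e \<longlonglongrightarrow> 0" .
  have ln_lim: "(\<lambda>N. ln (\<alpha> / (\<mu>0 * real N + 1)) / real N) \<longlonglongrightarrow> 0"
  proof (cases "\<mu>0 = 0")
    case True
    then show ?thesis by (simp add: lim_const_over_n)
  next
    case False
    then have "0 < \<mu>0" using \<mu>0 by simp
    then show ?thesis using \<alpha>(1) by real_asymp
  qed
  let ?u = "\<lambda>N. ln (\<alpha> / (\<mu>0 * real N + 1)) / real N
     + real (n N) / real N * ln ((?t N + c) / (z + c)) + prefactor z N
     - (\<alpha> * ?v N * (1 / real N) + ?e N ^ 2) / (\<theta> * (z + c))"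
  have q_lim: "(\<lambda>N. ln ((?t N + c) / (z + c))) \<longlonglongrightarrow> ln ((b + c) / (z + c))"
    using top_limit zc c_pos by (intro tendsto_ln tendsto_divide tendsto_add tendsto_const) auto
  have err_lim: "(\<lambda>N. (\<alpha> * ?v N * (1 / real N) + ?e N ^ 2) / (\<theta> * (z + c))) \<longlonglongrightarrow>
      (\<alpha> * (\<integral>x. (z + c) * (x + c) / (z - x) ^ 2 \<partial>\<mu>) * 0 + 0 ^ 2) / (\<theta> * (z + c))"
    using \<theta> zc
    by (intro tendsto_divide[OF tendsto_add[OF tendsto_mult[OF tendsto_mult[OF tendsto_const v_lim] lim_1_over_n]
        tendsto_power[OF e_lim]] tendsto_const]) auto
  have "?u \<longlonglongrightarrow> 0 + \<mu>0 * ln ((b + c) / (z + c)) + free_energy z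
      - (\<alpha> * (\<integral>x. (z + c) * (x + c) / (z - x) ^ 2 \<partial>\<mu>) * 0 + 0 ^ 2) / (\<theta> * (z + c))"
    by (rule tendsto_diff[OF tendsto_add[OF tendsto_add[OF ln_lim tendsto_mult[OF n_lim q_lim]]
        prefactor_tendsto[OF z]] err_lim])
  then have "?u \<longlonglongrightarrow> free_energy z + \<mu>0 * ln ((b + c) / (z + c))"
    by (simp add: add.commute)
  moreover have "\<forall>\<^sub>F N in sequentially. ?u N \<le> log_series N"
    using eventually_below[OF z]
  proof eventually_elim
    case (elim N)
    let ?G = "\<Prod>j<N. (1 - (lam N j + c) / (z + c)) powr - \<alpha>"
    let ?C = "\<theta> * real N * (z + c) - real N * \<alpha> * ln (\<theta> * real N * (z + c)) + xlogx (real N * \<alpha>)"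
    let ?S = "sphere_series \<alpha> N (\<lambda>j. lam N j + c) (\<theta> * real N)"
    let ?p = "pochhammer \<alpha> (n N) / fact (n N)"
    let ?q = "(?t N + c) / (z + c)"
    let ?V = "(\<alpha> * (\<Sum>j<N. (z + c) * (lam N j + c) / (z - lam N j) ^ 2)
           + (real N * \<alpha> + real (n N) + \<alpha> * (\<Sum>j<N. (lam N j + c) / (z - lam N j))
           - \<theta> * real N * (z + c)) ^ 2) / (\<theta> * real N * (z + c))"
    have N: "0 < real N" using elim by simp
    have l: "0 \<le> lam N j + c" "lam N j + c < z + c" if "j < N" for j
      using elim lam_ge that by auto
    have G: "0 < ?G" using l zc by (intro powr_prod_ln(1)) auto
    have q: "0 < ?q" using elim zc by simp
    have p: "\<alpha> / (\<mu>0 * real N + 1) \<le> ?p"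
    proof -
      have "\<alpha> / (\<mu>0 * real N + 1) \<le> \<alpha> / real (Suc (n N))"
        using \<alpha> n(1)[of N] \<mu>0 by (intro divide_left_mono) (auto intro!: mult_pos_pos add_nonneg_pos)
      also have "\<dots> \<le> ?p" by (rule pochhammer_over_fact_ge[OF \<alpha>])
      finally show ?thesis .
    qed
    have p0: "0 < \<alpha> / (\<mu>0 * real N + 1)" using \<alpha> \<mu>0 by (auto intro!: divide_pos_pos add_nonneg_pos)
    have "\<alpha> / (\<mu>0 * real N + 1) * ?q ^ n N * ?G * exp (?C - ?V) \<le> ?p * ?q ^ n N * ?G * exp (?C - ?V)"
      using p q G by (intro mult_right_mono) auto
    also have "\<dots> \<le> ?S"
    proof -
      have d: "z + c - (lam N j + c) = z - lam N j" for j by simp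
      have pre: "0 < N" "0 < \<theta> * real N" "top_index N < N"
        using elim \<theta> top_index by auto
      show ?thesis
        by (rule sphere_series_lower[of \<alpha> N "\<theta> * real N" "z + c" "\<lambda>j. lam N j + c" "top_index N" "n N",
              unfolded d, OF \<alpha> pre(1,2) zc l pre(3)])
    qed
    finally have le: "\<alpha> / (\<mu>0 * real N + 1) * ?q ^ n N * ?G * exp (?C - ?V) \<le> ?S" .
    have ln_prod4: "ln (P * Q ^ k * E * exp D) = ln P + real k * ln Q + ln E + D"
      "0 < P * Q ^ k * E * exp D"
      if "0 < P" "0 < Q" "0 < E" for P Q E D :: real and k
      using that by (simp_all add: ln_mult ln_realpow)
    have "ln (\<alpha> / (\<mu>0 * real N + 1) * ?q ^ n N * ?G * exp (?C - ?V)) \<le> ln ?S"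
      by (rule ln_mono[OF le ln_prod4(2)[OF p0 q G]])
    then have "ln (\<alpha> / (\<mu>0 * real N + 1)) + real (n N) * ln ?q + ln ?G + (?C - ?V) \<le> ln ?S"
      unfolding ln_prod4(1)[OF p0 q G] .
    then have "(ln (\<alpha> / (\<mu>0 * real N + 1)) + real (n N) * ln ?q + ln ?G + (?C - ?V)) / real N \<le> ln ?S / real N"
      using N by (intro divide_right_mono) auto
    moreover have "?V / real N = (\<alpha> * ?v N * (1 / real N) + ?e N ^ 2) / (\<theta> * (z + c))"
    proof -
      have e: "?e N = (real N * \<alpha> + real (n N) + \<alpha> * (\<Sum>j<N. (lam N j + c) / (z - lam N j))
           - \<theta> * real N * (z + c)) / real N"
      proof -
        have "\<alpha> + k / M + \<alpha> * (A / M) - \<theta> * W = (M * \<alpha> + k + \<alpha> * A - \<theta> * M * W) / M"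
          if "0 < M" for M k A W using that by (simp add: field_simps)
        then show ?thesis using N by blast
      qed
      have v: "\<alpha> * ?v N = \<alpha> * (\<Sum>j<N. (z + c) * (lam N j + c) / (z - lam N j) ^ 2) / real N"
        by simp
      have ring: "(A + X ^ 2) / (t * M * W) / M = (A / M * (1 / M) + (X / M) ^ 2) / (t * W)"
        if "0 < M" "0 < t" "0 < W" for A X t M W :: real
        using that by (simp add: field_simps power2_eq_square)
      show ?thesis unfolding e v by (rule ring[OF N \<theta> zc])
    qed
    ultimately show ?case
      unfolding log_series_def prefactor_def by (simp add: add_divide_distrib diff_divide_distrib)
  qed
  ultimately show ?thesis by blast
qed

text \<open>At such a point the lower bound needs no shift.\<close>

lemma log_series_tendsto_interior:
  assumes z: "b < z" and H: "\<alpha> * hilbert_transform \<mu> z = \<theta>"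
  shows "log_series \<longlonglongrightarrow> free_energy z"
proof -
  obtain u where u: "u \<longlonglongrightarrow> free_energy z" "\<forall>\<^sub>F N in sequentially. log_series N \<le> u N"
    using log_series_upper[OF z] by blast
  obtain l where l: "l \<longlonglongrightarrow> free_energy z" "\<forall>\<^sub>F N in sequentially. l N \<le> log_series N"
    using log_series_lower[OF z] H by auto
  show ?thesis by (rule tendsto_sandwich[OF l(2) u(2) l(1) u(1)])
qed

context
  assumes H: "\<And>z. b < z \<Longrightarrow> \<alpha> * hilbert_transform \<mu> z \<le> \<theta>"
begin

lemma hilbert_transform_le: "b < z \<Longrightarrow> hilbert_transform \<mu> z \<le> \<theta> / \<alpha>"
  using H[of z] \<alpha> by (simp add: field_simps)

text \<open>An atom at b would make H(z) at least a constant multiple of 1/(z - b), which is unbounded.\<close>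

lemma AE_below_edge: "AE x in \<mu>. x < b"
proof -
  have "measure \<mu> {b} \<le> e" if "0 < e" for e
  proof -
    \<comment> \<open>chosen such that the bound \<theta>/\<alpha> for H(z) leaves room for an atom of mass at most e\<close>
    define z where "z = b + e * \<alpha> / \<theta>"
    have z: "b < z" using that \<alpha> \<theta> by (simp add: z_def)
    have "measure \<mu> {b} / (z - b) = (\<integral>x. indicator {b} x / (z - b) \<partial>\<mu>)" by simp
    also have "\<dots> \<le> hilbert_transform \<mu> z"
      unfolding hilbert_transform_def
    proof (rule integral_mono_AE)
      show "integrable \<mu> (\<lambda>x. indicator {b} x / (z - b))"
        by (intro integrable_bounded_on_support[where B = "1 / (z - b)"])
           (use z in \<open>auto simp: indicator_def\<close>)
      show "AE x in \<mu>. indicator {b} x / (z - b) \<le> 1 / (z - x)"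
        using support(1) by eventually_elim (use z in \<open>auto simp: indicator_def\<close>)
    qed (rule integrable_resolvent[OF z])
    also have "\<dots> \<le> \<theta> / \<alpha>" using z by (rule hilbert_transform_le)
    finally have "measure \<mu> {b} \<le> \<theta> / \<alpha> * (z - b)" using z by (simp add: field_simps)
    also have "\<dots> = e" using \<alpha> \<theta> by (simp add: z_def)
    finally show ?thesis .
  qed
  then have "measure \<mu> {b} = 0"
    using field_le_epsilon[of "measure \<mu> {b}" 0] by (simp add: measure_le_0_iff)
  then have "AE x in \<mu>. x \<noteq> b"
    by (subst AE_iff_measurable[of "{b}"]) (auto simp: emeasure_eq_measure)
  then show ?thesis using support(1) by eventually_elim auto
qed

text \<open>As z decreases to b the functions -ln (z - x) increase to -ln (b - x), which is unbounded if b
lies in the support. Their integrals stay bounded because the difference of two of them is at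
most the integral of 1/(z - x), so monotone convergence applies.\<close>

lemma free_energy_tendsto_edge: "(\<lambda>i. free_energy (b + 1 / real (Suc i))) \<longlonglongrightarrow> free_energy b"
proof -
  define z where "z = (\<lambda>i. b + 1 / real (Suc i))"
  define f where "f = (\<lambda>i x. - ln (\<theta> / \<alpha> * (z i - x)))"
  have z: "b < z i" for i by (simp add: z_def)
  have z_mono: "z j \<le> z i" if "i \<le> j" for i j
    using that by (auto simp: z_def intro!: divide_left_mono)
  have z_lim: "z \<longlonglongrightarrow> b"
    unfolding z_def using tendsto_add[OF tendsto_const LIMSEQ_inverse_real_of_nat, of b]
    by (simp add: inverse_eq_divide)
  have int: "integrable \<mu> (f i)" for i
    unfolding f_def using z[of i] \<alpha> \<theta>
    by (intro integrable_continuous_on_support) (auto intro!: continuous_intros)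
  have f_diff: "f i x - f 0 x \<le> 1 / (z i - x)" if "x < b" for i x
  proof -
    have p: "0 < z i - x" "0 < z 0 - x" using z[of i] z[of 0] that by auto
    have "f i x - f 0 x = ln ((z 0 - x) / (z i - x))"
      unfolding f_def using p \<alpha> \<theta> by (simp add: ln_mult ln_div)
    also have "\<dots> \<le> (z 0 - x) / (z i - x) - 1"
      using p by (intro ln_le_minus_one) auto
    also have "\<dots> = (z 0 - z i) / (z i - x)" using p by (simp add: field_simps)
    also have "\<dots> \<le> 1 / (z i - x)"
      using p by (intro divide_right_mono) (auto simp: z_def)
    finally show ?thesis .
  qed
  have mono: "AE x in \<mu>. mono (\<lambda>i. f i x)"
    using AE_below_edge
  proof eventually_elim
    case (elim x)
    show ?case
    proof (rule monoI)
      fix i j :: nat assume "i \<le> j"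
      then show "f i x \<le> f j x"
        unfolding f_def using z_mono[of i j] z[of j] elim \<alpha> \<theta>
        by (simp add: mult_left_mono divide_right_mono)
    qed
  qed
  have lim: "AE x in \<mu>. (\<lambda>i. f i x) \<longlonglongrightarrow> - ln (\<theta> / \<alpha> * (b - x))"
    using AE_below_edge
  proof eventually_elim
    case (elim x)
    then have "\<theta> / \<alpha> * (b - x) \<noteq> 0" using \<alpha> \<theta> by simp
    then show ?case unfolding f_def
      by (intro tendsto_minus tendsto_ln tendsto_mult tendsto_diff tendsto_const z_lim)
  qed
  have "incseq (\<lambda>i. integral\<^sup>L \<mu> (f i))"
  proof (rule incseq_SucI)
    fix i show "integral\<^sup>L \<mu> (f i) \<le> integral\<^sup>L \<mu> (f (Suc i))"
    proof (rule integral_mono_AE[OF int int])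
      show "AE x in \<mu>. f i x \<le> f (Suc i) x" using mono by eventually_elim (rule incseq_SucD)
    qed
  qed
  moreover have "integral\<^sup>L \<mu> (f i) \<le> integral\<^sup>L \<mu> (f 0) + \<theta> / \<alpha>" for i
  proof -
    have "integral\<^sup>L \<mu> (f i) - integral\<^sup>L \<mu> (f 0) = (\<integral>x. f i x - f 0 x \<partial>\<mu>)"
      using int by simp
    also have "\<dots> \<le> hilbert_transform \<mu> (z i)"
      unfolding hilbert_transform_def
    proof (rule integral_mono_AE)
      show "AE x in \<mu>. f i x - f 0 x \<le> 1 / (z i - x)"
        using AE_below_edge by eventually_elim (rule f_diff)
    qed (intro Bochner_Integration.integrable_diff int integrable_resolvent z)+
    also have "\<dots> \<le> \<theta> / \<alpha>" using z by (rule hilbert_transform_le)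
    finally show ?thesis by simp
  qed
  ultimately obtain L where L: "(\<lambda>i. integral\<^sup>L \<mu> (f i)) \<longlonglongrightarrow> L"
    using incseq_convergent by blast
  have "integral\<^sup>L \<mu> (\<lambda>x. - ln (\<theta> / \<alpha> * (b - x))) = L"
    by (rule integral_monotone_convergence[OF int mono lim L]) simp
  then have "(\<lambda>i. \<integral>x. ln (\<theta> / \<alpha> * (z i - x)) \<partial>\<mu>) \<longlonglongrightarrow> (\<integral>x. ln (\<theta> / \<alpha> * (b - x)) \<partial>\<mu>)"
    using tendsto_minus[OF L] by (simp only: f_def integral_minus minus_minus flip: minus_equation_iff)
  from tendsto_diff[OF tendsto_diff[OF tendsto_mult[OF tendsto_const z_lim] tendsto_const]
      tendsto_mult[OF tendsto_const this], of \<theta> \<alpha> \<alpha>]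
  show ?thesis unfolding free_energy_def z_def .
qed

text \<open>Both bounds are used at points z decreasing to b. The cost of the shift per N is at most (z + c)
\<theta> ln ((z + c)/(b + c)) and tends to 0.\<close>

lemma log_series_tendsto_edge: "log_series \<longlonglongrightarrow> free_energy b"
proof (rule order_tendstoI)
  define z where "z = (\<lambda>i. b + 1 / real (Suc i))"
  have z: "b < z i" for i by (simp add: z_def)
  have F: "(\<lambda>i. free_energy (z i)) \<longlonglongrightarrow> free_energy b"
    unfolding z_def by (rule free_energy_tendsto_edge)
  fix y
  {
    assume "free_energy b < y"
    then obtain i where i: "free_energy (z i) < y"
      using order_tendstoD(2)[OF F] by (auto simp: eventually_sequentially)
    obtain u where u: "u \<longlonglongrightarrow> free_energy (z i)" "\<forall>\<^sub>F N in sequentially. log_series N \<le> u N"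
      using log_series_upper[OF z] by blast
    from u(2) order_tendstoD(2)[OF u(1) i] show "\<forall>\<^sub>F N in sequentially. log_series N < y"
      by eventually_elim simp
  next
    assume y: "y < free_energy b"
    have z_lim: "z \<longlonglongrightarrow> b"
      unfolding z_def using tendsto_add[OF tendsto_const LIMSEQ_inverse_real_of_nat, of b]
      by (simp add: inverse_eq_divide)
    have zc: "0 < z i + c" for i using z[of i] c_pos by simp
    have "(\<lambda>i. ln ((b + c) / (z i + c))) \<longlonglongrightarrow> ln ((b + c) / (b + c))"
      using c_pos by (intro tendsto_ln tendsto_divide tendsto_add tendsto_const z_lim) auto
    from tendsto_add[OF F tendsto_mult[OF tendsto_mult[OF tendsto_add[OF z_lim tendsto_const] tendsto_const] this], of c \<theta>]
    have "(\<lambda>i. free_energy (z i) + (z i + c) * \<theta> * ln ((b + c) / (z i + c))) \<longlonglongrightarrow> free_energy b"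
      using c_pos by simp
    from order_tendstoD(1)[OF this y] obtain i
      where i: "y < free_energy (z i) + (z i + c) * \<theta> * ln ((b + c) / (z i + c))"
      by (auto simp: eventually_sequentially)
    have "0 \<le> hilbert_transform \<mu> (z i)"
      unfolding hilbert_transform_def
      by (rule integral_nonneg_AE, use support(1) in eventually_elim, use z[of i] in auto)
    then have "(z i + c) * (\<theta> - \<alpha> * hilbert_transform \<mu> (z i)) \<le> (z i + c) * \<theta>"
      using zc[of i] \<alpha> by simp
    moreover have "ln ((b + c) / (z i + c)) \<le> 0"
      using z[of i] zc[of i] c_pos by simp
    ultimately have "(z i + c) * \<theta> * ln ((b + c) / (z i + c))
        \<le> (z i + c) * (\<theta> - \<alpha> * hilbert_transform \<mu> (z i)) * ln ((b + c) / (z i + c))"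
      by (rule mult_right_mono_neg)
    with i have i': "y < free_energy (z i)
        + (z i + c) * (\<theta> - \<alpha> * hilbert_transform \<mu> (z i)) * ln ((b + c) / (z i + c))"
      by linarith
    obtain u where u: "u \<longlonglongrightarrow> free_energy (z i)
          + (z i + c) * (\<theta> - \<alpha> * hilbert_transform \<mu> (z i)) * ln ((b + c) / (z i + c))"
        "\<forall>\<^sub>F N in sequentially. u N \<le> log_series N"
      using log_series_lower[OF z H[OF z]] by blast
    from u(2) order_tendstoD(1)[OF u(1) i'] show "\<forall>\<^sub>F N in sequentially. y < log_series N"
      by eventually_elim simp
  }
qed

end

end

end

text \<open>For \<gamma> = \<theta>/\<alpha>, the point where the free energy reaches its infimum over z > b: the critical point
if there is one, and otherwise, the free energy being increasing, the end point b.\<close>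

definition saddle_point :: "real measure \<Rightarrow> real \<Rightarrow> real \<Rightarrow> real \<Rightarrow> bool" where
  "saddle_point \<mu> b \<gamma> z \<longleftrightarrow> b < z \<and> hilbert_transform \<mu> z = \<gamma>
     \<or> z = b \<and> H_max \<mu> b \<le> ereal \<gamma>"

context spectral_limit begin

lemma log_series_tendsto:
  assumes \<alpha>: "0 < \<alpha>" "\<alpha> \<le> 1" and \<theta>: "0 < \<theta>" and z: "saddle_point \<mu> b (\<theta> / \<alpha>) z"
  shows "log_series \<alpha> \<theta> \<longlonglongrightarrow> free_energy \<alpha> \<theta> z"
  using z unfolding saddle_point_def
proof (elim disjE conjE)
  assume "b < z" "hilbert_transform \<mu> z = \<theta> / \<alpha>"
  then show ?thesis using log_series_tendsto_interior[OF \<alpha> \<theta>, of z] \<alpha> by simp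
next
  assume z: "z = b" and H: "H_max \<mu> b \<le> ereal (\<theta> / \<alpha>)"
  have "\<alpha> * hilbert_transform \<mu> y \<le> \<theta>" if "b < y" for y
  proof -
    have "ereal (hilbert_transform \<mu> y) \<le> ereal (\<theta> / \<alpha>)"
      using hilbert_transform_le_H_max[OF that] H by (rule order_trans)
    then show ?thesis using \<alpha> by (simp add: field_simps)
  qed
  then show ?thesis unfolding z by (rule log_series_tendsto_edge[OF \<alpha> \<theta>])
qed

lemma series_tendsto:
  assumes \<alpha>: "0 < \<alpha>" "\<alpha> \<le> 1" and \<theta>: "0 < \<theta>" and z: "saddle_point \<mu> b (\<theta> / \<alpha>) z"
    and S: "\<And>N. 0 < N \<Longrightarrow>
      sphere_series \<alpha> N (\<lambda>j. lam N j + c) (\<theta> * real N) = exp (\<theta> * real N * c) * S N"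
  shows "(\<lambda>N. 1 / real N * ln (S N)) \<longlonglongrightarrow> free_energy \<alpha> \<theta> z"
proof -
  have "\<forall>\<^sub>F N in sequentially. log_series \<alpha> \<theta> N = 1 / real N * ln (S N)"
    using eventually_below[of "b + 1", simplified]
  proof eventually_elim
    case (elim N)
    have "0 < sphere_series \<alpha> N (\<lambda>j. lam N j + c) (\<theta> * real N)"
      using elim \<alpha> \<theta> lam_ge c_pos
      by (intro sphere_series_pos[where z = "b + 1 + c"]) auto
    then have "0 < S N" unfolding S[OF conjunct1[OF elim]] by (simp add: zero_less_mult_iff)
    then have "ln (exp (\<theta> * real N * c) * S N) = \<theta> * real N * c + ln (S N)" by (simp add: ln_mult)
    then show ?case
      using elim by (simp add: log_series_def[OF \<alpha> \<theta>] S add_divide_distrib)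
  qed
  with log_series_tendsto[OF \<alpha> \<theta> z] show ?thesis by (rule Lim_transform_eventually)
qed

end

section \<open>Spectral data of diagonal matrices\<close>

lemma diagonal_char_poly:
  fixes A :: "real mat"
  assumes A: "A \<in> carrier_mat N N" "diagonal_mat A"
  shows "char_poly A = (\<Prod>j<N. [:- A $$ (j, j), 1:])"
proof -
  have "upper_triangular A" using A by (auto simp: upper_triangular_def diagonal_mat_def)
  then have "char_poly A = (\<Prod>a\<leftarrow>diag_mat A. [:- a, 1:])"
    by (rule char_poly_upper_triangular[OF A(1)])
  also have "\<dots> = (\<Prod>j\<leftarrow>[0..<N]. [:- A $$ (j, j), 1:])"
    using A(1) by (simp add: diag_mat_def o_def)
  also have "\<dots> = (\<Prod>j<N. [:- A $$ (j, j), 1:])"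
    by (simp add: prod.distinct_set_conv_list[symmetric] atLeast0LessThan)
  finally show ?thesis .
qed

lemma diagonal_spectrum:
  fixes A :: "real mat"
  assumes A: "A \<in> carrier_mat N N" "diagonal_mat A"
  shows "spectrum A = (\<lambda>j. A $$ (j, j)) ` {..<N}"
proof -
  have "spectrum A = {x. poly (char_poly A) x = 0}"
    unfolding spectrum_def eigenvalue_root_char_poly[OF A(1), symmetric] by auto
  also have "\<dots> = (\<lambda>j. A $$ (j, j)) ` {..<N}"
    unfolding diagonal_char_poly[OF A] by (auto simp: poly_prod)
  finally show ?thesis .
qed

lemma integral_empirical_spectral_measure:
  fixes A :: "real mat" and f :: "real \<Rightarrow> real"
  assumes A: "A \<in> carrier_mat N N" "diagonal_mat A" and N: "0 < N" and f: "f \<in> borel_measurable borel"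
  shows "integral\<^sup>L (empirical_spectral_measure A) f = (\<Sum>j<N. f (A $$ (j, j))) / real N"
proof -
  have ne: "{..<N} \<noteq> {}" using N by auto
  have "proots (char_poly A) = (\<Sum>j<N. {#A $$ (j, j)#})"
    unfolding diagonal_char_poly[OF A] by (subst proots_prod) auto
  also have "\<dots> = image_mset (\<lambda>j. A $$ (j, j)) (mset_set {..<N})"
    by (induction N) (simp_all add: lessThan_Suc)
  finally have "pmf_of_multiset (proots (char_poly A)) = map_pmf (\<lambda>j. A $$ (j, j)) (pmf_of_set {..<N})"
    by (simp only: map_pmf_of_set[OF finite_lessThan ne])
  then have "integral\<^sup>L (empirical_spectral_measure A) f
      = integral\<^sup>L (map_pmf (\<lambda>j. A $$ (j, j)) (pmf_of_set {..<N})) f"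
    unfolding empirical_spectral_measure_def using f by (simp add: integral_distr)
  also have "\<dots> = (\<Sum>j<N. f (A $$ (j, j))) / real N"
    by (simp add: integral_pmf_of_set[OF ne finite_lessThan])
  finally show ?thesis .
qed

lemma real_distribution_empirical: "real_distribution (empirical_spectral_measure A)"
proof -
  have "prob_space (empirical_spectral_measure A)"
    unfolding empirical_spectral_measure_def by (intro measure_pmf.prob_space_distr) simp
  then show ?thesis
    by (simp add: real_distribution_def real_distribution_axioms_def empirical_spectral_measure_def)
qed

text \<open>Weak convergence provides limits for bounded continuous test functions only. Such functions
vanishing up to b (resp. above -c) first show that the limit measure lives between -c and b;
after that a function continuous on a slightly larger interval may be replaced by its
composition with the projection onto that interval.\<close>

lemma spectral_limitI:
  fixes \<mu> :: "real measure" and lam :: "nat \<Rightarrow> nat \<Rightarrow> real" and lo :: "nat \<Rightarrow> real"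
  assumes \<mu>: "real_distribution \<mu>"
    and conv: "\<And>f B. (\<And>x. isCont f x) \<Longrightarrow> (\<And>x. \<bar>f x\<bar> \<le> B) \<Longrightarrow>
        (\<lambda>N. (\<Sum>j<N. f (lam N j)) / real N) \<longlonglongrightarrow> (\<integral>x. f x \<partial>\<mu>)"
    and lo: "convergent lo" "\<And>N j. j < N \<Longrightarrow> lo N \<le> lam N j"
    and top: "\<And>N. 0 < N \<Longrightarrow> top_index N < N" "\<And>N j. j < N \<Longrightarrow> lam N j \<le> lam N (top_index N)"
      "(\<lambda>N. lam N (top_index N)) \<longlonglongrightarrow> b"
  shows "\<exists>c. spectral_limit \<mu> b c lam top_index"
proof -
  interpret real_distribution \<mu> by fact
  obtain C where C: "\<And>N. \<bar>lo N\<bar> \<le> C"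
    using convergent_imp_Bseq[OF lo(1)] by (auto simp: Bseq_def)
  \<comment> \<open>C + 1 makes the shifted eigenvalues positive, and the absolute value makes b + c positive\<close>
  define c where "c = C + 1 + \<bar>b\<bar>"
  have lam_ge: "1 \<le> lam N j + c" if "j < N" for N j
    using lo(2)[OF that] C[of N] by (simp add: c_def)
  have C0: "0 \<le> C" using C[of 0] by linarith
  then have bc: "0 < b + c" by (simp add: c_def)
  \<comment> \<open>a bounded continuous function that is positive exactly on the positive half line\<close>
  define hat where "hat = (\<lambda>y::real. max 0 (min 1 y))"
  have hat: "isCont (\<lambda>x. hat (s * x + d)) x" for s d x
    unfolding hat_def by (intro continuous_intros)
  have hat_bound: "\<bar>hat y\<bar> \<le> 1" "0 \<le> hat y" for y by (auto simp: hat_def)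
  have hat_int: "integrable \<mu> (\<lambda>x. hat (s * x + d))" for s d
  proof (rule integrable_const_bound[where B = 1])
    have "continuous_on UNIV (\<lambda>x. hat (s * x + d))"
      using hat by (auto simp: continuous_on_eq_continuous_at)
    then have "(\<lambda>x. hat (s * x + d)) \<in> borel_measurable borel"
      by (rule borel_measurable_continuous_onI)
    then show "(\<lambda>x. hat (s * x + d)) \<in> borel_measurable \<mu>" by simp
  qed (use hat_bound in simp)
  have vanish: "AE x in \<mu>. s * x + d \<le> 0"
    if lim: "e \<longlonglongrightarrow> 0" and le: "\<And>N j. j < N \<Longrightarrow> hat (s * lam N j + d) \<le> e N" for s d e
  proof -
    have "(\<lambda>N. (\<Sum>j<N. hat (s * lam N j + d)) / real N) \<longlonglongrightarrow> (\<integral>x. hat (s * x + d) \<partial>\<mu>)"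
      using hat hat_bound by (intro conv)
    moreover have "\<forall>\<^sub>F N in sequentially. (\<Sum>j<N. hat (s * lam N j + d)) / real N \<le> e N"
      using eventually_gt_at_top[of 0]
    proof eventually_elim
      case (elim N)
      have "(\<Sum>j<N. hat (s * lam N j + d)) \<le> (\<Sum>j<N. e N)" using le by (intro sum_mono) auto
      then show ?case using elim by (simp add: divide_simps mult.commute)
    qed
    ultimately have "(\<integral>x. hat (s * x + d) \<partial>\<mu>) \<le> 0"
      using lim by (intro tendsto_le[of sequentially]) auto
    moreover have "0 \<le> (\<integral>x. hat (s * x + d) \<partial>\<mu>)" by (intro Bochner_Integration.integral_nonneg hat_bound)
    ultimately have "AE x in \<mu>. hat (s * x + d) = 0"
      using integral_nonneg_eq_0_iff_AE[OF hat_int] hat_bound by auto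
    then show ?thesis by eventually_elim (auto simp: hat_def max_def min_def split: if_splits)
  qed
  have sup1: "AE x in \<mu>. x \<le> b"
  proof -
    have "(\<lambda>N. hat (1 * lam N (top_index N) + - b)) \<longlonglongrightarrow> hat (1 * b + - b)"
      by (rule isCont_tendsto_compose[OF hat top(3)])
    then have "(\<lambda>N. hat (1 * lam N (top_index N) + - b)) \<longlonglongrightarrow> 0" by (simp add: hat_def)
    then have "AE x in \<mu>. 1 * x + - b \<le> 0"
      by (rule vanish) (use top(2) in \<open>force simp: hat_def\<close>)
    then show ?thesis by eventually_elim simp
  qed
  have sup2: "AE x in \<mu>. - c \<le> x"
  proof -
    have "AE x in \<mu>. (- 1) * x + - c \<le> 0"
    proof (rule vanish[OF tendsto_const])
      show "hat ((- 1) * lam N j + - c) \<le> 0" if "j < N" for N j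
        using lam_ge[OF that] by (simp add: hat_def)
    qed
    then show ?thesis by eventually_elim simp
  qed
  have lim: "(\<lambda>N. (\<Sum>j<N. f (lam N j)) / real N) \<longlonglongrightarrow> integral\<^sup>L \<mu> f"
    if hi: "b < hi" and f: "f \<in> borel_measurable borel" "continuous_on {-c..hi} f" for f hi
  proof -
    define g where "g = (\<lambda>x. f (max (- c) (min hi x)))"
    have chi: "- c \<le> hi" using hi bc by linarith
    have "continuous_on UNIV g"
      unfolding g_def by (rule continuous_on_compose2[OF f(2)]) (use chi in \<open>auto intro!: continuous_intros\<close>)
    then have "isCont g x" for x by (simp add: continuous_on_eq_continuous_at)
    moreover have "bounded (f ` {-c..hi})"
      using f(2) by (intro compact_imp_bounded compact_continuous_image) auto
    then obtain B where B: "\<forall>x\<in>{-c..hi}. \<bar>f x\<bar> \<le> B" by (auto simp: bounded_iff)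
    then have "\<bar>g x\<bar> \<le> B" for x unfolding g_def using chi by auto
    ultimately have "(\<lambda>N. (\<Sum>j<N. g (lam N j)) / real N) \<longlonglongrightarrow> integral\<^sup>L \<mu> g" by (rule conv)
    also have "integral\<^sup>L \<mu> g = integral\<^sup>L \<mu> f"
    proof (rule integral_cong_AE)
      show "g \<in> borel_measurable \<mu>" "f \<in> borel_measurable \<mu>" using f(1) unfolding g_def by simp_all
      show "AE x in \<mu>. g x = f x"
        using sup1 sup2 by eventually_elim (use hi in \<open>simp add: g_def\<close>)
    qed
    finally have "(\<lambda>N. (\<Sum>j<N. g (lam N j)) / real N) \<longlonglongrightarrow> integral\<^sup>L \<mu> f" .
    moreover have "\<forall>\<^sub>F N in sequentially. (\<Sum>j<N. g (lam N j)) / real N = (\<Sum>j<N. f (lam N j)) / real N"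
      using order_tendstoD(2)[OF top(3) hi]
    proof eventually_elim
      case (elim N)
      have "g (lam N j) = f (lam N j)" if "j < N" for j
        using elim top(2)[OF that] lam_ge[OF that] by (simp add: g_def max_def min_def)
      then show ?case by simp
    qed
    ultimately show ?thesis by (rule Lim_transform_eventually)
  qed
  have "spectral_limit \<mu> b c lam top_index"
  proof
    show "0 \<le> lam N j + c" if "j < N" for N j using lam_ge[OF that] by simp
  qed (fact sup1 sup2 bc lim top)+
  then show ?thesis ..
qed

section \<open>The function v and the saddle point\<close>

lemma hilbert_transform_mirror:
  assumes "real_distribution \<mu>"
  shows "hilbert_transform (distr \<mu> borel uminus) z = - hilbert_transform \<mu> (- z)"
proof -
  interpret real_distribution \<mu> by fact
  have "hilbert_transform (distr \<mu> borel uminus) z = (\<integral>x. 1 / (z - (- x)) \<partial>\<mu>)"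
    unfolding hilbert_transform_def by (subst integral_distr) auto
  also have "\<dots> = (\<integral>x. - (1 / (- z - x)) \<partial>\<mu>)"
  proof (rule Bochner_Integration.integral_cong[OF refl])
    fix x
    have "z - (- x) = - (- z - x)" by simp
    then show "1 / (z - (- x)) = - (1 / (- z - x))" by (simp only: divide_minus_right)
  qed
  finally show ?thesis by (simp add: hilbert_transform_def)
qed

context
  fixes \<mu> \<mu>' :: "real measure" and a b c c' :: real
  assumes upper: "bounded_support \<mu> b c"
    and lower: "bounded_support (distr \<mu> borel uminus) (- a) c'"
    and ab: "a \<le> b"
  defines "\<mu>' \<equiv> distr \<mu> borel uminus"
begin

interpretation U: bounded_support \<mu> b c by (rule upper)
interpretation L: bounded_support \<mu>' "- a" c' unfolding \<mu>'_def by (rule lower)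

lemma mirror: "hilbert_transform \<mu>' z = - hilbert_transform \<mu> (- z)"
  unfolding \<mu>'_def by (rule hilbert_transform_mirror) (rule U.real_distribution_axioms)

text \<open>Everything below the support is obtained from what is known above the support by the reflection
of x to -x.\<close>

lemma H_min_eq: "H_min \<mu> a = - H_max \<mu>' (- a)"
proof -
  have f: "filterlim uminus (at_right (- a)) (at_left a)"
    by (simp add: filterlim_def at_left_minus filtermap_filtermap)
  have "((\<lambda>z. - ereal (hilbert_transform \<mu>' (- z))) \<longlongrightarrow> - H_max \<mu>' (- a)) (at_left a)"
    by (intro tendsto_uminus_ereal filterlim_compose[OF L.H_max_tendsto f])
  then have "((\<lambda>z. ereal (hilbert_transform \<mu> z)) \<longlongrightarrow> - H_max \<mu>' (- a)) (at_left a)"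
    by (simp add: mirror)
  then show ?thesis unfolding H_min_def by (intro tendsto_Lim) simp_all
qed

lemma H_max_pos: "0 < H_max \<mu> b"
proof -
  have "0 < ereal (hilbert_transform \<mu> (b + 1))" using U.hilbert_transform_bounds(1)[of "b + 1"] by simp
  also have "\<dots> \<le> H_max \<mu> b" by (rule U.hilbert_transform_le_H_max) simp
  finally show ?thesis .
qed

lemma H_min_neg: "H_min \<mu> a < 0"
proof -
  have "0 < ereal (hilbert_transform \<mu>' (- a + 1))" using L.hilbert_transform_bounds(1)[of "- a + 1"] by simp
  also have "\<dots> \<le> H_max \<mu>' (- a)" by (rule L.hilbert_transform_le_H_max) simp
  finally show ?thesis unfolding H_min_eq by (cases "H_max \<mu>' (- a)") auto
qed

lemma inj_hilbert_transform: "inj_on (hilbert_transform \<mu>) (- {a..b})"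
proof (rule inj_onI)
  fix y z assume yz: "y \<in> - {a..b}" "z \<in> - {a..b}" and eq: "hilbert_transform \<mu> y = hilbert_transform \<mu> z"
  have pos: "0 < hilbert_transform \<mu> x" if "b < x" for x
    using that by (rule U.hilbert_transform_bounds)
  have neg: "hilbert_transform \<mu> x < 0" if "x < a" for x
    using L.hilbert_transform_bounds(1)[of "- x"] that by (simp add: mirror)
  consider "b < y" "b < z" | "y < a" "z < a" | "b < y" "z < a" | "y < a" "b < z"
    using yz by fastforce
  then show "y = z"
  proof cases
    case 1
    then show ?thesis
      using U.hilbert_transform_strict_antimono[of y z] U.hilbert_transform_strict_antimono[of z y] eq
      by (cases y z rule: linorder_cases) auto
  next
    case 2
    then show ?thesis
      using L.hilbert_transform_strict_antimono[of "- y" "- z"]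
        L.hilbert_transform_strict_antimono[of "- z" "- y"] eq
      by (cases y z rule: linorder_cases) (auto simp: mirror)
  next
    case 3
    then show ?thesis using pos[of y] neg[of z] eq by simp
  next
    case 4
    then show ?thesis using pos[of z] neg[of y] eq by simp
  qed
qed

lemma K_transform_eq:
  "z \<notin> {a..b} \<Longrightarrow> K_transform \<mu> a b (hilbert_transform \<mu> z) = z"
  unfolding K_transform_def by (intro inv_into_f_f inj_hilbert_transform) simp

text \<open>The three cases in the definition of v, including the values of R at the end point, are one
formula in terms of the saddle point.\<close>

lemma v_fun_pos:
  assumes "0 < \<beta>" "0 < \<theta>"
  shows "\<exists>z. saddle_point \<mu> b (2 * \<theta> / \<beta>) z \<and> v_fun \<beta> \<mu> a b \<theta> = z - \<beta> / (2 * \<theta>)"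
proof -
  define \<gamma> where "\<gamma> = 2 * \<theta> / \<beta>"
  have \<gamma>: "0 < \<gamma>" "2 / \<beta> * \<theta> = \<gamma>" "1 / \<gamma> = \<beta> / (2 * \<theta>)" using assms by (simp_all add: \<gamma>_def)
  have min: "H_min \<mu> a < ereal \<gamma>" using less_trans[OF H_min_neg, of "ereal \<gamma>"] \<gamma>(1) by simp
  show ?thesis
  proof (cases "ereal \<gamma> < H_max \<mu> b")
    case True
    then obtain z where z: "b < z" "hilbert_transform \<mu> z = \<gamma>"
      using U.hilbert_transform_attains[OF \<gamma>(1)] by blast
    have "v_fun \<beta> \<mu> a b \<theta> = K_transform \<mu> a b \<gamma> - 1 / \<gamma>"
      unfolding v_fun_def R_transform_def \<gamma>(2) \<gamma>_def[symmetric] using True min \<gamma>(1) by auto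
    also have "K_transform \<mu> a b \<gamma> = z" using K_transform_eq[of z] z by simp
    finally show ?thesis using z by (auto simp: saddle_point_def \<gamma>(3) \<gamma>_def[symmetric])
  next
    case False
    have "v_fun \<beta> \<mu> a b \<theta> = b - \<beta> / (2 * \<theta>)"
      unfolding v_fun_def R_transform_def \<gamma>(2) \<gamma>_def[symmetric] using False min \<gamma> by auto
    then show ?thesis using False by (auto simp: saddle_point_def \<gamma>_def[symmetric])
  qed
qed

lemma v_fun_neg:
  assumes "0 < \<beta>" "\<theta> < 0"
  shows "\<exists>z. saddle_point \<mu>' (- a) (2 * - \<theta> / \<beta>) (- z) \<and> v_fun \<beta> \<mu> a b \<theta> = z - \<beta> / (2 * \<theta>)"
proof -
  define \<gamma> where "\<gamma> = 2 * \<theta> / \<beta>"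
  have \<gamma>: "\<gamma> < 0" "2 / \<beta> * \<theta> = \<gamma>" "1 / \<gamma> = \<beta> / (2 * \<theta>)" "2 * - \<theta> / \<beta> = - \<gamma>"
    using assms by (simp_all add: \<gamma>_def divide_neg_pos)
  have max: "ereal \<gamma> < H_max \<mu> b" using less_trans[OF _ H_max_pos, of "ereal \<gamma>"] \<gamma>(1) by simp
  have eq: "ereal (- \<gamma>) < H_max \<mu>' (- a) \<longleftrightarrow> H_min \<mu> a < ereal \<gamma>"
    "H_max \<mu>' (- a) \<le> ereal (- \<gamma>) \<longleftrightarrow> ereal \<gamma> \<le> H_min \<mu> a"
    unfolding H_min_eq by (cases "H_max \<mu>' (- a)"; auto)+
  show ?thesis
  proof (cases "H_min \<mu> a < ereal \<gamma>")
    case True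
    then obtain y where y: "- a < y" "hilbert_transform \<mu>' y = - \<gamma>"
      using L.hilbert_transform_attains[of "- \<gamma>"] \<gamma>(1) eq by auto
    have "v_fun \<beta> \<mu> a b \<theta> = K_transform \<mu> a b \<gamma> - 1 / \<gamma>"
      unfolding v_fun_def R_transform_def \<gamma>(2) \<gamma>_def[symmetric] using True max \<gamma>(1) by auto
    also have "K_transform \<mu> a b \<gamma> = - y" using K_transform_eq[of "- y"] y by (simp add: mirror)
    finally show ?thesis
      using y by (intro exI[of _ "- y"]) (simp add: saddle_point_def \<gamma>_def)
  next
    case False
    have "v_fun \<beta> \<mu> a b \<theta> = a - \<beta> / (2 * \<theta>)"
      unfolding v_fun_def R_transform_def \<gamma>(2) \<gamma>_def[symmetric] using False max \<gamma> by auto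
    then show ?thesis
      using False eq unfolding saddle_point_def \<gamma>(4) by (intro exI[of _ a]) auto
  qed
qed

end

section \<open>The limit of the spherical integral\<close>

theorem theorem1p6:
  fixes \<beta> :: real
    and m1 :: "nat \<Rightarrow> real mat measure"
    and m2 :: "nat \<Rightarrow> complex mat measure"
    and E :: "nat \<Rightarrow> real mat"
    and \<mu> :: "real measure"
    and lmin lmax \<theta> :: real
  assumes "\<beta> = 1 \<or> \<beta> = 2"
    and "\<And>N. N \<ge> 1 \<Longrightarrow> haar_prob N (m1 N)"
    and "\<And>N. N \<ge> 1 \<Longrightarrow> haar_prob N (m2 N)"
    and "\<And>N. N \<ge> 1 \<Longrightarrow> E N \<in> carrier_mat N N \<and> diagonal_mat (E N)"
    and "real_distribution \<mu>" and "compact (msupp \<mu>)"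
    and "weak_conv_m (\<lambda>N. empirical_spectral_measure (E N)) \<mu>"
    and "(\<lambda>N. lambda_min (E N)) \<longlonglongrightarrow> lmin"
    and "(\<lambda>N. lambda_max (E N)) \<longlonglongrightarrow> lmax"
  shows "(\<lambda>N. 1 / real N *
            ln (if \<beta> = 1 then orthogonal_integral (m1 N) N \<theta> (E N)
                else unitary_integral (m2 N) N \<theta> (E N)))
         \<longlonglongrightarrow>
           \<theta> * v_fun \<beta> \<mu> lmin lmax \<theta>
           - \<beta> / 2 * (\<integral>x. ln (1 + 2 / \<beta> * \<theta> * v_fun \<beta> \<mu> lmin lmax \<theta>
                                - 2 / \<beta> * \<theta> * x) \<partial>\<mu>)"
proof -
  define \<alpha> where "\<alpha> = \<beta> / 2"
  have \<alpha>: "0 < \<alpha>" "\<alpha> \<le> 1" and \<beta>: "0 < \<beta>" using assms(1) by (auto simp: \<alpha>_def)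
  interpret \<mu>: real_distribution \<mu> by fact
  define d where "d = (\<lambda>N j. E N $$ (j, j))"
  define S where "S = (\<lambda>N. sphere_series \<alpha> N (d N) (\<theta> * real N))"
  define I where "I = (\<lambda>N. if \<beta> = 1 then orthogonal_integral (m1 N) N \<theta> (E N)
                else unitary_integral (m2 N) N \<theta> (E N))"
  have E: "E N \<in> carrier_mat N N" "diagonal_mat (E N)" if "0 < N" for N
    using assms(4)[of N] that by auto
  have I_eq: "I N = S N" if "0 < N" for N
    using assms(1) orthogonal_integral_eq_sphere_series[OF assms(2) _ E, of N \<theta>]
      unitary_integral_eq_sphere_series[OF assms(3) _ E, of N \<theta>] that
    by (auto simp: I_def S_def \<alpha>_def d_def)
  have affine: "sphere_series \<alpha> N (\<lambda>j. s * l j + c) x = exp (x * c) * sphere_series \<alpha> N l (s * x)"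
    if "0 < N" for N s l c x
  proof (cases "\<beta> = 1")
    case True
    interpret haar_isotropic "m1 N" N "1 / 2" using assms(2) that by (intro haar_isotropic_real) auto
    show ?thesis unfolding \<alpha>_def True by (rule sphere_series_affine)
  next
    case False
    then have "\<beta> / 2 = 1" using assms(1) by simp
    interpret haar_isotropic "m2 N" N 1 using assms(3) that by (intro haar_isotropic_complex) auto
    show ?thesis unfolding \<alpha>_def \<open>\<beta> / 2 = 1\<close> by (rule sphere_series_affine)
  qed
  have bounds: "lambda_min (E N) \<le> d N j" "d N j \<le> lambda_max (E N)" if "j < N" for N j
    using that diagonal_spectrum[OF E, of N] unfolding lambda_min_def lambda_max_def d_def by auto
  have attained: "\<exists>j<N. d N j = lambda_min (E N)" "\<exists>j<N. d N j = lambda_max (E N)" if "0 < N" for N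
  proof -
    have "Min (spectrum (E N)) \<in> spectrum (E N)" "Max (spectrum (E N)) \<in> spectrum (E N)"
      using that unfolding diagonal_spectrum[OF E[OF that]] by (intro Min_in Max_in; auto)+
    then show "\<exists>j<N. d N j = lambda_min (E N)" "\<exists>j<N. d N j = lambda_max (E N)"
      unfolding diagonal_spectrum[OF E[OF that]] lambda_min_def lambda_max_def d_def by auto
  qed
  obtain imin where imin: "\<And>N. 0 < N \<Longrightarrow> imin N < N \<and> d N (imin N) = lambda_min (E N)"
    using attained(1) by metis
  obtain imax where imax: "\<And>N. 0 < N \<Longrightarrow> imax N < N \<and> d N (imax N) = lambda_max (E N)"
    using attained(2) by metis
  have lims: "(\<lambda>N. d N (imin N)) \<longlonglongrightarrow> lmin" "(\<lambda>N. d N (imax N)) \<longlonglongrightarrow> lmax"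
  proof -
    have min: "\<forall>\<^sub>F N in sequentially. lambda_min (E N) = d N (imin N)"
      using eventually_gt_at_top[of 0] by eventually_elim (simp add: imin)
    have max: "\<forall>\<^sub>F N in sequentially. lambda_max (E N) = d N (imax N)"
      using eventually_gt_at_top[of 0] by eventually_elim (simp add: imax)
    show "(\<lambda>N. d N (imin N)) \<longlonglongrightarrow> lmin" by (rule Lim_transform_eventually[OF assms(8) min])
    show "(\<lambda>N. d N (imax N)) \<longlonglongrightarrow> lmax" by (rule Lim_transform_eventually[OF assms(9) max])
  qed
  have conv: "(\<lambda>N. (\<Sum>j<N. f (d N j)) / real N) \<longlonglongrightarrow> (\<integral>x. f x \<partial>\<mu>)"
    if f: "\<And>x. isCont f x" "\<And>x. \<bar>f x\<bar> \<le> B" for f B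
  proof -
    have "continuous_on UNIV f" using f(1) by (simp add: continuous_on_eq_continuous_at)
    then have meas: "f \<in> borel_measurable borel" by (rule borel_measurable_continuous_onI)
    have "\<forall>\<^sub>F N in sequentially.
        integral\<^sup>L (empirical_spectral_measure (E N)) f = (\<Sum>j<N. f (d N j)) / real N"
      using eventually_gt_at_top[of 0]
      by eventually_elim (simp add: d_def integral_empirical_spectral_measure[OF E] meas)
    moreover have "(\<lambda>N. integral\<^sup>L (empirical_spectral_measure (E N)) f) \<longlonglongrightarrow> integral\<^sup>L \<mu> f"
      using f by (intro weak_conv_imp_integral_bdd_continuous_conv[OF real_distribution_empirical assms(5,7)]) auto
    ultimately show ?thesis by (rule Lim_transform_eventually[rotated])
  qed
  define \<mu>' where "\<mu>' = distr \<mu> borel uminus"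
  have \<mu>': "real_distribution \<mu>'"
    unfolding \<mu>'_def by (intro \<mu>.real_distribution_distr) simp
  have "\<exists>c. spectral_limit \<mu> lmax c d imax"
  proof (rule spectral_limitI[OF assms(5) conv convergentI[OF assms(8)] bounds(1)])
    show "imax N < N" if "0 < N" for N using imax[OF that] by simp
    show "d N j \<le> d N (imax N)" if "j < N" for N j using bounds(2)[OF that] imax[of N] that by simp
  qed (use lims in simp_all)
  then obtain c where c: "spectral_limit \<mu> lmax c d imax" ..
  have conv': "(\<lambda>N. (\<Sum>j<N. f (- d N j)) / real N) \<longlonglongrightarrow> (\<integral>x. f x \<partial>\<mu>')"
    if f: "\<And>x. isCont f x" "\<And>x. \<bar>f x\<bar> \<le> B" for f B
  proof -
    have "isCont (\<lambda>x. f (- x)) x" for x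
      using isCont_o2[OF isCont_minus[OF continuous_ident] f(1)] .
    then have "(\<lambda>N. (\<Sum>j<N. f (- d N j)) / real N) \<longlonglongrightarrow> (\<integral>x. f (- x) \<partial>\<mu>)"
      using f(2) by (intro conv[of "\<lambda>x. f (- x)" B])
    also have "(\<integral>x. f (- x) \<partial>\<mu>) = (\<integral>x. f x \<partial>\<mu>')"
    proof -
      have "continuous_on UNIV f" using f(1) by (simp add: continuous_on_eq_continuous_at)
      then have "f \<in> borel_measurable borel" by (rule borel_measurable_continuous_onI)
      then show ?thesis unfolding \<mu>'_def by (subst integral_distr) auto
    qed
    finally show ?thesis .
  qed
  have "\<exists>c. spectral_limit \<mu>' (- lmin) c (\<lambda>N j. - d N j) imin"
  proof (rule spectral_limitI[OF \<mu>' conv' convergentI[OF tendsto_minus[OF assms(9)]]])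
    show "imin N < N" if "0 < N" for N using imin[OF that] by simp
    show "- d N j \<le> - d N (imin N)" if "j < N" for N j using bounds(1)[OF that] imin[of N] that by simp
    show "- lambda_max (E N) \<le> - d N j" if "j < N" for N j using bounds(2)[OF that] by simp
    show "(\<lambda>N. - d N (imin N)) \<longlonglongrightarrow> - lmin" by (intro tendsto_minus lims)
  qed
  then obtain c' where c': "spectral_limit \<mu>' (- lmin) c' (\<lambda>N j. - d N j) imin" ..
  have ab: "lmin \<le> lmax"
  proof (rule LIMSEQ_le[OF assms(8,9)], intro exI allI impI)
    fix N :: nat assume "1 \<le> N"
    then show "lambda_min (E N) \<le> lambda_max (E N)" using bounds[of 0 N] by simp
  qed
  note bs = spectral_limit.axioms(1)[OF c] spectral_limit.axioms(1)[OF c', unfolded \<mu>'_def]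
  define v where "v = v_fun \<beta> \<mu> lmin lmax \<theta>"
  have "(\<lambda>N. 1 / real N * ln (S N)) \<longlonglongrightarrow>
      \<theta> * v - \<beta> / 2 * (\<integral>x. ln (1 + 2 / \<beta> * \<theta> * v - 2 / \<beta> * \<theta> * x) \<partial>\<mu>)"
  proof (cases \<theta> "0::real" rule: linorder_cases)
    case equal
    have "S N = 1" for N
      unfolding S_def sphere_series_def equal
      using powser_zero[of "\<lambda>k. spectral_coeff \<alpha> N (d N) k / pochhammer (real N * \<alpha>) k"]
      by (simp add: mult.commute)
    note S_1 = this
    have "\<forall>\<^sub>F N in sequentially. 0 = 1 / real N * ln (S N)"
      using eventually_gt_at_top[of 0] by eventually_elim (simp add: S_1)
    from Lim_transform_eventually[OF tendsto_const this] show ?thesis using equal by simp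
  next
    case greater
    then obtain z where z: "saddle_point \<mu> lmax (2 * \<theta> / \<beta>) z" "v = z - \<beta> / (2 * \<theta>)"
      using v_fun_pos[OF bs ab \<beta>] unfolding v_def by blast
    have "(\<lambda>N. 1 / real N * ln (S N)) \<longlonglongrightarrow> spectral_limit.free_energy \<mu> \<alpha> \<theta> z"
    proof (rule spectral_limit.series_tendsto[OF c \<alpha> greater])
      show "saddle_point \<mu> lmax (\<theta> / \<alpha>) z" using z(1) by (simp add: \<alpha>_def mult.commute)
      show "sphere_series \<alpha> N (\<lambda>j. d N j + c) (\<theta> * real N) = exp (\<theta> * real N * c) * S N"
        if "0 < N" for N using affine[OF that, of 1 "d N" c "\<theta> * real N"] by (simp add: S_def)
    qed
    also have "spectral_limit.free_energy \<mu> \<alpha> \<theta> z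
        = \<theta> * v - \<beta> / 2 * (\<integral>x. ln (1 + 2 / \<beta> * \<theta> * v - 2 / \<beta> * \<theta> * x) \<partial>\<mu>)"
    proof -
      have "1 + 2 / \<beta> * \<theta> * v - 2 / \<beta> * \<theta> * x = \<theta> / \<alpha> * (z - x)" for x
        using greater \<beta> unfolding z(2) \<alpha>_def by (simp add: field_simps)
      moreover have "\<theta> * v = \<theta> * z - \<alpha>" using greater unfolding z(2) \<alpha>_def by (simp add: field_simps)
      ultimately show ?thesis
        unfolding spectral_limit.free_energy_def[OF c \<alpha> greater] by (simp add: \<alpha>_def)
    qed
    finally show ?thesis .
  next
    case less
    then have \<theta>': "0 < - \<theta>" by simp
    obtain z where z: "saddle_point \<mu>' (- lmin) (2 * - \<theta> / \<beta>) (- z)" "v = z - \<beta> / (2 * \<theta>)"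
      using v_fun_neg[OF bs ab \<beta> less] unfolding v_def \<mu>'_def by blast
    have "(\<lambda>N. 1 / real N * ln (S N)) \<longlonglongrightarrow> spectral_limit.free_energy \<mu>' \<alpha> (- \<theta>) (- z)"
    proof (rule spectral_limit.series_tendsto[OF c' \<alpha> \<theta>'])
      show "saddle_point \<mu>' (- lmin) (- \<theta> / \<alpha>) (- z)" using z(1) by (simp add: \<alpha>_def mult.commute)
      show "sphere_series \<alpha> N (\<lambda>j. - d N j + c') (- \<theta> * real N) = exp (- \<theta> * real N * c') * S N"
        if "0 < N" for N using affine[OF that, of "- 1" "d N" c' "- \<theta> * real N"] by (simp add: S_def)
    qed
    also have "spectral_limit.free_energy \<mu>' \<alpha> (- \<theta>) (- z)
        = \<theta> * v - \<beta> / 2 * (\<integral>x. ln (1 + 2 / \<beta> * \<theta> * v - 2 / \<beta> * \<theta> * x) \<partial>\<mu>)"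
    proof -
      have "1 + 2 / \<beta> * \<theta> * v - 2 / \<beta> * \<theta> * x = - \<theta> / \<alpha> * (- z - - x)" for x
        using less \<beta> unfolding z(2) \<alpha>_def by (simp add: field_simps)
      moreover have "\<theta> * v = - \<theta> * - z - \<alpha>" using less unfolding z(2) \<alpha>_def by (simp add: field_simps)
      moreover have "(\<integral>x. ln (- \<theta> / \<alpha> * (- z - x)) \<partial>\<mu>') = (\<integral>x. ln (- \<theta> / \<alpha> * (- z - - x)) \<partial>\<mu>)"
        unfolding \<mu>'_def by (rule integral_distr) auto
      ultimately show ?thesis
        unfolding spectral_limit.free_energy_def[OF c' \<alpha> \<theta>'] by (simp only: \<alpha>_def)
    qed
    finally show ?thesis .
  qed
  moreover have "\<forall>\<^sub>F N in sequentially. 1 / real N * ln (S N) = 1 / real N * ln (I N)"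
    using eventually_gt_at_top[of 0] by eventually_elim (simp add: I_eq)
  ultimately show ?thesis unfolding I_def v_def by (rule Lim_transform_eventually)
qed

end
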